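(* Let $n\ge 3$ and let $\mathbb{H}^n/\mathbb{Z}^{n-2}$ be equipped with its standard hyperbolic metric. There exist a complete connected Riemannian manifold $(M^n,g)$ that is not (globally) hyperbolic, and compact subsets $K\subset M$ and $K'\subset \mathbb{H}^n/\mathbb{Z}^{n-2}$, such that (1) the scalar curvature satisfies $R_g\ge -n(n-1)$ on $M$; and (2) $M\setminus K$ is isometric to $(\mathbb{H}^n/\mathbb{Z}^{n-2})\setminus K'$.
   Context: Represent hyperbolic $n$-space by the upper half-space $\{(x,\boldsymbol{y},z): x\in\mathbb{R},\ \boldsymbol{y}\in\mathbb{R}^{n-2},\ z>0\}$ with metric $z^{-2}(dz^2+dx^2+|d\boldsymbol{y}|^2)$. The group $\mathbb{Z}^{n-2}$ acts by translating $\boldsymbol{y}$ along the lattice $2\pi\mathbb{Z}^{n-2}\subset\mathbb{R}^{n-2}$, keeping $x,z$ fixed; $\mathbb{H}^n/\mathbb{Z}^{n-2}$ is the quotient, with the induced hyperbolic metric $g_H=z^{-2}(dz^2+dx^2)+z^{-2}g_{\mathbb{T}^{n-2}}$, where $g_{\mathbb{T}^{n-2}}$ is the induced flat metric on $\mathbb{T}^{n-2}=\mathbb{R}^{n-2}/2\pi\mathbb{Z}^{n-2}$. "Not (globally) hyperbolic" means that $g$ does not have constant sectional curvature $-1$ on all of $M$. All manifolds are assumed orientable; $M$ is without boundary. *)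

theory Defs
  imports "HOL-Analysis.Analysis"
begin

section \<open>Smooth maps between Euclidean spaces\<close>

text \<open>Both notions below are meant for open \<open>S\<close> only, since derivatives are taken at full
  neighbourhoods.\<close>

primrec C_k_on ::
  "nat \<Rightarrow> 'a::real_normed_vector set \<Rightarrow> ('a \<Rightarrow> 'b::real_normed_vector) \<Rightarrow> bool" where
  "C_k_on 0 S f \<longleftrightarrow> continuous_on S f"
| "C_k_on (Suc k) S f \<longleftrightarrow>
     (\<forall>x\<in>S. f differentiable (at x)) \<and> (\<forall>v. C_k_on k S (\<lambda>x. frechet_derivative f (at x) v))"

definition smooth_on :: "'a::real_normed_vector set \<Rightarrow> ('a \<Rightarrow> 'b::real_normed_vector) \<Rightarrow> bool" where
  "smooth_on S f \<longleftrightarrow> (\<forall>k. C_k_on k S f)"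


section \<open>Smooth manifolds\<close>

text \<open>A chart is given by its inverse: a pair of an open set \<open>V\<close> of coordinates and a
  parametrization \<open>\<psi>\<close> of an open set \<open>\<psi> ` V\<close> of the manifold. Values of \<open>\<psi>\<close> outside \<open>V\<close> are
  irrelevant.\<close>

type_synonym ('p, 'n) chart = "(real^'n) set \<times> (real^'n \<Rightarrow> 'p)"

definition is_chart :: "'p topology \<Rightarrow> ('p, 'n::finite) chart \<Rightarrow> bool" where
  "is_chart X = (\<lambda>(V, \<psi>). open V \<and> openin X (\<psi> ` V) \<and>
     homeomorphic_map (top_of_set V) (subtopology X (\<psi> ` V)) \<psi>)"

definition chart_range :: "('p, 'n::finite) chart \<Rightarrow> 'p set" where
  "chart_range c = snd c ` fst c"

definition local_rep ::
  "('p, 'n::finite) chart \<Rightarrow> ('q, 'm::finite) chart \<Rightarrow> ('p \<Rightarrow> 'q) \<Rightarrow> real^'n \<Rightarrow> real^'m" where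
  "local_rep c c' f = inv_into (fst c') (snd c') \<circ> f \<circ> snd c"

definition local_dom ::
  "('p, 'n::finite) chart \<Rightarrow> ('q, 'm::finite) chart \<Rightarrow> 'p set \<Rightarrow> ('p \<Rightarrow> 'q) \<Rightarrow> (real^'n) set" where
  "local_dom c c' U f = {x \<in> fst c. snd c x \<in> U \<and> f (snd c x) \<in> chart_range c'}"

text \<open>The coordinate change from \<open>c\<close> to \<open>c'\<close> is the local representation of the identity. An
  atlas need not be maximal.\<close>

definition smooth_atlas :: "'p topology \<Rightarrow> ('p, 'n::finite) chart set \<Rightarrow> bool" where
  "smooth_atlas X A \<longleftrightarrow>
     (\<forall>c\<in>A. is_chart X c) \<and>
     (\<Union>c\<in>A. chart_range c) = topspace X \<and>
     (\<forall>c\<in>A. \<forall>c'\<in>A. smooth_on (local_dom c c' UNIV id) (local_rep c c' id))"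

definition smooth_manifold :: "'p topology \<Rightarrow> ('p, 'n::finite) chart set \<Rightarrow> bool" where
  "smooth_manifold X A \<longleftrightarrow> Hausdorff_space X \<and> second_countable X \<and> smooth_atlas X A"

definition orientable :: "'p topology \<Rightarrow> ('p, 'n::finite) chart set \<Rightarrow> bool" where
  "orientable X A \<longleftrightarrow>
     (\<exists>B. smooth_atlas X B \<and> smooth_atlas X (A \<union> B) \<and>
        (\<forall>c\<in>B. \<forall>c'\<in>B. \<forall>x\<in>local_dom c c' UNIV id.
           0 < det (jacobian (local_rep c c' id) (at x))))"


section \<open>Riemannian manifolds\<close>

text \<open>\<open>metric M c x\<close> is the matrix \<open>(g\<^sub>i\<^sub>j)\<close> of the metric tensor in the chart \<open>c\<close> at the
  coordinate vector \<open>x\<close>.\<close>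

record ('p, 'n::finite) riem =
  mtop :: "'p topology"
  atlas :: "('p, 'n) chart set"
  metric :: "('p, 'n) chart \<Rightarrow> real^'n \<Rightarrow> real^'n^'n"

definition pullback_matrix :: "(real^'n \<Rightarrow> real^'m) \<Rightarrow> (real^'m \<Rightarrow> real^'m^'m) \<Rightarrow>
    real^'n::finite \<Rightarrow> real^'n^'n::finite" where
  "pullback_matrix F G x =
     transpose (jacobian F (at x)) ** G (F x) ** jacobian F (at x)"

definition riemannian_manifold :: "('p, 'n::finite) riem \<Rightarrow> bool" where
  "riemannian_manifold M \<longleftrightarrow>
     smooth_manifold (mtop M) (atlas M) \<and>
     (\<forall>c\<in>atlas M. smooth_on (fst c) (metric M c) \<and>
        (\<forall>x\<in>fst c. transpose (metric M c x) = metric M c x \<and>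
           (\<forall>v. v \<noteq> 0 \<longrightarrow> 0 < v \<bullet> (metric M c x *v v)))) \<and>
     (\<forall>c\<in>atlas M. \<forall>c'\<in>atlas M. \<forall>x\<in>local_dom c c' UNIV id.
        metric M c x = pullback_matrix (local_rep c c' id) (metric M c') x)"

subsection \<open>Completeness\<close>

text \<open>\<open>joined M p q L\<close>: there is a piecewise \<open>C\<^sup>1\<close> curve of length \<open>L\<close> from \<open>p\<close> to \<open>q\<close>. By
  compactness, such a curve is a finite concatenation of \<open>C\<^sup>1\<close> arcs (one-sided derivatives at the
  end points), each contained in the range of one chart.\<close>

inductive joined :: "('p, 'n::finite) riem \<Rightarrow> 'p \<Rightarrow> 'p \<Rightarrow> real \<Rightarrow> bool" for M where
  arc: "\<lbrakk>(V, \<psi>) \<in> atlas M; u ` {0..1} \<subseteq> V;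
         \<And>t. t \<in> {0..1} \<Longrightarrow> (u has_vector_derivative u' t) (at t within {0..1});
         continuous_on {0..1} u'\<rbrakk> \<Longrightarrow>
       joined M (\<psi> (u 0)) (\<psi> (u 1))
         (integral {0..1} (\<lambda>t. sqrt (u' t \<bullet> (metric M (V, \<psi>) (u t) *v u' t))))"
| concat: "\<lbrakk>joined M p q L; joined M q r L'\<rbrakk> \<Longrightarrow> joined M p r (L + L')"

text \<open>The infimum is over a nonempty set when \<open>M\<close> is connected, the only case of interest.\<close>

definition riem_dist :: "('p, 'n::finite) riem \<Rightarrow> 'p \<Rightarrow> 'p \<Rightarrow> real" where
  "riem_dist M p q = Inf {L. joined M p q L}"

definition complete_riem :: "('p, 'n::finite) riem \<Rightarrow> bool" where
  "complete_riem M \<longleftrightarrow>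
     (\<forall>\<sigma>. range \<sigma> \<subseteq> topspace (mtop M) \<and>
        (\<forall>\<epsilon>>0. \<exists>N. \<forall>i\<ge>N. \<forall>j\<ge>N. riem_dist M (\<sigma> i) (\<sigma> j) < \<epsilon>) \<longrightarrow>
        (\<exists>q\<in>topspace (mtop M). (\<lambda>i. riem_dist M (\<sigma> i) q) \<longlonglongrightarrow> 0))"

subsection \<open>Curvature in local coordinates\<close>

definition partial :: "'n::finite \<Rightarrow> (real^'n \<Rightarrow> real) \<Rightarrow> real^'n \<Rightarrow> real" where
  "partial i f x = frechet_derivative f (at x) (axis i 1)"

text \<open>\<open>christoffel G k i j\<close> is \<open>\<Gamma>\<^sup>k\<^sub>i\<^sub>j\<close>.\<close>

definition christoffel ::
  "(real^'n \<Rightarrow> real^'n^'n) \<Rightarrow> 'n \<Rightarrow> 'n \<Rightarrow> 'n::finite \<Rightarrow> real^'n \<Rightarrow> real" where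
  "christoffel G k i j x = (1/2) * (\<Sum>l\<in>UNIV. matrix_inv (G x) $ k $ l *
     (partial i (\<lambda>y. G y $ j $ l) x + partial j (\<lambda>y. G y $ i $ l) x
      - partial l (\<lambda>y. G y $ i $ j) x))"

text \<open>\<open>riemann_coeff G l k i j\<close> is the \<open>\<partial>\<^sub>l\<close>-component of \<open>R(\<partial>\<^sub>i, \<partial>\<^sub>j)\<partial>\<^sub>k\<close>, where
  \<open>R(X, Y)Z = \<nabla>\<^sub>X\<nabla>\<^sub>Y Z - \<nabla>\<^sub>Y\<nabla>\<^sub>X Z - \<nabla>\<^bsub>[X,Y]\<^esub> Z\<close>; with this sign the sectional curvature is
  \<open>g(R(v, w)w, v)\<close> for orthonormal \<open>v\<close>, \<open>w\<close>, and the Ricci tensor is the trace of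
  \<open>X \<mapsto> R(X, Y)Z\<close>.\<close>

definition riemann_coeff ::
  "(real^'n \<Rightarrow> real^'n^'n) \<Rightarrow> 'n \<Rightarrow> 'n \<Rightarrow> 'n \<Rightarrow> 'n::finite \<Rightarrow> real^'n \<Rightarrow> real" where
  "riemann_coeff G l k i j x =
     partial i (christoffel G l j k) x - partial j (christoffel G l i k) x
     + (\<Sum>m\<in>UNIV. christoffel G l i m x * christoffel G m j k x
                - christoffel G l j m x * christoffel G m i k x)"

definition curvature_op ::
  "(real^'n \<Rightarrow> real^'n^'n) \<Rightarrow> real^'n \<Rightarrow> real^'n \<Rightarrow> real^'n \<Rightarrow> real^'n \<Rightarrow> real^'n::finite" where
  "curvature_op G x v w z =
     (\<chi> l. \<Sum>i\<in>UNIV. \<Sum>j\<in>UNIV. \<Sum>k\<in>UNIV. riemann_coeff G l k i j x * v $ i * w $ j * z $ k)"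

definition sectional_curvature ::
  "(real^'n \<Rightarrow> real^'n^'n) \<Rightarrow> real^'n \<Rightarrow> real^'n \<Rightarrow> real^'n::finite \<Rightarrow> real" where
  "sectional_curvature G x v w =
     (v \<bullet> (G x *v curvature_op G x v w w)) /
     ((v \<bullet> (G x *v v)) * (w \<bullet> (G x *v w)) - (v \<bullet> (G x *v w))\<^sup>2)"

definition ricci :: "(real^'n \<Rightarrow> real^'n^'n) \<Rightarrow> 'n \<Rightarrow> 'n::finite \<Rightarrow> real^'n \<Rightarrow> real" where
  "ricci G j k x = (\<Sum>i\<in>UNIV. riemann_coeff G i k i j x)"

definition scalar_curvature :: "(real^'n \<Rightarrow> real^'n^'n) \<Rightarrow> real^'n::finite \<Rightarrow> real" where
  "scalar_curvature G x = (\<Sum>j\<in>UNIV. \<Sum>k\<in>UNIV. matrix_inv (G x) $ j $ k * ricci G j k x)"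

definition hyperbolic :: "('p, 'n::finite) riem \<Rightarrow> bool" where
  "hyperbolic M \<longleftrightarrow>
     (\<forall>c\<in>atlas M. \<forall>x\<in>fst c. \<forall>v w. v \<noteq> w \<and> independent {v, w} \<longrightarrow>
        sectional_curvature (metric M c) x v w = -1)"

subsection \<open>Isometries\<close>

definition smooth_map ::
  "('p, 'n::finite) riem \<Rightarrow> 'p set \<Rightarrow> ('q, 'm::finite) riem \<Rightarrow> ('p \<Rightarrow> 'q) \<Rightarrow> bool" where
  "smooth_map M U N f \<longleftrightarrow> continuous_map (subtopology (mtop M) U) (mtop N) f \<and>
     (\<forall>c\<in>atlas M. \<forall>c'\<in>atlas N. smooth_on (local_dom c c' U f) (local_rep c c' f))"

text \<open>\<open>U\<close> and \<open>U'\<close> are meant to be open subsets, regarded as Riemannian manifolds with the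
  restricted metrics.\<close>

definition isometric_subsets ::
  "('p, 'n::finite) riem \<Rightarrow> 'p set \<Rightarrow> ('q, 'n) riem \<Rightarrow> 'q set \<Rightarrow> bool" where
  "isometric_subsets M U N U' \<longleftrightarrow>
     (\<exists>f f'. homeomorphic_maps (subtopology (mtop M) U) (subtopology (mtop N) U') f f' \<and>
        smooth_map M U N f \<and> smooth_map N U' M f' \<and>
        (\<forall>c\<in>atlas M. \<forall>c'\<in>atlas N. \<forall>x\<in>local_dom c c' U f.
           metric M c x = pullback_matrix (local_rep c c' f) (metric N c') x))"


section \<open>The hyperbolic manifold \<open>\<H>\<^sup>n / \<int>\<^sup>n\<^sup>-\<^sup>2\<close>\<close>

text \<open>The index \<open>a\<close> labels the coordinate \<open>x\<close>, the index \<open>b\<close> the coordinate \<open>z\<close>, and the remaining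
  indices the \<open>n - 2\<close> coordinates of \<open>\<^bold>y\<close>. Points of the quotient are orbits.\<close>

definition upper_half_space :: "'n::finite \<Rightarrow> (real^'n) set" where
  "upper_half_space b = {p. 0 < p $ b}"

definition y_lattice :: "'n \<Rightarrow> 'n::finite \<Rightarrow> (real^'n) set" where
  "y_lattice a b = {t. t $ a = 0 \<and> t $ b = 0 \<and> (\<forall>i. t $ i \<in> \<int>)}"

definition orbit :: "'n \<Rightarrow> 'n::finite \<Rightarrow> real^'n \<Rightarrow> (real^'n) set" where
  "orbit a b p = {p + (2 * pi) *\<^sub>R t | t. t \<in> y_lattice a b}"

definition quotient_topology ::
  "'a::topological_space set \<Rightarrow> ('a \<Rightarrow> 'b) \<Rightarrow> 'b topology" where
  "quotient_topology S \<pi> =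
     topology (\<lambda>U. U \<subseteq> \<pi> ` S \<and> openin (top_of_set S) {x \<in> S. \<pi> x \<in> U})"

lemma openin_quotient_topology:
  "openin (quotient_topology S \<pi>) U \<longleftrightarrow>
     U \<subseteq> \<pi> ` S \<and> openin (top_of_set S) {x \<in> S. \<pi> x \<in> U}"
proof -
  have "istopology (\<lambda>U. U \<subseteq> \<pi> ` S \<and> openin (top_of_set S) {x \<in> S. \<pi> x \<in> U})"
    unfolding istopology_def
  proof (intro conjI allI impI)
    fix U W
    assume U: "U \<subseteq> \<pi> ` S \<and> openin (top_of_set S) {x \<in> S. \<pi> x \<in> U}"
      and W: "W \<subseteq> \<pi> ` S \<and> openin (top_of_set S) {x \<in> S. \<pi> x \<in> W}"
    have "{x \<in> S. \<pi> x \<in> U \<inter> W} = {x \<in> S. \<pi> x \<in> U} \<inter> {x \<in> S. \<pi> x \<in> W}" by auto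
    then show "openin (top_of_set S) {x \<in> S. \<pi> x \<in> U \<inter> W}" using U W by auto
    show "U \<inter> W \<subseteq> \<pi> ` S" using U by auto
  next
    fix \<U>
    assume U: "\<forall>U\<in>\<U>. U \<subseteq> \<pi> ` S \<and> openin (top_of_set S) {x \<in> S. \<pi> x \<in> U}"
    have "{x \<in> S. \<pi> x \<in> \<Union>\<U>} = (\<Union>U\<in>\<U>. {x \<in> S. \<pi> x \<in> U})" by auto
    then show "openin (top_of_set S) {x \<in> S. \<pi> x \<in> \<Union>\<U>}" using U by auto
    show "\<Union>\<U> \<subseteq> \<pi> ` S" using U by auto
  qed
  then show ?thesis by (simp add: quotient_topology_def topology_inverse')
qed

text \<open>The charts are the local inverses of the projection, so in each of them the metric is
  \<open>z\<^sup>-\<^sup>2(dx\<^sup>2 + |d\<^bold>y|\<^sup>2 + dz\<^sup>2)\<close>.\<close>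

definition hyperbolic_quotient :: "'n \<Rightarrow> 'n::finite \<Rightarrow> ((real^'n) set, 'n) riem" where
  "hyperbolic_quotient a b = \<lparr>
     mtop = quotient_topology (upper_half_space b) (orbit a b),
     atlas = {(V, orbit a b) | V.
                open V \<and> V \<subseteq> upper_half_space b \<and> inj_on (orbit a b) V},
     metric = (\<lambda>_ p. (1 / (p $ b)\<^sup>2) *\<^sub>R mat 1)\<rparr>"

end

theory Submission
  imports Defs
begin

text \<open>The hyperbolic metric is \<open>z\<^sup>-\<^sup>2\<close> times the flat metric \<open>dx\<^sup>2 + dz\<^sup>2 + |d\<^bold>y|\<^sup>2\<close>. In the half-plane take polar
coordinates \<open>(\<rho>, \<theta>)\<close> about a point \<open>(0, z\<^sub>0)\<close>, and let \<open>\<phi>\<close> be one of the circle coordinates of \<open>\<^bold>y\<close>.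
Outside the disc \<open>\<rho> \<le> 4\<close> the flat metric is \<open>d\<rho>\<^sup>2 + d\<phi>\<^sup>2 + \<rho>\<^sup>2 d\<theta>\<^sup>2 + |d\<^bold>y'|\<^sup>2\<close>, where \<open>\<^bold>y'\<close> are the
remaining circle coordinates. Now read \<open>(exp (\<rho> - 4), \<phi>)\<close> as polar coordinates of a point \<open>p\<close> of
the plane: since \<open>\<rho> = 4 + log |p|\<close>, the flat metric becomes
\<open>exp (2 (4 - A)) |dp|\<^sup>2 + A\<^sup>2 d\<theta>\<^sup>2 + |d\<^bold>y'|\<^sup>2\<close> with \<open>A = 4 + log |p|\<close>, and the hyperbolic metric is
obtained by dividing by \<open>f\<^sup>2\<close>, where \<open>f = z\<^sub>0 + A cos \<theta>\<close>.

These formulas make sense for any positive function \<open>A\<close> on the whole plane. Replacing \<open>log |p|\<close>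
for \<open>|p| < 1\<close> by a smooth subharmonic radial function discards the disc \<open>\<rho> \<le> 4\<close> and fills in the
circle \<open>\<phi>\<close> by a disc instead. As \<open>\<theta>\<close> and \<open>\<^bold>y'\<close> are again \<open>n - 2\<close> periodic coordinates, the new
manifold is the quotient of the open set \<open>f > 0\<close> of \<open>\<real>\<^sup>n\<close> by the same lattice as before, and it is
unchanged outside the image of \<open>|p| \<le> 1\<close>, which is compact (\<open>isometric_ends\<close>).

Let \<open>q = exp (2 (A - 4)) \<Delta>A\<close> and \<open>E = 1 - exp (2 (A - 4)) |\<nabla>A|\<^sup>2\<close>; both vanish for \<open>|p| \<ge> 1\<close>. The
metric before division by \<open>f\<^sup>2\<close> has scalar curvature \<open>2 q (1 - 1 / A)\<close>, and after it
\<open>R + n (n - 1) = 2 f\<^sup>2 q (1 - 1 / A) + 2 (n - 1) f cos \<theta> (q - E / A) + n (n - 1) E cos\<^sup>2 \<theta>\<close>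
(\<open>scalar_curvature_cap\<close>). If \<open>A \<ge> 2\<close> and \<open>0 \<le> E \<le> 2 q\<close>, the middle term is at most \<open>2 (n - 1) f q\<close>
in absolute value, so the term quadratic in \<open>f\<close> wins on \<open>|p| < 1\<close> once \<open>z\<^sub>0\<close>, and with it \<open>f\<close>, is large. The
condition \<open>E \<le> 2 q\<close> requires \<open>\<Delta>A\<close> to be positive wherever \<open>E\<close> is; it holds for \<open>A = 4 + log v / 2\<close>, \<open>v = s + exp (- 4 / (1 - s))\<close>, \<open>s = |p|\<^sup>2 < 1\<close>
(\<open>defect_bounds\<close>). At \<open>p = 0\<close> the inequality is strict, and so the metric is not hyperbolic.

For completeness, \<open>|\<nabla> log f| \<le> 1\<close> because \<open>E \<ge> 0\<close>, and likewise \<open>log (f + A)\<close> is Lipschitz. A Cauchy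
sequence therefore stays in a region where \<open>f\<close> is bounded away from \<open>0\<close> and \<open>A\<close> is bounded, and
such regions are compact modulo the lattice (\<open>complete_if_proper\<close>).\<close>

section \<open>Calculus of smooth maps\<close>

lemma C_k_on_SucE:
  assumes "C_k_on (Suc k) S f"
  shows "\<And>x. x \<in> S \<Longrightarrow> (f has_derivative frechet_derivative f (at x)) (at x)"
    and "\<And>v. C_k_on k S (\<lambda>x. frechet_derivative f (at x) v)"
  using assms[unfolded C_k_on.simps(2)] iffD1[OF frechet_derivative_works] by blast+

lemma C_k_on_cong:
  assumes "open S" and "\<And>x. x \<in> S \<Longrightarrow> f x = g x" and "C_k_on k S g"
  shows "C_k_on k S f"
  using assms(2,3)
proof (induction k arbitrary: f g)
  case 0
  then show ?case using continuous_on_cong[of S S f g] by simp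
next
  case (Suc k)
  have deriv: "f differentiable (at x)" "frechet_derivative f (at x) = frechet_derivative g (at x)"
    if x: "x \<in> S" for x
  proof -
    have "(g has_derivative frechet_derivative g (at x)) (at x)"
      using C_k_on_SucE(1)[OF Suc.prems(2) x] .
    then have "(f has_derivative frechet_derivative g (at x)) (at x)"
      by (rule has_derivative_transform_within_open[OF _ \<open>open S\<close> x]) (simp add: Suc.prems(1))
    then show "f differentiable (at x)" "frechet_derivative f (at x) = frechet_derivative g (at x)"
      by (auto simp: differentiable_def dest: frechet_derivative_at)
  qed
  show ?case
    unfolding C_k_on.simps
  proof (intro conjI ballI allI)
    fix v
    show "C_k_on k S (\<lambda>x. frechet_derivative f (at x) v)"
      by (rule Suc.IH[OF _ C_k_on_SucE(2)[OF Suc.prems(2)]]) (simp add: deriv)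
  qed (rule deriv)
qed

lemma C_k_on_local:
  assumes "\<And>x. x \<in> S \<Longrightarrow> \<exists>N. open N \<and> x \<in> N \<and> C_k_on k N f"
  shows "C_k_on k S f"
  using assms
proof (induction k arbitrary: f)
  case 0
  have "isCont f x" if "x \<in> S" for x
    using 0[OF that] by (auto simp: continuous_on_eq_continuous_at)
  then show ?case by (simp add: continuous_at_imp_continuous_on)
next
  case (Suc k)
  show ?case
    unfolding C_k_on.simps
  proof (intro conjI ballI allI)
    show "f differentiable at x" if "x \<in> S" for x
      using Suc.prems[OF that] by auto
    show "C_k_on k S (\<lambda>x. frechet_derivative f (at x) v)" for v
      by (rule Suc.IH) (use Suc.prems in fastforce)
  qed
qed

text \<open>Iterated Frechet derivatives are awkward to compute with, so all closure properties are proved by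
exhibiting some derivative whose directional values are again of class \<open>C\<^sup>k\<close>.\<close>

lemma C_k_on_SucI:
  assumes "open S" and "\<And>x. x \<in> S \<Longrightarrow> (f has_derivative f' x) (at x)"
    and "\<And>v. C_k_on k S (\<lambda>x. f' x v)"
  shows "C_k_on (Suc k) S f"
  unfolding C_k_on.simps
proof (intro conjI ballI allI)
  show "f differentiable at x" if "x \<in> S" for x
    using assms(2)[OF that] by (auto simp: differentiable_def)
  show "C_k_on k S (\<lambda>x. frechet_derivative f (at x) v)" for v
    by (rule C_k_on_cong[OF assms(1) _ assms(3)]) (simp flip: frechet_derivative_at[OF assms(2)])
qed

lemma C_k_on_SucD: "C_k_on (Suc k) S f \<Longrightarrow> C_k_on k S f"
proof (induction k arbitrary: f)
  case 0
  then show ?case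
    by (auto intro!: continuous_at_imp_continuous_on differentiable_imp_continuous_within)
next
  case (Suc k)
  from Suc.prems have "\<forall>x\<in>S. f differentiable (at x)"
    "\<And>v. C_k_on (Suc k) S (\<lambda>x. frechet_derivative f (at x) v)"
    unfolding C_k_on.simps(2)[of "Suc k"] by blast+
  with Suc.IH show ?case unfolding C_k_on.simps(2)[of k] by blast
qed

lemma C_k_on_const [simp]: "C_k_on k S (\<lambda>_. c)"
  by (induction k arbitrary: c) auto

lemma C_k_on_linear:
  assumes "bounded_linear f"
  shows "C_k_on k S f"
proof (cases k)
  case 0
  then show ?thesis using assms by (simp add: linear_continuous_on)
next
  case (Suc m)
  have "frechet_derivative f (at x) = f" "f differentiable at x" for x
    using bounded_linear_imp_has_derivative[OF assms, of "at x"]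
    by (auto simp: differentiable_def dest: frechet_derivative_at)
  then show ?thesis using Suc by simp
qed

lemma C_k_on_add:
  assumes "open S" "C_k_on k S f" "C_k_on k S g"
  shows "C_k_on k S (\<lambda>x. f x + g x)"
  using assms(2,3)
proof (induction k arbitrary: f g)
  case (Suc k)
  note D = Suc.prems[THEN C_k_on_SucE(1)] Suc.prems[THEN C_k_on_SucE(2)]
  show ?case
  proof (rule C_k_on_SucI[OF assms(1)])
    show "((\<lambda>x. f x + g x) has_derivative
        (\<lambda>v. frechet_derivative f (at x) v + frechet_derivative g (at x) v)) (at x)" if "x \<in> S" for x
      by (intro has_derivative_add D that)
    show "C_k_on k S (\<lambda>x. frechet_derivative f (at x) v + frechet_derivative g (at x) v)" for v
      by (intro Suc.IH D)
  qed
qed (simp add: continuous_on_add)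

lemma C_k_on_bilinear:
  assumes "open S" "bounded_bilinear m" "C_k_on k S f" "C_k_on k S g"
  shows "C_k_on k S (\<lambda>x. m (f x) (g x))"
  using assms(3,4)
proof (induction k arbitrary: f g)
  case 0
  then show ?case using assms(2) by (simp add: bounded_bilinear.continuous_on)
next
  case (Suc k)
  note D = Suc.prems[THEN C_k_on_SucE(1)] Suc.prems[THEN C_k_on_SucE(2)]
  have k: "C_k_on k S f" "C_k_on k S g" using Suc.prems by (blast intro: C_k_on_SucD)+
  show ?case
  proof (rule C_k_on_SucI[OF assms(1)])
    show "((\<lambda>x. m (f x) (g x)) has_derivative
        (\<lambda>v. m (f x) (frechet_derivative g (at x) v) + m (frechet_derivative f (at x) v) (g x))) (at x)"
      if "x \<in> S" for x
      by (intro bounded_bilinear.FDERIV[OF assms(2)] D that)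
    show "C_k_on k S (\<lambda>x. m (f x) (frechet_derivative g (at x) v) + m (frechet_derivative f (at x) v) (g x))" for v
      by (intro C_k_on_add[OF assms(1)] Suc.IH D k)
  qed
qed

text \<open>Composition is needed only with a function of one real variable. There the chain rule gives a
product of two functions covered by the induction hypothesis, and no expansion in a basis occurs.\<close>

lemma C_k_on_compose_real:
  fixes h :: "real \<Rightarrow> real"
  assumes "open S" "open T" "C_k_on k T h" "C_k_on k S f" "\<And>x. x \<in> S \<Longrightarrow> f x \<in> T"
  shows "C_k_on k S (\<lambda>x. h (f x))"
  using assms(3-5)
proof (induction k arbitrary: h f)
  case 0
  then show ?case by (auto intro: continuous_on_compose2)
next
  case (Suc k)
  note D = C_k_on_SucE[OF Suc.prems(1)] C_k_on_SucE[OF Suc.prems(2)]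
  have k: "C_k_on k S f" using Suc.prems(2) by (rule C_k_on_SucD)
  show ?case
  proof (rule C_k_on_SucI[OF assms(1)])
    fix x assume x: "x \<in> S"
    let ?h' = "frechet_derivative h (at (f x))"
    have h: "(h has_derivative ?h') (at (f x))"
      by (rule D(1)[OF Suc.prems(3)[OF x]])
    have "(\<lambda>t. t * ?h' 1) = ?h'"
    proof
      show "t * ?h' 1 = ?h' t" for t
        using linear_scale[OF has_derivative_linear[OF h], of t 1] by (simp only: real_scaleR_def mult_1_right)
    qed
    with h have "(h has_derivative (\<lambda>t. t * ?h' 1)) (at (f x))"
      by (simp only:)
    moreover have "(f has_derivative frechet_derivative f (at x)) (at x)"
      by (rule D(3)[OF x])
    ultimately show "((\<lambda>x. h (f x)) has_derivative (\<lambda>v. frechet_derivative f (at x) v * ?h' 1)) (at x)"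
      by (rule has_derivative_compose[rotated])
  next
    fix v
    have "C_k_on k S (\<lambda>x. frechet_derivative h (at (f x)) 1)"
      by (rule Suc.IH[OF D(2) k Suc.prems(3)])
    then show "C_k_on k S (\<lambda>x. frechet_derivative f (at x) v * frechet_derivative h (at (f x)) 1)"
      by (intro C_k_on_bilinear[OF \<open>open S\<close> bounded_bilinear_mult] D(4))
  qed
qed

lemma smooth_on_cong:
  assumes "open S" "\<And>x. x \<in> S \<Longrightarrow> f x = g x" "smooth_on S g"
  shows "smooth_on S f"
  unfolding smooth_on_def
proof
  show "C_k_on k S f" for k
    by (rule C_k_on_cong[OF assms(1,2)]) (use assms(3) in \<open>simp_all add: smooth_on_def\<close>)
qed

lemma smooth_on_local:
  assumes "\<And>x. x \<in> S \<Longrightarrow> \<exists>N. open N \<and> x \<in> N \<and> smooth_on N f"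
  shows "smooth_on S f"
  using assms unfolding smooth_on_def by (intro allI C_k_on_local) meson

lemma smooth_on_subset: "smooth_on S f \<Longrightarrow> open S \<Longrightarrow> T \<subseteq> S \<Longrightarrow> smooth_on T f"
  by (rule smooth_on_local) blast

lemma smooth_on_const [simp, intro]: "smooth_on S (\<lambda>_. c)"
  by (simp add: smooth_on_def)

lemma smooth_on_linear: "bounded_linear f \<Longrightarrow> smooth_on S f"
  by (simp add: smooth_on_def C_k_on_linear)

lemma smooth_on_add:
  "open S \<Longrightarrow> smooth_on S f \<Longrightarrow> smooth_on S g \<Longrightarrow> smooth_on S (\<lambda>x. f x + g x)"
  by (simp add: smooth_on_def C_k_on_add)

lemma smooth_on_sum:
  assumes "open S" "\<And>i. i \<in> I \<Longrightarrow> smooth_on S (f i)"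
  shows "smooth_on S (\<lambda>x. \<Sum>i\<in>I. f i x)"
  using assms(2)
proof (induction I rule: infinite_finite_induct)
  case (insert i I)
  show ?case
    unfolding sum.insert[OF insert.hyps]
    by (intro smooth_on_add assms(1) insert.IH insert.prems) simp_all
qed simp_all

lemma smooth_on_scaleR:
  "open S \<Longrightarrow> smooth_on S f \<Longrightarrow> smooth_on S g \<Longrightarrow> smooth_on S (\<lambda>x. f x *\<^sub>R g x)"
  by (simp add: smooth_on_def C_k_on_bilinear[OF _ bounded_bilinear_scaleR])

lemma smooth_on_mult:
  fixes f g :: "'a::real_normed_vector \<Rightarrow> real"
  shows "open S \<Longrightarrow> smooth_on S f \<Longrightarrow> smooth_on S g \<Longrightarrow> smooth_on S (\<lambda>x. f x * g x)"
  by (simp add: smooth_on_def C_k_on_bilinear[OF _ bounded_bilinear_mult])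

lemma smooth_on_diff:
  assumes "open S" "smooth_on S f" "smooth_on S g"
  shows "smooth_on S (\<lambda>x. f x - g x)"
proof -
  have "smooth_on S (\<lambda>x. f x + (-1) *\<^sub>R g x)"
    by (intro smooth_on_add smooth_on_scaleR assms smooth_on_const)
  then show ?thesis by simp
qed

lemma smooth_on_minus:
  assumes "open S" "smooth_on S f"
  shows "smooth_on S (\<lambda>x. - f x)"
  using smooth_on_diff[OF assms(1) smooth_on_const[of S 0] assms(2)] by simp

lemma smooth_on_power:
  fixes f :: "'a::real_normed_vector \<Rightarrow> real"
  assumes "open S" "smooth_on S f"
  shows "smooth_on S (\<lambda>x. f x ^ n)"
proof (induction n)
  case 0
  show ?case unfolding power_0 by (rule smooth_on_const)
next
  case (Suc n)
  show ?case unfolding power_Suc by (rule smooth_on_mult[OF assms Suc])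
qed

lemma smooth_on_compose_real:
  fixes h :: "real \<Rightarrow> real"
  assumes "smooth_on T h" "open T" "open S" "smooth_on S f" "\<And>x. x \<in> S \<Longrightarrow> f x \<in> T"
  shows "smooth_on S (\<lambda>x. h (f x))"
  unfolding smooth_on_def
proof
  show "C_k_on k S (\<lambda>x. h (f x))" for k
    using assms unfolding smooth_on_def by (intro C_k_on_compose_real[where T = T and h = h and f = f]) blast+
qed

lemma smooth_on_component: "smooth_on S (\<lambda>x::real^'n. x $ i)"
  by (intro smooth_on_linear bounded_linear_vec_nth)

lemma smooth_on_vec:
  fixes f :: "'i::finite \<Rightarrow> 'a::real_normed_vector \<Rightarrow> real"
  assumes "open S" "\<And>i. smooth_on S (f i)"
  shows "smooth_on S (\<lambda>x. \<chi> i. f i x)"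
proof -
  have "smooth_on S (\<lambda>x. \<Sum>i\<in>UNIV. f i x *\<^sub>R axis i (1::real))"
    by (intro smooth_on_sum smooth_on_scaleR assms smooth_on_const)
  moreover have "(\<Sum>i\<in>UNIV. f i x *\<^sub>R axis i (1::real)) = (\<chi> i. f i x)" for x
    using basis_expansion[of "\<chi> i. f i x"] by (simp add: vector_scalar_mult_def scalar_mult_eq_scaleR)
  ultimately show ?thesis by simp
qed

lemma smooth_on_has_derivative:
  "smooth_on S f \<Longrightarrow> x \<in> S \<Longrightarrow> (f has_derivative frechet_derivative f (at x)) (at x)"
proof -
  assume "smooth_on S f" "x \<in> S"
  then have "C_k_on (Suc 0) S f" "x \<in> S" unfolding smooth_on_def by blast+
  then show ?thesis by (rule C_k_on_SucE(1))
qed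

lemma smooth_on_continuous: "smooth_on S f \<Longrightarrow> continuous_on S f"
  unfolding smooth_on_def using C_k_on.simps(1) by blast

lemma smooth_on_translate: "smooth_on S f \<Longrightarrow> open S \<Longrightarrow> smooth_on S (\<lambda>x. f x + c)"
  by (intro smooth_on_add smooth_on_const)

text \<open>Functions of one real variable are handled through their derivatives.\<close>

lemma C_k_on_SucI_real:
  fixes f :: "real \<Rightarrow> real"
  assumes "open S" "\<And>x. x \<in> S \<Longrightarrow> (f has_real_derivative f' x) (at x)" "C_k_on k S f'"
  shows "C_k_on (Suc k) S f"
  using assms
  by (intro C_k_on_SucI[where f' = "\<lambda>x v. f' x * v"])
    (auto simp: has_field_derivative_def intro: C_k_on_bilinear[OF _ bounded_bilinear_mult])

lemma smooth_on_real_derivI: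
  fixes f :: "real \<Rightarrow> real"
  assumes "open S" "\<And>x. x \<in> S \<Longrightarrow> (f has_real_derivative f' x) (at x)" "smooth_on S f'"
  shows "smooth_on S f"
  unfolding smooth_on_def
proof
  fix k
  have "C_k_on (Suc k) S f"
    using assms by (intro C_k_on_SucI_real[of S f f']) (auto simp: smooth_on_def)
  then show "C_k_on k S f" by (rule C_k_on_SucD)
qed

lemma smooth_on_exp: "smooth_on UNIV (exp :: real \<Rightarrow> real)"
proof -
  have "C_k_on k UNIV (exp :: real \<Rightarrow> real)" for k
    by (induction k) (simp add: continuous_on_exp, rule C_k_on_SucI_real[OF open_UNIV DERIV_exp])
  then show ?thesis by (simp add: smooth_on_def)
qed

lemma smooth_on_sin: "smooth_on UNIV (sin :: real \<Rightarrow> real)"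
  and smooth_on_cos: "smooth_on UNIV (cos :: real \<Rightarrow> real)"
proof -
  have "C_k_on k UNIV (sin :: real \<Rightarrow> real) \<and> C_k_on k UNIV (cos :: real \<Rightarrow> real)" for k
  proof (induction k)
    case (Suc k)
    have "C_k_on k UNIV (\<lambda>x::real. (-1) * sin x)"
      using Suc by (intro C_k_on_bilinear[OF _ bounded_bilinear_mult]) auto
    then have "C_k_on k UNIV (\<lambda>x::real. - sin x)" by simp
    from C_k_on_SucI_real[OF open_UNIV DERIV_sin conjunct2[OF Suc]]
      C_k_on_SucI_real[OF open_UNIV DERIV_cos this]
    show ?case by (rule conjI)
  qed (auto intro: continuous_intros)
  then show "smooth_on UNIV (sin :: real \<Rightarrow> real)" "smooth_on UNIV (cos :: real \<Rightarrow> real)"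
    by (simp_all add: smooth_on_def)
qed

lemma smooth_on_inverse: "smooth_on (- {0}) (inverse :: real \<Rightarrow> real)"
proof -
  have "C_k_on k (- {0}) (inverse :: real \<Rightarrow> real)" for k
  proof (induction k)
    case (Suc k)
    have "C_k_on k (- {0}) (\<lambda>x::real. (-1) * (inverse x * inverse x))"
      using Suc by (intro C_k_on_bilinear[OF _ bounded_bilinear_mult]) auto
    then show ?case
      by (intro C_k_on_SucI_real[where f' = "\<lambda>x. (-1) * (inverse x * inverse x)"])
        (auto intro!: derivative_eq_intros)
  qed (auto intro!: continuous_intros)
  then show ?thesis by (simp add: smooth_on_def)
qed

lemma smooth_on_ln: "smooth_on {0<..} (ln :: real \<Rightarrow> real)"
proof (rule smooth_on_real_derivI)
  show "smooth_on {0<..} (inverse :: real \<Rightarrow> real)"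
    by (rule smooth_on_subset[OF smooth_on_inverse]) auto
  show "(ln has_real_derivative inverse x) (at x)" if "x \<in> {0<..}" for x :: real
    using that by (simp add: DERIV_ln)
qed simp

lemmas smooth_on_exp' = smooth_on_compose_real[OF smooth_on_exp open_UNIV _ _ UNIV_I]
lemmas smooth_on_sin' = smooth_on_compose_real[OF smooth_on_sin open_UNIV _ _ UNIV_I]
lemmas smooth_on_cos' = smooth_on_compose_real[OF smooth_on_cos open_UNIV _ _ UNIV_I]

lemma smooth_on_inverse':
  fixes f :: "'a::real_normed_vector \<Rightarrow> real"
  shows "open S \<Longrightarrow> smooth_on S f \<Longrightarrow> (\<And>x. x \<in> S \<Longrightarrow> f x \<noteq> 0) \<Longrightarrow> smooth_on S (\<lambda>x. inverse (f x))"
  using smooth_on_compose_real[OF smooth_on_inverse, of S f] by auto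

lemma smooth_on_divide:
  fixes f g :: "'a::real_normed_vector \<Rightarrow> real"
  shows "open S \<Longrightarrow> smooth_on S f \<Longrightarrow> smooth_on S g \<Longrightarrow> (\<And>x. x \<in> S \<Longrightarrow> g x \<noteq> 0) \<Longrightarrow>
    smooth_on S (\<lambda>x. f x / g x)"
  unfolding divide_inverse by (intro smooth_on_mult smooth_on_inverse')

lemma smooth_on_ln':
  fixes f :: "'a::real_normed_vector \<Rightarrow> real"
  shows "open S \<Longrightarrow> smooth_on S f \<Longrightarrow> (\<And>x. x \<in> S \<Longrightarrow> 0 < f x) \<Longrightarrow> smooth_on S (\<lambda>x. ln (f x))"
  using smooth_on_compose_real[OF smooth_on_ln, of S f] by auto

lemma smooth_on_sqrt':
  fixes f :: "'a::real_normed_vector \<Rightarrow> real"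
  assumes "open S" "smooth_on S f" "\<And>x. x \<in> S \<Longrightarrow> 0 < f x"
  shows "smooth_on S (\<lambda>x. sqrt (f x))"
proof (rule smooth_on_cong[OF assms(1)])
  show "smooth_on S (\<lambda>x. exp (ln (f x) / 2))"
    using assms by (intro smooth_on_exp' smooth_on_divide smooth_on_ln' smooth_on_const) auto
  show "sqrt (f x) = exp (ln (f x) / 2)" if "x \<in> S" for x
    using assms(3)[OF that] by (simp add: powr_half_sqrt[symmetric] powr_def)
qed

lemma smooth_on_arctan: "smooth_on UNIV arctan"
proof (rule smooth_on_real_derivI[OF open_UNIV])
  show "(arctan has_real_derivative inverse (1 + x\<^sup>2)) (at x)" for x
    by (rule DERIV_arctan)
  have "1 + x\<^sup>2 \<noteq> 0" for x :: real using zero_le_power2[of x] by linarith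
  then show "smooth_on UNIV (\<lambda>x::real. inverse (1 + x\<^sup>2))"
    by (intro smooth_on_inverse' smooth_on_add smooth_on_power smooth_on_linear smooth_on_const) auto
qed

lemmas smooth_on_arctan' = smooth_on_compose_real[OF smooth_on_arctan open_UNIV _ _ UNIV_I]

section \<open>Quotients of periodic domains\<close>

definition periods :: "'n \<Rightarrow> 'n::finite \<Rightarrow> (real^'n) set" where
  "periods a b = {t. t $ a = 0 \<and> t $ b = 0 \<and> (\<forall>i. \<exists>k::int. t $ i = 2 * pi * of_int k)}"

lemma periods_eq: "periods a b = (\<lambda>t. (2 * pi) *\<^sub>R t) ` y_lattice a b"
proof (intro equalityI subsetI)
  fix t assume t: "t \<in> periods a b"
  have "\<exists>k::int. t $ i / (2 * pi) = of_int k" for i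
    using t by (auto simp: periods_def) (metis nonzero_mult_div_cancel_left pi_neq_zero mult_eq_0_iff zero_neq_numeral)
  then have "t $ i / (2 * pi) \<in> \<int>" for i
    using Ints_of_int by metis
  then have "(1 / (2 * pi)) *\<^sub>R t \<in> y_lattice a b"
    using t by (auto simp: periods_def y_lattice_def)
  moreover have "t = (2 * pi) *\<^sub>R ((1 / (2 * pi)) *\<^sub>R t)" by simp
  ultimately show "t \<in> (\<lambda>t. (2 * pi) *\<^sub>R t) ` y_lattice a b" by blast
qed (auto simp: periods_def y_lattice_def Ints_def image_iff)

lemma orbit_eq: "orbit a b p = {p + t | t. t \<in> periods a b}"
  by (auto simp: orbit_def periods_eq)

lemma periods_zero: "0 \<in> periods a b"
  by (auto simp: periods_def intro: exI[of _ 0])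

lemma periods_uminus: "t \<in> periods a b \<Longrightarrow> - t \<in> periods a b"
  by (auto simp: periods_def) (metis minus_mult_right of_int_minus)

lemma periods_add: "s \<in> periods a b \<Longrightarrow> t \<in> periods a b \<Longrightarrow> s + t \<in> periods a b"
  by (auto simp: periods_def) (metis distrib_left of_int_add)

lemma orbit_eq_iff: "orbit a b p = orbit a b q \<longleftrightarrow> q - p \<in> periods a b"
proof
  assume "orbit a b p = orbit a b q"
  moreover have "q \<in> orbit a b q" using periods_zero by (force simp: orbit_eq)
  ultimately have "q \<in> orbit a b p" by simp
  then show "q - p \<in> periods a b" by (auto simp: orbit_eq)
next
  assume *: "q - p \<in> periods a b"
  have "orbit a b q \<subseteq> orbit a b p" if "q - p \<in> periods a b" for p q
  proof -
    have "\<exists>s. q + t = p + s \<and> s \<in> periods a b" if t: "t \<in> periods a b" for t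
      using periods_add[OF \<open>q - p \<in> periods a b\<close> t] by (intro exI[of _ "q - p + t"]) auto
    then show ?thesis by (auto simp: orbit_eq)
  qed
  from this[OF *] this[of p q] periods_uminus[OF *] show "orbit a b p = orbit a b q" by auto
qed

lemma orbit_add_period: "t \<in> periods a b \<Longrightarrow> orbit a b (p + t) = orbit a b p"
  by (metis add_diff_cancel_left' orbit_eq_iff)

text \<open>Rational bounds below \<open>2 \<pi>\<close> for the distance between two points of an orbit are enough to make balls
of radius \<open>3\<close> charts and to separate orbits.\<close>

lemma period_norm:
  assumes "t \<in> periods a b" "t \<noteq> 0"
  shows "6 \<le> norm t"
proof -
  obtain i where i: "t $ i \<noteq> 0" using assms(2) by (auto simp: vec_eq_iff)
  obtain k :: int where k: "t $ i = 2 * pi * of_int k" using assms(1) by (auto simp: periods_def)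
  have "1 \<le> \<bar>k\<bar>" using i k by auto
  then have "1 \<le> \<bar>real_of_int k\<bar>" by linarith
  then have "2 * pi * 1 \<le> 2 * pi * \<bar>real_of_int k\<bar>" by (intro mult_left_mono) auto
  also have "\<dots> = \<bar>t $ i\<bar>" by (simp add: k abs_mult)
  also have "\<dots> \<le> norm t" by (rule component_le_norm_cart)
  finally show ?thesis using pi_gt3 by linarith
qed

lemma inj_on_orbit_ball: "inj_on (orbit a b) (ball x 3)"
proof (rule inj_onI)
  fix p q assume pq: "p \<in> ball x 3" "q \<in> ball x 3" "orbit a b p = orbit a b q"
  have "norm (q - p) < 6"
    using pq(1,2) dist_triangle[of q p x] by (simp add: dist_norm norm_minus_commute)
  then show "p = q" using period_norm[of "q - p" a b] pq(3) by (auto simp: orbit_eq_iff)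
qed

lemma closed_orbit: "closed (orbit a b p)"
proof (rule discrete_imp_closed[of 6])
  show "\<forall>x\<in>orbit a b p. \<forall>y\<in>orbit a b p. dist y x < 6 \<longrightarrow> y = x"
  proof (intro ballI impI)
    fix x y assume "x \<in> orbit a b p" "y \<in> orbit a b p" and d: "dist y x < 6"
    then obtain s t where st: "x = p + s" "y = p + t" "s \<in> periods a b" "t \<in> periods a b"
      by (auto simp: orbit_eq)
    have "t - s \<in> periods a b" using periods_add[OF st(4) periods_uminus[OF st(3)]] by simp
    then show "y = x" using period_norm[of "t - s" a b] d st(1,2) by (auto simp: dist_norm)
  qed
qed simp

text \<open>The construction of the hyperbolic quotient, with the half-space and its metric replaced by an
arbitrary domain and an arbitrary matrix-valued function. Both manifolds of the theorem have this
form, with the same lattice.\<close>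

definition quotient_riem ::
  "'n \<Rightarrow> 'n::finite \<Rightarrow> (real^'n) set \<Rightarrow> (real^'n \<Rightarrow> real^'n^'n) \<Rightarrow> ((real^'n) set, 'n) riem" where
  "quotient_riem a b S G = \<lparr>
     mtop = quotient_topology S (orbit a b),
     atlas = {(V, orbit a b) | V. open V \<and> V \<subseteq> S \<and> inj_on (orbit a b) V},
     metric = (\<lambda>_. G)\<rparr>"

lemma hyperbolic_quotient_eq:
  "hyperbolic_quotient a b =
     quotient_riem a b (upper_half_space b) (\<lambda>p. (1 / (p $ b)\<^sup>2) *\<^sub>R mat 1)"
  by (simp add: hyperbolic_quotient_def quotient_riem_def)

lemma quotient_riem_simps [simp]:
  "mtop (quotient_riem a b S G) = quotient_topology S (orbit a b)"
  "metric (quotient_riem a b S G) c = G"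
  "c \<in> atlas (quotient_riem a b S G) \<longleftrightarrow>
     (\<exists>V. c = (V, orbit a b) \<and> open V \<and> V \<subseteq> S \<and> inj_on (orbit a b) V)"
  by (auto simp: quotient_riem_def)

locale periodic_domain =
  fixes a b :: "'n::finite" and S :: "(real^'n) set"
  assumes open_domain: "open S"
    and add_period: "\<And>x t. x \<in> S \<Longrightarrow> t \<in> periods a b \<Longrightarrow> x + t \<in> S"
begin

abbreviation quot :: "(real^'n) set topology" where
  "quot \<equiv> quotient_topology S (orbit a b)"

lemma openin_quot: "openin quot U \<longleftrightarrow> U \<subseteq> orbit a b ` S \<and> open {x \<in> S. orbit a b x \<in> U}"
  using open_domain by (auto simp: openin_quotient_topology openin_open_eq)

lemma openin_quot_orbit_image:
  assumes "open N" "N \<subseteq> S"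
  shows "openin quot (orbit a b ` N)"
proof -
  have "{x \<in> S. orbit a b x \<in> orbit a b ` N} = (\<Union>t\<in>periods a b. (\<lambda>x. t + x) ` N)"
  proof (intro equalityI subsetI)
    fix x assume "x \<in> {x \<in> S. orbit a b x \<in> orbit a b ` N}"
    then obtain y where y: "y \<in> N" "orbit a b y = orbit a b x" by auto
    then have "x - y \<in> periods a b" by (simp add: orbit_eq_iff)
    then show "x \<in> (\<Union>t\<in>periods a b. (\<lambda>x. t + x) ` N)" using y(1) by force
  next
    fix x assume "x \<in> (\<Union>t\<in>periods a b. (\<lambda>x. t + x) ` N)"
    then obtain t y where "t \<in> periods a b" "y \<in> N" "x = y + t" by (auto simp: add.commute)
    then show "x \<in> {x \<in> S. orbit a b x \<in> orbit a b ` N}"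
      using add_period assms(2) by (auto simp: orbit_add_period)
  qed
  also have "open \<dots>" using assms(1) by (auto intro: open_translation)
  finally show ?thesis using assms(2) by (auto simp: openin_quot)
qed

lemma topspace_quot: "topspace quot = orbit a b ` S"
proof
  show "topspace quot \<subseteq> orbit a b ` S"
    using openin_topspace[of quot] unfolding openin_quot by blast
  show "orbit a b ` S \<subseteq> topspace quot"
    using openin_quot_orbit_image[OF open_domain subset_refl] openin_subset by blast
qed

lemma continuous_map_orbit: "continuous_map (top_of_set S) quot (orbit a b)"
  unfolding continuous_map
proof (intro conjI allI impI)
  show "orbit a b ` topspace (top_of_set S) \<subseteq> topspace quot" by (simp add: topspace_quot)
  show "openin (top_of_set S) {x \<in> topspace (top_of_set S). orbit a b x \<in> U}" if "openin quot U" for U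
    using that by (simp add: openin_quotient_topology)
qed

lemma open_map_orbit: "open_map (top_of_set S) quot (orbit a b)"
  unfolding open_map_def using openin_quot_orbit_image open_domain by (auto simp: openin_open_eq)

lemma is_chart_quot:
  assumes "open V" "V \<subseteq> S" "inj_on (orbit a b) V"
  shows "is_chart quot (V, orbit a b)"
proof -
  have sub: "subtopology (top_of_set S) V = top_of_set V"
    using assms(2) by (simp add: subtopology_subtopology Int_absorb1)
  have "homeomorphic_map (top_of_set V) (subtopology quot (orbit a b ` V)) (orbit a b)"
  proof (rule bijective_open_imp_homeomorphic_map)
    show "continuous_map (top_of_set V) (subtopology quot (orbit a b ` V)) (orbit a b)"
      using continuous_map_from_subtopology[OF continuous_map_orbit, of V]
      by (intro continuous_map_into_subtopology) (auto simp: sub)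
    show "open_map (top_of_set V) (subtopology quot (orbit a b ` V)) (orbit a b)"
      unfolding open_map_def
    proof (intro allI impI)
      fix U assume "openin (top_of_set V) U"
      then have U: "open U" "U \<subseteq> V" using assms(1) by (auto simp: openin_open_eq)
      then have "openin quot (orbit a b ` U)" using assms(2) by (intro openin_quot_orbit_image) auto
      then show "openin (subtopology quot (orbit a b ` V)) (orbit a b ` U)"
        using U(2) openin_subset by (auto simp: openin_subtopology intro!: exI[of _ "orbit a b ` U"])
    qed
    show "orbit a b ` topspace (top_of_set V) = topspace (subtopology quot (orbit a b ` V))"
      using assms(2) by (auto simp: topspace_quot)
  qed (use assms(3) in simp)
  then show ?thesis using assms by (simp add: is_chart_def openin_quot_orbit_image)
qed

lemma small_chart:
  assumes "x \<in> S"
  obtains V where "open V" "V \<subseteq> S" "inj_on (orbit a b) V" "x \<in> V" "convex V"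
proof -
  obtain e where e: "e > 0" "ball x e \<subseteq> S" using open_domain assms by (auto simp: open_contains_ball)
  show ?thesis
    by (rule that[of "ball x (min e 3)"])
      (use e in \<open>auto intro: inj_on_subset[OF inj_on_orbit_ball[of a b x]]\<close>)
qed

lemma Hausdorff_quot: "Hausdorff_space quot"
  unfolding Hausdorff_space_def
proof (intro allI impI)
  fix P Q assume "P \<in> topspace quot \<and> Q \<in> topspace quot \<and> P \<noteq> Q"
  then obtain x y where xy: "x \<in> S" "y \<in> S" "P = orbit a b x" "Q = orbit a b y" "orbit a b x \<noteq> orbit a b y"
    by (auto simp: topspace_quot)
  have "x \<notin> orbit a b y"
    using xy(5) orbit_add_period[of _ a b y] by (auto simp: orbit_eq[of a b y])
  then obtain e where e: "e > 0" "ball x e \<subseteq> - orbit a b y"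
    using closed_orbit[of a b y] by (metis ComplI open_Compl open_contains_ball)
  define U where "U = ball x (e / 2) \<inter> S"
  define V where "V = ball y (e / 2) \<inter> S"
  have "openin quot (orbit a b ` U)" "openin quot (orbit a b ` V)"
    using open_domain by (auto simp: U_def V_def intro!: openin_quot_orbit_image)
  moreover have "P \<in> orbit a b ` U" "Q \<in> orbit a b ` V"
    using xy e(1) by (auto simp: U_def V_def)
  moreover have "disjnt (orbit a b ` U) (orbit a b ` V)"
  proof (rule ccontr)
    assume "\<not> disjnt (orbit a b ` U) (orbit a b ` V)"
    then obtain x' y' where xy': "x' \<in> U" "y' \<in> V" "orbit a b y' = orbit a b x'"
      by (auto simp: disjnt_def)
    define t where "t = x' - y'"
    have "t \<in> periods a b" using xy'(3) by (simp add: orbit_eq_iff t_def)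
    then have "y + t \<in> orbit a b y" by (auto simp: orbit_eq)
    moreover have "dist x (y + t) < e"
    proof -
      have "dist x x' < e / 2" "dist y' y < e / 2" using xy' by (auto simp: U_def V_def dist_commute)
      moreover have "dist x' (y + t) = dist y' y" by (simp add: t_def dist_norm)
      ultimately show ?thesis using dist_triangle[of x "y + t" x'] by linarith
    qed
    ultimately show False using e(2) by auto
  qed
  ultimately show "\<exists>U V. openin quot U \<and> openin quot V \<and> P \<in> U \<and> Q \<in> V \<and> disjnt U V" by blast
qed

lemma second_countable_quot: "second_countable quot"
proof (rule second_countable_open_map_image[OF continuous_map_orbit open_map_orbit])
  show "orbit a b ` topspace (top_of_set S) = topspace quot" by (simp add: topspace_quot)
  obtain \<B> :: "(real^'n) set set" where \<B>: "countable \<B>" "\<And>C. C \<in> \<B> \<Longrightarrow> open C"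
    "\<And>S. open S \<Longrightarrow> \<exists>U. U \<subseteq> \<B> \<and> S = \<Union>U"
    using univ_second_countable by blast
  have "\<exists>V\<in>\<B>. x \<in> V \<and> V \<subseteq> U" if "open U" "x \<in> U" for U x
    using \<B>(3)[OF that(1)] that(2) by blast
  then have "second_countable (euclidean :: (real^'n) topology)"
    unfolding second_countable_def using \<B>(1,2) by (auto intro!: exI[of _ \<B>])
  then show "second_countable (top_of_set S)" by (rule second_countable_subtopology)
qed

lemma connected_quot:
  assumes "connected S"
  shows "connected_space quot"
proof -
  have "connectedin (top_of_set S) S" using assms by (simp add: connectedin_subtopology)
  from connectedin_continuous_map_image[OF continuous_map_orbit this] show ?thesis
    by (simp add: connectedin_topspace flip: topspace_quot)
qed

lemma compactin_quot:
  assumes "compact K" "K \<subseteq> S"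
  shows "compactin quot (orbit a b ` K)"
proof (rule image_compactin[OF _ continuous_map_orbit])
  show "compactin (top_of_set S) K" using assms by (simp add: compactin_subtopology)
qed

end


subsection \<open>Maps with smooth lifts\<close>

definition smooth_lift ::
  "'n \<Rightarrow> 'n \<Rightarrow> ((real^'n) set \<Rightarrow> (real^'n) set) \<Rightarrow> (real^'n::finite) set \<Rightarrow> (real^'n \<Rightarrow> real^'n) \<Rightarrow> bool" where
  "smooth_lift a b f N \<Psi> \<longleftrightarrow>
     open N \<and> smooth_on N \<Psi> \<and> (\<forall>y\<in>N. f (orbit a b y) = orbit a b (\<Psi> y))"

text \<open>A map between quotients is studied through local lifts to \<open>\<real>\<^sup>n\<close>. In any pair of charts it agrees
near a given point with a lift followed by a translation by one period, as \<open>V'\<close> meets every orbit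
at most once.\<close>

lemma local_rep_smooth_lift:
  assumes "open V'" "inj_on (orbit a b) V'" and x: "f (orbit a b x) \<in> orbit a b ` V'"
    and lift: "smooth_lift a b f N \<Psi>" "x \<in> N"
  shows "\<exists>N' t. open N' \<and> x \<in> N' \<and> N' \<subseteq> N \<and> t \<in> periods a b \<and>
    (\<forall>y\<in>N'. local_rep (V, orbit a b) (V', orbit a b) f y = \<Psi> y + t)"
proof -
  let ?F = "local_rep (V, orbit a b) (V', orbit a b) f"
  note lift' = lift[unfolded smooth_lift_def]
  obtain z where z: "z \<in> V'" "orbit a b (\<Psi> x) = orbit a b z" using x lift' by auto
  define t where "t = z - \<Psi> x"
  define N' where "N' = {y \<in> N. \<Psi> y + t \<in> V'}"
  have t: "t \<in> periods a b" using z(2) by (simp add: orbit_eq_iff t_def)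
  show ?thesis
  proof (intro exI[of _ N'] exI[of _ t] conjI ballI)
    have "continuous_on N \<Psi>" using lift' by (simp add: smooth_on_continuous)
    then have "continuous_on N (\<lambda>y. \<Psi> y + t)" by (intro continuous_intros)
    from continuous_open_preimage[OF this] show "open N'"
      using lift' assms(1) by (simp add: N'_def vimage_def Int_def)
    show "x \<in> N'" using lift' z(1) by (simp add: N'_def t_def)
    show "?F y = \<Psi> y + t" if "y \<in> N'" for y
    proof -
      have "f (orbit a b y) = orbit a b (\<Psi> y + t)"
        using lift' that t by (simp add: N'_def orbit_add_period)
      then show ?thesis using that assms(2) by (simp add: local_rep_def N'_def)
    qed
  qed (auto simp: N'_def t)
qed

lemma smooth_on_local_rep:
  assumes "open V'" "inj_on (orbit a b) V'"
    and lift: "\<And>x. x \<in> V \<Longrightarrow> orbit a b x \<in> U \<Longrightarrow> \<exists>N \<Psi>. smooth_lift a b f N \<Psi> \<and> x \<in> N"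
  shows "smooth_on (local_dom (V, orbit a b) (V', orbit a b) U f)
           (local_rep (V, orbit a b) (V', orbit a b) f)"
proof (rule smooth_on_local)
  let ?F = "local_rep (V, orbit a b) (V', orbit a b) f"
  fix x assume "x \<in> local_dom (V, orbit a b) (V', orbit a b) U f"
  then have x: "x \<in> V" "orbit a b x \<in> U" "f (orbit a b x) \<in> orbit a b ` V'"
    by (auto simp: local_dom_def chart_range_def)
  obtain N \<Psi> where N: "smooth_lift a b f N \<Psi>" "x \<in> N" using lift[OF x(1,2)] by blast
  obtain N' t where N': "open N'" "x \<in> N'" "N' \<subseteq> N"
    "\<And>y. y \<in> N' \<Longrightarrow> ?F y = \<Psi> y + t"
    using local_rep_smooth_lift[OF assms(1,2) x(3) N, where V = V] by metis
  have "smooth_on N' \<Psi>"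
    using N(1) N'(3) smooth_on_subset by (auto simp: smooth_lift_def)
  then have "smooth_on N' (\<lambda>y. \<Psi> y + t)" using N'(1) by (rule smooth_on_translate)
  then have "smooth_on N' (?F)"
    by (rule smooth_on_cong[where g = "\<lambda>y. \<Psi> y + t", OF N'(1) N'(4), rotated])
  then show "\<exists>N. open N \<and> x \<in> N \<and> smooth_on N (?F)"
    using N'(1,2) by blast
qed

lemma jacobian_local_rep:
  assumes "open V'" "inj_on (orbit a b) V'" and x: "f (orbit a b x) \<in> orbit a b ` V'"
    and lift: "smooth_lift a b f N \<Psi>" "x \<in> N"
  shows "jacobian (local_rep (V, orbit a b) (V', orbit a b) f) (at x) = jacobian \<Psi> (at x)"
    and "\<exists>t\<in>periods a b. local_rep (V, orbit a b) (V', orbit a b) f x = \<Psi> x + t"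
proof -
  let ?F = "local_rep (V, orbit a b) (V', orbit a b) f"
  obtain N' t where N': "open N'" "x \<in> N'" "N' \<subseteq> N" "t \<in> periods a b"
    "\<And>y. y \<in> N' \<Longrightarrow> ?F y = \<Psi> y + t"
    using local_rep_smooth_lift[OF assms, where V = V] by metis
  have "(\<Psi> has_derivative frechet_derivative \<Psi> (at x)) (at x)"
    using lift by (intro smooth_on_has_derivative[of N]) (auto simp: smooth_lift_def)
  then have "((\<lambda>y. \<Psi> y + t) has_derivative frechet_derivative \<Psi> (at x)) (at x)"
    by (rule has_derivative_add_const)
  then have "(?F has_derivative frechet_derivative \<Psi> (at x)) (at x)"
    by (rule has_derivative_transform_within_open[OF _ N'(1,2)]) (simp add: N'(5))
  then show "jacobian (?F) (at x) = jacobian \<Psi> (at x)"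
    unfolding jacobian_def by (simp flip: frechet_derivative_at)
  show "\<exists>t\<in>periods a b. ?F x = \<Psi> x + t"
    using N'(2,4,5) by blast
qed

lemma smooth_lift_id: "open N \<Longrightarrow> smooth_lift a b id N id"
  unfolding smooth_lift_def id_def by (simp add: smooth_on_linear)

context periodic_domain
begin

text \<open>The identity lifts to the identity, so coordinate changes are locally translations by periods. This
gives a smooth, oriented atlas at once.\<close>

lemma jacobian_transition:
  assumes "open V'" "inj_on (orbit a b) V'" "x \<in> local_dom (V, orbit a b) (V', orbit a b) UNIV id"
  shows "jacobian (local_rep (V, orbit a b) (V', orbit a b) id) (at x) = mat 1"
    and "\<exists>t\<in>periods a b. local_rep (V, orbit a b) (V', orbit a b) id x = x + t"
  using jacobian_local_rep[OF assms(1,2) _ smooth_lift_id[OF open_UNIV], of x V] assms(3)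
  by (simp_all add: jacobian_def local_dom_def chart_range_def matrix_id_mat_1 matrix_id)

lemma smooth_atlas_quot: "smooth_atlas quot (atlas (quotient_riem a b S G))"
  unfolding smooth_atlas_def
proof (intro conjI ballI)
  show "is_chart quot c" if "c \<in> atlas (quotient_riem a b S G)" for c
    using that is_chart_quot by auto
  show "(\<Union>c\<in>atlas (quotient_riem a b S G). chart_range c) = topspace quot"
  proof (intro equalityI subsetI)
    fix P assume "P \<in> topspace quot"
    then obtain x where x: "x \<in> S" "P = orbit a b x" by (auto simp: topspace_quot)
    obtain V where "open V" "V \<subseteq> S" "inj_on (orbit a b) V" "x \<in> V" by (rule small_chart[OF x(1)])
    then show "P \<in> (\<Union>c\<in>atlas (quotient_riem a b S G). chart_range c)"
      using x(2) by (auto simp: chart_range_def intro!: bexI[of _ "(V, orbit a b)"])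
  qed (auto simp: topspace_quot chart_range_def subset_iff)
  fix c c' assume "c \<in> atlas (quotient_riem a b S G)" "c' \<in> atlas (quotient_riem a b S G)"
  then show "smooth_on (local_dom c c' UNIV id) (local_rep c c' id)"
    using smooth_lift_id[OF open_UNIV] by (auto intro!: smooth_on_local_rep)
qed

lemma riemannian_manifold_quot:
  assumes "smooth_on S G"
    and "\<And>x. x \<in> S \<Longrightarrow> transpose (G x) = G x"
    and "\<And>x v. x \<in> S \<Longrightarrow> v \<noteq> 0 \<Longrightarrow> 0 < v \<bullet> (G x *v v)"
    and "\<And>x t. x \<in> S \<Longrightarrow> t \<in> periods a b \<Longrightarrow> G (x + t) = G x"
  shows "riemannian_manifold (quotient_riem a b S G)"
proof -
  let ?M = "quotient_riem a b S G"
  have "smooth_manifold (mtop ?M) (atlas ?M)"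
    unfolding smooth_manifold_def using Hausdorff_quot second_countable_quot smooth_atlas_quot by simp
  moreover have "\<forall>c\<in>atlas ?M. smooth_on (fst c) (metric ?M c) \<and>
        (\<forall>x\<in>fst c. transpose (metric ?M c x) = metric ?M c x \<and>
           (\<forall>v. v \<noteq> 0 \<longrightarrow> 0 < v \<bullet> (metric ?M c x *v v)))"
    using assms(2,3) smooth_on_subset[OF assms(1) open_domain] by (auto dest!: subsetD)
  moreover have "\<forall>c\<in>atlas ?M. \<forall>c'\<in>atlas ?M. \<forall>x\<in>local_dom c c' UNIV id.
        metric ?M c x = pullback_matrix (local_rep c c' id) (metric ?M c') x"
  proof (intro ballI)
    fix c c' x assume c: "c \<in> atlas ?M" "c' \<in> atlas ?M" and x: "x \<in> local_dom c c' UNIV id"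
    obtain V V' where V: "c = (V, orbit a b)" "V \<subseteq> S"
      and V': "c' = (V', orbit a b)" "open V'" "inj_on (orbit a b) V'" using c by auto
    have "x \<in> S" using x V by (auto simp: local_dom_def)
    then show "metric ?M c x = pullback_matrix (local_rep c c' id) (metric ?M c') x"
      using jacobian_transition[OF V'(2,3), of x V] x assms(4) V V'
      by (auto simp: pullback_matrix_def transpose_mat)
  qed
  ultimately show ?thesis unfolding riemannian_manifold_def by blast
qed

lemma orientable_quot: "orientable quot (atlas (quotient_riem a b S G))"
  unfolding orientable_def
proof (intro exI[of _ "atlas (quotient_riem a b S G)"] conjI ballI)
  fix c c' x assume "c \<in> atlas (quotient_riem a b S G)" "c' \<in> atlas (quotient_riem a b S G)"
    "x \<in> local_dom c c' UNIV id"
  then show "0 < det (jacobian (local_rep c c' id) (at x))"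
    using jacobian_transition(1) by auto
qed (simp_all add: smooth_atlas_quot)

lemma smooth_map_quot:
  assumes S': "periodic_domain a b S'"
    and U: "openin quot U"
    and lift: "\<And>x. x \<in> S \<Longrightarrow> orbit a b x \<in> U \<Longrightarrow>
        \<exists>N \<Psi>. smooth_lift a b f N \<Psi> \<and> x \<in> N \<and> \<Psi> ` N \<subseteq> S'"
  shows "smooth_map (quotient_riem a b S G) U (quotient_riem a b S' G') f"
  unfolding smooth_map_def
proof (intro conjI ballI)
  interpret S': periodic_domain a b S' by fact
  have U': "U \<subseteq> orbit a b ` S" using U by (simp add: openin_quot)
  show "continuous_map (subtopology (mtop (quotient_riem a b S G)) U) (mtop (quotient_riem a b S' G')) f"
    unfolding continuous_map quotient_riem_simps
  proof (intro conjI allI impI)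
    show "f ` topspace (subtopology quot U) \<subseteq> topspace S'.quot"
    proof safe
      fix P assume "P \<in> topspace (subtopology quot U)"
      then obtain x where x: "x \<in> S" "P = orbit a b x" "orbit a b x \<in> U"
        by (auto simp: topspace_quot)
      obtain N \<Psi> where "smooth_lift a b f N \<Psi>" "x \<in> N" "\<Psi> ` N \<subseteq> S'"
        using lift[OF x(1,3)] by blast
      then show "f P \<in> topspace S'.quot" by (auto simp: smooth_lift_def x S'.topspace_quot)
    qed
    fix W assume W: "openin S'.quot W"
    define W' where "W' = {x \<in> S'. orbit a b x \<in> W}"
    have W'_open: "open W'" using W by (simp add: S'.openin_quot W'_def)
    have "\<exists>T. open T \<and> x \<in> T \<and> T \<subseteq> {x \<in> S. orbit a b x \<in> U \<and> f (orbit a b x) \<in> W}"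
      if x: "x \<in> S" "orbit a b x \<in> U" "f (orbit a b x) \<in> W" for x
    proof -
      obtain N \<Psi> where N: "open N" "smooth_on N \<Psi>" "\<And>y. y \<in> N \<Longrightarrow> f (orbit a b y) = orbit a b (\<Psi> y)"
        "x \<in> N" "\<Psi> ` N \<subseteq> S'"
        using lift[OF x(1,2)] unfolding smooth_lift_def by blast
      have "open (N \<inter> \<Psi> -` W')"
        by (rule continuous_open_preimage[OF smooth_on_continuous[OF N(2)] N(1) W'_open])
      moreover have "open {x \<in> S. orbit a b x \<in> U}" using U by (simp add: openin_quot)
      ultimately have "open ((N \<inter> \<Psi> -` W') \<inter> {x \<in> S. orbit a b x \<in> U})" by (rule open_Int)
      moreover have "x \<in> (N \<inter> \<Psi> -` W') \<inter> {x \<in> S. orbit a b x \<in> U}"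
        using N(3-5) x by (auto simp: W'_def)
      moreover have "(N \<inter> \<Psi> -` W') \<inter> {x \<in> S. orbit a b x \<in> U}
          \<subseteq> {x \<in> S. orbit a b x \<in> U \<and> f (orbit a b x) \<in> W}"
        using N(3) by (auto simp: W'_def)
      ultimately show ?thesis by blast
    qed
    then have "open {x \<in> S. orbit a b x \<in> U \<and> f (orbit a b x) \<in> W}"
      by (subst open_subopen) blast
    then have "openin quot {P \<in> U. f P \<in> W}"
      using U' by (auto simp: openin_quot)
    then show "openin (subtopology quot U) {P \<in> topspace (subtopology quot U). f P \<in> W}"
      using U' by (auto simp: openin_subtopology topspace_quot intro!: exI[of _ "{P \<in> U. f P \<in> W}"])
  qed
  fix c c' assume "c \<in> atlas (quotient_riem a b S G)" "c' \<in> atlas (quotient_riem a b S' G')"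
  then obtain V V' where V: "c = (V, orbit a b)" "V \<subseteq> S"
      and V': "c' = (V', orbit a b)" "open V'" "inj_on (orbit a b) V'" by auto
  show "smooth_on (local_dom c c' U f) (local_rep c c' f)"
    unfolding V V' by (rule smooth_on_local_rep[OF V'(2,3)]) (use lift V(2) in blast)
qed

end

text \<open>The lifts of \<open>f'\<close> make the inverse of \<open>f\<close> smooth, and it is then isometric because \<open>f\<close> is.\<close>

lemma isometric_subsets_quotI:
  assumes S: "periodic_domain a b S" and S': "periodic_domain a b S'"
    and U: "openin (quotient_topology S (orbit a b)) U"
    and U': "openin (quotient_topology S' (orbit a b)) U'"
    and G': "\<And>x t. x \<in> S' \<Longrightarrow> t \<in> periods a b \<Longrightarrow> G' (x + t) = G' x"
    and f: "\<And>P. P \<in> U \<Longrightarrow> f P \<in> U' \<and> f' (f P) = P"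
    and f': "\<And>Q. Q \<in> U' \<Longrightarrow> f' Q \<in> U \<and> f (f' Q) = Q"
    and lift: "\<And>x. x \<in> S \<Longrightarrow> orbit a b x \<in> U \<Longrightarrow>
        \<exists>N \<Psi>. smooth_lift a b f N \<Psi> \<and> x \<in> N \<and> \<Psi> ` N \<subseteq> S' \<and> G x = pullback_matrix \<Psi> G' x"
    and lift': "\<And>x. x \<in> S' \<Longrightarrow> orbit a b x \<in> U' \<Longrightarrow>
        \<exists>N \<Psi>. smooth_lift a b f' N \<Psi> \<and> x \<in> N \<and> \<Psi> ` N \<subseteq> S"
  shows "isometric_subsets (quotient_riem a b S G) U (quotient_riem a b S' G') U'"
  unfolding isometric_subsets_def
proof (intro exI conjI ballI)
  interpret S: periodic_domain a b S by fact
  interpret S': periodic_domain a b S' by fact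
  show sf: "smooth_map (quotient_riem a b S G) U (quotient_riem a b S' G') f"
    by (rule S.smooth_map_quot[OF S' U]) (use lift in blast)
  show sf': "smooth_map (quotient_riem a b S' G') U' (quotient_riem a b S G) f'"
    by (rule S'.smooth_map_quot[OF S U']) (use lift' in blast)
  show "homeomorphic_maps (subtopology (mtop (quotient_riem a b S G)) U)
     (subtopology (mtop (quotient_riem a b S' G')) U') f f'"
    using sf sf' f f' unfolding homeomorphic_maps_def smooth_map_def
    by (auto intro!: continuous_map_into_subtopology)
  fix c c' x assume c: "c \<in> atlas (quotient_riem a b S G)" "c' \<in> atlas (quotient_riem a b S' G')"
    and x: "x \<in> local_dom c c' U f"
  obtain V V' where V: "c = (V, orbit a b)" "V \<subseteq> S"
    and V': "c' = (V', orbit a b)" "open V'" "V' \<subseteq> S'" "inj_on (orbit a b) V'" using c by auto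
  have x': "x \<in> S" "orbit a b x \<in> U" "f (orbit a b x) \<in> orbit a b ` V'"
    using x V V' by (auto simp: local_dom_def chart_range_def)
  obtain N \<Psi> where N: "smooth_lift a b f N \<Psi>" "x \<in> N" "\<Psi> ` N \<subseteq> S'" "G x = pullback_matrix \<Psi> G' x"
    using lift[OF x'(1,2)] by blast
  have "\<Psi> x \<in> S'" using N(2,3) by blast
  then show "metric (quotient_riem a b S G) c x =
      pullback_matrix (local_rep c c' f) (metric (quotient_riem a b S' G') c') x"
    using jacobian_local_rep[OF V'(2,4) x'(3) N(1,2), of V] G' N(4)
    by (auto simp: pullback_matrix_def V V')
qed

section \<open>Completeness of quotients\<close>

lemma continuous_on_quadratic_form:
  fixes A :: "'x::topological_space \<Rightarrow> real^'n^'n"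
  assumes "continuous_on T A" "continuous_on T v"
  shows "continuous_on T (\<lambda>x. v x \<bullet> (A x *v v x))"
  unfolding inner_vec_def matrix_vector_mult_def inner_real_def vec_lambda_beta
  by (intro continuous_intros assms)

lemma quadratic_form_le:
  fixes A :: "real^'n^'n"
  shows "v \<bullet> (A *v v) \<le> (\<Sum>i\<in>UNIV. \<Sum>j\<in>UNIV. \<bar>A $ i $ j\<bar>) * (norm v)\<^sup>2"
proof -
  have "v \<bullet> (A *v v) \<le> norm v * norm (A *v v)" by (rule norm_cauchy_schwarz)
  also have "\<dots> \<le> norm v * (onorm ((*v) A) * norm v)"
    by (intro mult_left_mono onorm) auto
  also have "\<dots> \<le> norm v * ((\<Sum>i\<in>UNIV. \<Sum>j\<in>UNIV. \<bar>A $ i $ j\<bar>) * norm v)"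
    by (intro mult_left_mono mult_right_mono onorm_le_matrix_component_sum) auto
  finally show ?thesis by (simp add: power2_eq_square mult_ac)
qed

locale riemannian_domain = periodic_domain a b S
  for a b :: "'n::finite" and S +
  fixes G :: "real^'n \<Rightarrow> real^'n^'n"
  assumes smooth_metric: "smooth_on S G"
    and symmetric_metric: "x \<in> S \<Longrightarrow> transpose (G x) = G x"
    and positive_metric: "x \<in> S \<Longrightarrow> v \<noteq> 0 \<Longrightarrow> 0 < v \<bullet> (G x *v v)"
    and periodic_metric: "x \<in> S \<Longrightarrow> t \<in> periods a b \<Longrightarrow> G (x + t) = G x"
    and connected_domain: "connected S"
begin

abbreviation M :: "((real^'n) set, 'n) riem" where
  "M \<equiv> quotient_riem a b S G"

lemma metric_nonneg: "x \<in> S \<Longrightarrow> 0 \<le> v \<bullet> (G x *v v)"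
  using positive_metric[of x v] by (cases "v = 0") auto

lemma speed_continuous:
  assumes "continuous_on {0..1::real} u" "u ` {0..1} \<subseteq> S" "continuous_on {0..1} u'"
  shows "continuous_on {0..1} (\<lambda>t. sqrt (u' t \<bullet> (G (u t) *v u' t)))"
proof -
  have "continuous_on {0..1} (\<lambda>t. G (u t))"
    by (rule continuous_on_compose2[OF smooth_on_continuous[OF smooth_metric] assms(1,2)])
  then show ?thesis by (intro continuous_on_real_sqrt continuous_on_quadratic_form assms)
qed

definition gradient_bound :: "(real^'n \<Rightarrow> real) \<Rightarrow> real \<Rightarrow> bool" where
  "gradient_bound h \<kappa> \<longleftrightarrow> (\<forall>x\<in>S. \<exists>h'. (h has_derivative h') (at x) \<and>
     (\<forall>v. \<bar>h' v\<bar> \<le> \<kappa> * sqrt (v \<bullet> (G x *v v))))"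

lemma joined_nonneg: "joined M P Q L \<Longrightarrow> 0 \<le> L"
proof (induction rule: joined.induct)
  case (arc V \<psi> u u')
  then have V: "V \<subseteq> S" by auto
  have "continuous_on {0..1} u"
    using arc(3) by (meson continuous_on_vector_derivative)
  then have "continuous_on {0..1} (\<lambda>t. sqrt (u' t \<bullet> (G (u t) *v u' t)))"
    using arc V by (intro speed_continuous) auto
  moreover have "0 \<le> u' t \<bullet> (G (u t) *v u' t)" if "t \<in> {0..1}" for t
    by (rule metric_nonneg) (use arc(2) V that in blast)
  ultimately show ?case
    by (auto intro!: Henstock_Kurzweil_Integration.integral_nonneg integrable_continuous_real)
qed simp

text \<open>Integrating \<open>dh\<close> along a curve bounds the variation of \<open>h\<close> by the length. This is the only source of
lower bounds for distances.\<close>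

lemma joined_gradient_bound:
  assumes h: "gradient_bound h \<kappa>" and H: "\<And>x. x \<in> S \<Longrightarrow> H (orbit a b x) = h x"
  shows "joined M P Q L \<Longrightarrow> \<bar>H Q - H P\<bar> \<le> \<kappa> * L"
proof (induction rule: joined.induct)
  case (arc V \<psi> u u')
  then have V: "V \<subseteq> S" "\<psi> = orbit a b" by auto
  have uS: "u t \<in> S" if "t \<in> {0..1}" for t using arc(2) V that by blast
  have u: "continuous_on {0..1} u"
    using arc(3) by (meson continuous_on_vector_derivative)
  have speed: "continuous_on {0..1} (\<lambda>t. sqrt (u' t \<bullet> (G (u t) *v u' t)))"
    using arc uS by (intro speed_continuous u) auto
  define h' where "h' x = (SOME h'. (h has_derivative h') (at x) \<and>
     (\<forall>v. \<bar>h' v\<bar> \<le> \<kappa> * sqrt (v \<bullet> (G x *v v))))" for x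
  have h': "(h has_derivative h' x) (at x)" "\<bar>h' x v\<bar> \<le> \<kappa> * sqrt (v \<bullet> (G x *v v))"
    if "x \<in> S" for x v
    using someI_ex[OF h[unfolded gradient_bound_def, rule_format, OF that]]
    unfolding h'_def by blast+
  have deriv: "((\<lambda>t. h (u t)) has_vector_derivative h' (u t) (u' t)) (at t within {0..1})"
    if t: "t \<in> {0..1}" for t
  proof -
    have "(u has_derivative (\<lambda>s. s *\<^sub>R u' t)) (at t within {0..1})"
      using arc(3)[OF t] by (simp add: has_vector_derivative_def)
    from has_derivative_compose[OF this h'(1)[OF uS[OF t]]]
    have "((\<lambda>t. h (u t)) has_derivative (\<lambda>s. h' (u t) (s *\<^sub>R u' t))) (at t within {0..1})" .
    moreover have "h' (u t) (s *\<^sub>R u' t) = s *\<^sub>R h' (u t) (u' t)" for s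
      by (rule linear_scale[OF has_derivative_linear[OF h'(1)[OF uS[OF t]]]])
    ultimately show ?thesis unfolding has_vector_derivative_def by simp
  qed
  have int: "((\<lambda>t. h' (u t) (u' t)) has_integral (h (u 1) - h (u 0))) {0..1}"
    using deriv by (intro fundamental_theorem_of_calculus) auto
  then have "\<bar>h (u 1) - h (u 0)\<bar> = norm (integral {0..1} (\<lambda>t. h' (u t) (u' t)))"
    by (simp add: integral_unique)
  also have "\<dots> \<le> integral {0..1} (\<lambda>t. \<kappa> * sqrt (u' t \<bullet> (G (u t) *v u' t)))"
  proof (rule Henstock_Kurzweil_Integration.integral_norm_bound_integral)
    show "(\<lambda>t. h' (u t) (u' t)) integrable_on {0..1}" using int by blast
    show "(\<lambda>t. \<kappa> * sqrt (u' t \<bullet> (G (u t) *v u' t))) integrable_on {0..1}"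
      using speed by (intro integrable_continuous_real continuous_on_mult continuous_on_const)
    show "norm (h' (u t) (u' t)) \<le> \<kappa> * sqrt (u' t \<bullet> (G (u t) *v u' t))" if "t \<in> {0..1}" for t
      using h'(2)[OF uS[OF that]] by simp
  qed
  finally show ?case using uS V by (simp add: H)
next
  case (concat P Q L R L')
  then show ?case by (simp add: distrib_left)
qed

text \<open>Straight segments in a small ball bound the distance from above, so that convergence of points in
\<open>\<real>\<^sup>n\<close> implies convergence of their orbits for the Riemannian distance.\<close>

lemma joined_nearby:
  assumes "w \<in> S"
  obtains e C where "0 < e" "0 \<le> C" "ball w e \<subseteq> S"
    "\<And>x y. x \<in> ball w e \<Longrightarrow> y \<in> ball w e \<Longrightarrow>
       \<exists>L. joined M (orbit a b x) (orbit a b y) L \<and> L \<le> C * dist x y"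
proof -
  define \<beta> where "\<beta> x = (\<Sum>i\<in>UNIV. \<Sum>j\<in>UNIV. \<bar>G x $ i $ j\<bar>)" for x
  have "continuous_on S \<beta>"
    unfolding \<beta>_def by (intro continuous_intros smooth_on_continuous[OF smooth_metric])
  then have "continuous (at w) \<beta>"
    using open_domain assms by (simp add: continuous_on_eq_continuous_at)
  then obtain d where d: "d > 0" "\<And>x. dist x w < d \<Longrightarrow> dist (\<beta> x) (\<beta> w) < 1"
    unfolding continuous_at_eps_delta by (metis zero_less_one)
  obtain r where r: "r > 0" "ball w r \<subseteq> S"
    using open_domain assms by (auto simp: open_contains_ball)
  define e where "e = min (min d r) 3"
  have e: "e > 0" "ball w e \<subseteq> S" "ball w e \<subseteq> ball w d" "ball w e \<subseteq> ball w 3"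
    using d r by (auto simp: e_def)
  have \<beta>0: "0 \<le> \<beta> w" by (simp add: \<beta>_def sum_nonneg)
  have chart: "(ball w e, orbit a b) \<in> atlas M"
    using e(2) inj_on_subset[OF inj_on_orbit_ball e(4)] by simp
  show ?thesis
  proof (rule that[of e "sqrt (\<beta> w + 1)"])
    fix x y assume xy: "x \<in> ball w e" "y \<in> ball w e"
    define u where "u t = x + t *\<^sub>R (y - x)" for t
    have seg: "u t \<in> ball w e" if "t \<in> {0..1}" for t
    proof -
      have "u t = (1 - t) *\<^sub>R x + t *\<^sub>R y" by (simp add: u_def algebra_simps)
      then show ?thesis
        using that xy convexD[OF convex_ball xy, of "1 - t" t] by auto
    qed
    have deriv: "(u has_vector_derivative (y - x)) (at t within {0..1})" for t
      unfolding u_def by (auto intro!: derivative_eq_intros)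
    let ?L = "integral {0..1} (\<lambda>t. sqrt ((y - x) \<bullet> (metric M (ball w e, orbit a b) (u t) *v (y - x))))"
    have "joined M (orbit a b (u 0)) (orbit a b (u 1)) ?L"
      by (rule joined.arc[OF chart, of u "\<lambda>_. y - x"]) (use seg deriv in auto)
    then have "joined M (orbit a b x) (orbit a b y) ?L" by (simp add: u_def)
    moreover have "?L \<le> integral {0..1::real} (\<lambda>t. sqrt (\<beta> w + 1) * dist x y)"
    proof (rule integral_le)
      have "continuous_on {0..1} u" unfolding u_def by (intro continuous_intros)
      then have "continuous_on {0..1} (\<lambda>t. sqrt ((y - x) \<bullet> (G (u t) *v (y - x))))"
        using seg e(2) by (intro speed_continuous) auto
      then show "(\<lambda>t. sqrt ((y - x) \<bullet> (metric M (ball w e, orbit a b) (u t) *v (y - x)))) integrable_on {0..1}"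
        by (simp add: integrable_continuous_real)
      fix t :: real assume t: "t \<in> {0..1}"
      have "\<beta> (u t) \<le> \<beta> w + 1"
        using d(2)[of "u t"] seg[OF t] e(3) by (auto simp: dist_real_def dist_commute subset_iff)
      then have "(y - x) \<bullet> (G (u t) *v (y - x)) \<le> (\<beta> w + 1) * (norm (y - x))\<^sup>2"
        using quadratic_form_le[of "y - x" "G (u t)", folded \<beta>_def]
        by (meson mult_right_mono order_trans zero_le_power2)
      then have "sqrt ((y - x) \<bullet> (G (u t) *v (y - x))) \<le> sqrt ((\<beta> w + 1) * (norm (y - x))\<^sup>2)"
        by (rule real_sqrt_le_mono)
      also have "\<dots> = sqrt (\<beta> w + 1) * dist x y"
        by (simp add: real_sqrt_mult dist_norm norm_minus_commute)
      finally show "sqrt ((y - x) \<bullet> (metric M (ball w e, orbit a b) (u t) *v (y - x)))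
          \<le> sqrt (\<beta> w + 1) * dist x y" by simp
    qed auto
    ultimately show "\<exists>L. joined M (orbit a b x) (orbit a b y) L \<and> L \<le> sqrt (\<beta> w + 1) * dist x y"
      by auto
  qed (use e \<beta>0 in auto)
qed

text \<open>The infimum in the distance is taken over a nonempty set: being joined in both directions is an
equivalence relation with open classes.\<close>

lemma joined_exists:
  assumes "x \<in> S" "y \<in> S"
  shows "\<exists>L. joined M (orbit a b x) (orbit a b y) L"
proof -
  define R where "R x y \<longleftrightarrow> (\<exists>L. joined M (orbit a b x) (orbit a b y) L) \<and>
    (\<exists>L. joined M (orbit a b y) (orbit a b x) L)" for x y
  have "R x y"
  proof (rule connected_equivalence_relation[OF connected_domain assms])
    show "R y x" if "R x y" for x y using that by (auto simp: R_def)
    show "R x z" if "R x y" "R y z" for x y z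
      using that unfolding R_def by (meson joined.concat)
    fix w assume w: "w \<in> S"
    obtain e C where e: "0 < e" "0 \<le> C" "ball w e \<subseteq> S"
      "\<And>x y. x \<in> ball w e \<Longrightarrow> y \<in> ball w e \<Longrightarrow>
         \<exists>L. joined M (orbit a b x) (orbit a b y) L \<and> L \<le> C * dist x y"
      using joined_nearby[OF w] by metis
    have "R w x" if "x \<in> ball w e" for x
      using e(4)[of w x] e(4)[of x w] that e(1) unfolding R_def by auto
    then show "\<exists>T. openin (top_of_set S) T \<and> w \<in> T \<and> (\<forall>x\<in>T. R w x)"
      using e(1,3) open_domain by (intro exI[of _ "ball w e"]) (auto simp: openin_open_eq)
  qed
  then show ?thesis by (simp add: R_def)
qed

lemma riem_dist_le: "joined M P Q L \<Longrightarrow> riem_dist M P Q \<le> L"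
  unfolding riem_dist_def using joined_nonneg by (intro cInf_lower) (auto intro!: bdd_belowI[of _ 0])

lemma riem_dist_greatest:
  assumes "P \<in> orbit a b ` S" "Q \<in> orbit a b ` S" "\<And>L. joined M P Q L \<Longrightarrow> c \<le> L"
  shows "c \<le> riem_dist M P Q"
  unfolding riem_dist_def using joined_exists assms by (intro cInf_greatest) auto

lemma riem_dist_nonneg:
  "P \<in> orbit a b ` S \<Longrightarrow> Q \<in> orbit a b ` S \<Longrightarrow> 0 \<le> riem_dist M P Q"
  using riem_dist_greatest joined_nonneg by blast

lemma riem_dist_triangle:
  assumes "P \<in> orbit a b ` S" "Q \<in> orbit a b ` S" "R \<in> orbit a b ` S"
  shows "riem_dist M P R \<le> riem_dist M P Q + riem_dist M Q R"
proof -
  have "riem_dist M P R - L \<le> riem_dist M Q R" if L: "joined M P Q L" for L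
  proof (rule riem_dist_greatest[OF assms(2,3)])
    show "riem_dist M P R - L \<le> L'" if "joined M Q R L'" for L'
      using riem_dist_le[OF joined.concat[OF L that]] by simp
  qed
  then have "riem_dist M P R - riem_dist M Q R \<le> riem_dist M P Q"
    by (intro riem_dist_greatest assms(1,2)) (metis diff_le_eq add.commute)
  then show ?thesis by simp
qed

lemma riem_dist_gradient_bound:
  assumes "gradient_bound h \<kappa>" "0 < \<kappa>" "\<And>x t. x \<in> S \<Longrightarrow> t \<in> periods a b \<Longrightarrow> h (x + t) = h x"
    "x \<in> S" "y \<in> S"
  shows "\<bar>h y - h x\<bar> \<le> \<kappa> * riem_dist M (orbit a b x) (orbit a b y)"
proof -
  define H where "H P = h (SOME x. x \<in> S \<and> orbit a b x = P)" for P
  have H: "H (orbit a b x) = h x" if x: "x \<in> S" for x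
  proof -
    let ?y = "SOME y. y \<in> S \<and> orbit a b y = orbit a b x"
    have y: "?y \<in> S \<and> orbit a b ?y = orbit a b x" by (rule someI[of _ x]) (use x in simp)
    then have "?y - x \<in> periods a b" by (metis orbit_eq_iff)
    from assms(3)[OF x this] show ?thesis by (simp add: H_def)
  qed
  have "\<bar>h y - h x\<bar> / \<kappa> \<le> riem_dist M (orbit a b x) (orbit a b y)"
    using joined_gradient_bound[OF assms(1) H, of "orbit a b x" "orbit a b y"] assms(2,4,5) H
    by (intro riem_dist_greatest) (auto simp: divide_le_eq mult.commute)
  then show ?thesis using assms(2) by (simp add: divide_le_eq mult.commute)
qed

end

definition period_box :: "'n \<Rightarrow> 'n::finite \<Rightarrow> (real^'n) set" where
  "period_box a b = {w. \<forall>i. i \<noteq> a \<longrightarrow> i \<noteq> b \<longrightarrow> w $ i \<in> {0..2 * pi}}"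

lemma (in periodic_domain) representative_in_box:
  assumes "x \<in> S"
  obtains y where "y \<in> S" "orbit a b y = orbit a b x" "y \<in> period_box a b"
proof -
  define t :: "real^'n" where
    "t = (\<chi> i. if i = a \<or> i = b then 0 else 2 * pi * of_int (- \<lfloor>x $ i / (2 * pi)\<rfloor>))"
  have "\<exists>k. t $ i = 2 * pi * real_of_int k" for i
    by (cases "i = a \<or> i = b") (auto simp: t_def intro: exI[of _ 0] exI[of _ "- \<lfloor>x $ i / (2 * pi)\<rfloor>"])
  then have t: "t \<in> periods a b" by (auto simp: periods_def t_def)
  have "(x + t) $ i \<in> {0..2 * pi}" if "i \<noteq> a" "i \<noteq> b" for i
  proof -
    define k where "k = real_of_int \<lfloor>x $ i / (2 * pi)\<rfloor>"
    have "k \<le> x $ i / (2 * pi)" "x $ i / (2 * pi) \<le> k + 1" unfolding k_def by linarith+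
    then have "2 * pi * k \<le> x $ i" "x $ i \<le> 2 * pi * (k + 1)"
      by (simp_all add: field_simps)
    moreover have "(x + t) $ i = x $ i - 2 * pi * k" using that by (simp add: t_def k_def)
    ultimately show ?thesis by (simp add: algebra_simps)
  qed
  then have "x + t \<in> period_box a b" by (simp add: period_box_def)
  then show ?thesis using that[of "x + t"] add_period[OF assms t] orbit_add_period[OF t] by blast
qed

lemma (in periodic_domain) orbit_in_image_of_box:
  assumes x: "x \<in> S" and T: "\<And>y t. t \<in> periods a b \<Longrightarrow> T (y + t) = T y"
  shows "orbit a b x \<in> orbit a b ` {y. T y \<and> y \<in> period_box a b} \<longleftrightarrow> T x"
    (is "_ \<in> orbit a b ` ?B \<longleftrightarrow> _")
proof
  assume "orbit a b x \<in> orbit a b ` ?B"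
  then obtain y where y: "T y" "orbit a b y = orbit a b x" by auto
  then have "x - y \<in> periods a b" by (simp add: orbit_eq_iff)
  from T[OF this, of y] show "T x" using y(1) by simp
next
  assume Tx: "T x"
  obtain y where y: "orbit a b y = orbit a b x" "y \<in> period_box a b"
    using representative_in_box[OF x] by metis
  have "x - y \<in> periods a b" using y(1) by (simp add: orbit_eq_iff)
  from T[OF this, of y] have "y \<in> ?B" using Tx y(2) by simp
  then show "orbit a b x \<in> orbit a b ` ?B" using y(1) by blast
qed

context riemannian_domain
begin

text \<open>A substitute for the Hopf--Rinow theorem: if some periodic Lipschitz functions are
jointly proper modulo the lattice, then a Cauchy sequence stays in a compact set, has a
subsequence converging in \<open>\<real>\<^sup>n\<close>, and hence converges.\<close>

lemma complete_if_proper: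
  fixes F :: "(real^'n \<Rightarrow> real) set"
  assumes bound: "\<And>h. h \<in> F \<Longrightarrow> \<exists>\<kappa>>0. gradient_bound h \<kappa>"
    and periodic: "\<And>h x t. h \<in> F \<Longrightarrow> x \<in> S \<Longrightarrow> t \<in> periods a b \<Longrightarrow> h (x + t) = h x"
    and proper: "\<And>c. compact {x \<in> S. x \<in> period_box a b \<and>
                  (\<forall>h\<in>F. \<bar>h x\<bar> \<le> c h)}"
  shows "complete_riem M"
  unfolding complete_riem_def
proof (intro allI impI, elim conjE)
  fix \<sigma> :: "nat \<Rightarrow> (real^'n) set" assume range: "range \<sigma> \<subseteq> topspace (mtop M)"
    and cauchy: "\<forall>\<epsilon>>0. \<exists>N. \<forall>i\<ge>N. \<forall>j\<ge>N. riem_dist M (\<sigma> i) (\<sigma> j) < \<epsilon>"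
  have \<sigma>: "\<sigma> i \<in> orbit a b ` S" for i using range by (auto simp: topspace_quot)
  have "\<forall>i. \<exists>y. y \<in> S \<and> orbit a b y = \<sigma> i \<and> y \<in> period_box a b"
  proof
    fix i
    obtain x where x: "x \<in> S" "\<sigma> i = orbit a b x" using \<sigma>[of i] by blast
    show "\<exists>y. y \<in> S \<and> orbit a b y = \<sigma> i \<and> y \<in> period_box a b"
      by (rule representative_in_box[OF x(1)]) (use x(2) in auto)
  qed
  from choice[OF this] obtain w where W: "\<forall>i. w i \<in> S \<and> orbit a b (w i) = \<sigma> i \<and>
      w i \<in> period_box a b" by (rule exE)
  have w: "w i \<in> S" "orbit a b (w i) = \<sigma> i" "w i \<in> period_box a b" for i
    using W[THEN spec, of i] by blast+
  obtain N where N: "\<And>i j. i \<ge> N \<Longrightarrow> j \<ge> N \<Longrightarrow> riem_dist M (\<sigma> i) (\<sigma> j) < 1"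
    using cauchy[rule_format, OF zero_less_one] by blast
  have "\<forall>h\<in>F. \<exists>\<kappa>>0. gradient_bound h \<kappa>" using bound by blast
  from bchoice[OF this] obtain \<kappa> where "\<forall>h\<in>F. 0 < \<kappa> h \<and> gradient_bound h (\<kappa> h)" by (rule exE)
  then have \<kappa>: "\<And>h. h \<in> F \<Longrightarrow> 0 < \<kappa> h" "\<And>h. h \<in> F \<Longrightarrow> gradient_bound h (\<kappa> h)" by simp_all
  define c where "c h = \<bar>h (w N)\<bar> + \<kappa> h" for h
  define K where "K = {x \<in> S. x \<in> period_box a b \<and>
                  (\<forall>h\<in>F. \<bar>h x\<bar> \<le> c h)}"
  have wK: "w (N + i) \<in> K" for i
  proof -
    have "\<bar>h (w (N + i))\<bar> \<le> c h" if h: "h \<in> F" for h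
    proof -
      have "\<bar>h (w (N + i)) - h (w N)\<bar> \<le> \<kappa> h * riem_dist M (\<sigma> N) (\<sigma> (N + i))"
        using riem_dist_gradient_bound[OF \<kappa>(2,1) periodic w(1,1), OF h h h, of "N + i" N]
        by (simp add: w(2))
      also have "\<dots> \<le> \<kappa> h * 1"
        using N[of N "N + i"] \<kappa>(1)[OF h] by (intro mult_left_mono) auto
      finally show ?thesis by (simp add: c_def)
    qed
    then show ?thesis using w(1,3) by (auto simp: K_def)
  qed
  have "seq_compact K" unfolding K_def using proper by (rule compact_imp_seq_compact)
  then obtain q r where q: "q \<in> K" "strict_mono r" "((\<lambda>i. w (N + i)) \<circ> r) \<longlonglongrightarrow> q"
    by (rule seq_compactE[where f = "\<lambda>i. w (N + i)"]) (use wK in blast)+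
  have qS: "q \<in> S" using q(1) by (simp add: K_def)
  obtain e C where e: "0 < e" "0 \<le> C"
    "\<And>x y. x \<in> ball q e \<Longrightarrow> y \<in> ball q e \<Longrightarrow>
       \<exists>L. joined M (orbit a b x) (orbit a b y) L \<and> L \<le> C * dist x y"
    using joined_nearby[OF qS] by metis
  show "\<exists>q\<in>topspace (mtop M). (\<lambda>i. riem_dist M (\<sigma> i) q) \<longlonglongrightarrow> 0"
  proof (intro bexI[of _ "orbit a b q"] LIMSEQ_I)
    fix \<epsilon> :: real assume \<epsilon>: "0 < \<epsilon>"
    obtain N' where N': "\<And>i j. i \<ge> N' \<Longrightarrow> j \<ge> N' \<Longrightarrow> riem_dist M (\<sigma> i) (\<sigma> j) < \<epsilon> / 2"
      using cauchy[rule_format, OF half_gt_zero[OF \<epsilon>]] by blast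
    define \<delta> where "\<delta> = min e (\<epsilon> / (2 * (C + 1)))"
    have "\<delta> > 0" using e \<epsilon> by (simp add: \<delta>_def)
    then obtain k0 where k0: "\<And>k. k \<ge> k0 \<Longrightarrow> dist (w (N + r k)) q < \<delta>"
      using q(3) unfolding lim_sequentially by (auto simp: o_def)
    define k where "k = max k0 N'"
    have near: "dist (w (N + r k)) q < \<delta>" by (rule k0) (simp add: k_def)
    then obtain L where L: "joined M (\<sigma> (N + r k)) (orbit a b q) L" "L \<le> C * dist (w (N + r k)) q"
      using e(1) e(3)[of "w (N + r k)" q] by (auto simp: \<delta>_def dist_commute w(2))
    have "C * dist (w (N + r k)) q \<le> C * (\<epsilon> / (2 * (C + 1)))"
      using near e(2) by (intro mult_left_mono) (auto simp: \<delta>_def)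
    also have "\<dots> \<le> \<epsilon> / 2" using e(2) \<epsilon> by (simp add: field_simps)
    finally have close: "riem_dist M (\<sigma> (N + r k)) (orbit a b q) \<le> \<epsilon> / 2"
      using riem_dist_le[OF L(1)] L(2) by linarith
    have "N + r k \<ge> N'"
      using seq_suble[OF q(2), of k] by (simp add: k_def)
    have "norm (riem_dist M (\<sigma> i) (orbit a b q) - 0) < \<epsilon>" if "i \<ge> N'" for i
      using riem_dist_triangle[OF \<sigma>[of i] \<sigma>[of "N + r k"], of "orbit a b q"] qS close
        N'[OF that \<open>N + r k \<ge> N'\<close>] riem_dist_nonneg[OF \<sigma>[of i], of "orbit a b q"] by simp
    then show "\<exists>no. \<forall>n\<ge>no. norm (riem_dist M (\<sigma> n) (orbit a b q) - 0) < \<epsilon>" by blast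
  qed (use qS in \<open>simp add: topspace_quot\<close>)
qed

end

section \<open>Curvature of diagonal metrics\<close>

subsection \<open>Partial derivatives\<close>

lemma partial_eqI: "(f has_derivative f') (at x) \<Longrightarrow> partial k f x = f' (axis k 1)"
  unfolding partial_def by (simp flip: frechet_derivative_at)

lemma partial_cong:
  assumes "open W" "x \<in> W" "\<And>y. y \<in> W \<Longrightarrow> f y = g y"
  shows "partial k f x = partial k g x"
proof -
  have "(f has_derivative d) (at x) \<longleftrightarrow> (g has_derivative d) (at x)" for d
    using has_derivative_transform_within_open[of f d x UNIV W g]
      has_derivative_transform_within_open[of g d x UNIV W f] assms by metis
  then show ?thesis unfolding partial_def frechet_derivative_def by simp
qed

lemma smooth_on_partial:
  fixes f :: "real^'n \<Rightarrow> real"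
  assumes "smooth_on W f"
  shows "smooth_on W (partial k f)"
  unfolding smooth_on_def partial_def
proof
  show "C_k_on m W (\<lambda>x. frechet_derivative f (at x) (axis k 1))" for m
    by (rule C_k_on_SucE(2)) (use assms in \<open>simp add: smooth_on_def del: C_k_on.simps\<close>)
qed

definition diagonal :: "('n \<Rightarrow> real) \<Rightarrow> real^'n^'n::finite" where
  "diagonal d = (\<chi> i j. if i = j then d i else 0)"

lemma diagonal_nth: "diagonal d $ i $ j = (if i = j then d i else 0)"
  by (simp add: diagonal_def)

lemma sum_if_mult: "(\<Sum>l\<in>UNIV. (if k = l then c else 0) * X l) = c * (X k :: real)" for k :: "'n::finite"
proof -
  have "(if k = l then c else 0) * X l = (if k = l then c * X k else 0)" for l by simp
  then show ?thesis by simp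
qed

lemma transpose_diagonal: "transpose (diagonal d) = diagonal d"
  by (simp add: transpose_def diagonal_def vec_eq_iff)

lemma diagonal_mult_vec: "(diagonal d *v v) $ i = d i * v $ i"
  by (simp add: matrix_vector_mult_def diagonal_def if_distrib[of "\<lambda>x. x * _"] cong: if_cong)

lemma diagonal_quadratic: "v \<bullet> (diagonal d *v w) = (\<Sum>i\<in>UNIV. d i * (v $ i * w $ i))"
  by (simp add: inner_vec_def diagonal_mult_vec mult_ac)

lemma diagonal_mult: "diagonal d ** diagonal e = diagonal (\<lambda>i. d i * e i)"
proof -
  have "(diagonal d ** diagonal e) $ i $ j = diagonal (\<lambda>i. d i * e i) $ i $ j" for i j
  proof -
    have "(diagonal d ** diagonal e) $ i $ j
        = (\<Sum>k\<in>UNIV. (if i = k then d i else 0) * (if k = j then e k else 0))"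
      by (simp add: matrix_matrix_mult_def diagonal_nth)
    also have "\<dots> = (\<Sum>k\<in>UNIV. if i = k then d i * (if i = j then e i else 0) else 0)"
      by (rule sum.cong) auto
    finally show ?thesis by (simp add: diagonal_nth)
  qed
  then show ?thesis by (simp add: vec_eq_iff)
qed

lemma matrix_inv_diagonal:
  assumes "\<And>i. d i \<noteq> 0"
  shows "matrix_inv (diagonal d) = diagonal (\<lambda>i. inverse (d i))"
proof -
  have *: "diagonal (\<lambda>i. 1) = mat 1" by (simp add: diagonal_def mat_def)
  have "diagonal d ** diagonal (\<lambda>i. inverse (d i)) = mat 1"
    "diagonal (\<lambda>i. inverse (d i)) ** diagonal d = mat 1"
    using assms by (simp_all add: diagonal_mult *)
  then have "\<exists>B. diagonal d ** B = mat 1 \<and> B ** diagonal d = mat 1" by blast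
  from someI_ex[OF this] have inv: "matrix_inv (diagonal d) ** diagonal d = mat 1"
    unfolding matrix_inv_def by blast
  have "matrix_inv (diagonal d) = matrix_inv (diagonal d) ** (diagonal d ** diagonal (\<lambda>i. inverse (d i)))"
    by (simp add: \<open>diagonal d ** _ = mat 1\<close>)
  also have "\<dots> = diagonal (\<lambda>i. inverse (d i))" by (simp add: matrix_mul_assoc inv)
  finally show ?thesis .
qed

subsection \<open>Scalar curvature as a sum of sectional curvatures\<close>

lemma riemann_coeff_same [simp]: "riemann_coeff G i i i i x = 0"
  by (simp add: riemann_coeff_def)

lemma scalar_curvature_diagonal_eq_sum:
  assumes "G x = diagonal d" and "\<And>i. d i \<noteq> 0"
  shows "scalar_curvature G x = (\<Sum>j\<in>UNIV. \<Sum>i\<in>UNIV. inverse (d j) * riemann_coeff G i j i j x)"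
proof -
  have "scalar_curvature G x = (\<Sum>j\<in>UNIV. inverse (d j) * (\<Sum>i\<in>UNIV. riemann_coeff G i j i j x))"
    unfolding scalar_curvature_def assms(1) matrix_inv_diagonal[OF assms(2)] ricci_def diagonal_nth
    by (simp add: if_distrib[of "\<lambda>x. x * _"] cong: if_cong)
  then show ?thesis by (simp only: sum_distrib_left)
qed

lemma sectional_curvature_diagonal:
  assumes G: "G x = diagonal d" and "\<And>i. d i \<noteq> 0" and "i \<noteq> j"
  shows "sectional_curvature G x (axis i 1) (axis j 1) = riemann_coeff G i j i j x / d j"
proof -
  have quad: "axis k 1 \<bullet> (diagonal d *v v) = d k * v $ k" for k v
    by (simp add: inner_axis' diagonal_mult_vec)
  have "curvature_op G x (axis i 1) (axis j 1) (axis j 1) $ l = riemann_coeff G l j i j x" for l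
  proof -
    have "curvature_op G x (axis i 1) (axis j 1) (axis j 1) $ l
        = (\<Sum>i'\<in>UNIV. \<Sum>j'\<in>UNIV. \<Sum>k\<in>UNIV. if k = j then
            (if j' = j then (if i' = i then riemann_coeff G l j i j x else 0) else 0) else 0)"
      unfolding curvature_op_def vec_lambda_beta axis_def
      by (intro sum.cong refl) auto
    then show ?thesis by simp
  qed
  then show ?thesis
    unfolding sectional_curvature_def G quad using assms(2)[of i] assms(2)[of j] \<open>i \<noteq> j\<close>
    by (simp add: axis_def)
qed

text \<open>For a diagonal metric the coordinate vectors are orthogonal, and the scalar curvature is the sum of
the sectional curvatures of the \<open>n (n - 1)\<close> ordered pairs of coordinate vectors.\<close>

lemma hyperbolic_imp_scalar_curvature:
  fixes G :: "real^'n \<Rightarrow> real^'n^'n"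
  assumes G: "G x = diagonal d" and d: "\<And>i. d i \<noteq> 0"
    and sec: "\<And>v w. v \<noteq> w \<Longrightarrow> independent {v, w} \<Longrightarrow> sectional_curvature G x v w = -1"
  shows "scalar_curvature G x = - (real CARD('n) * (real CARD('n) - 1))"
proof -
  have "inverse (d j) * riemann_coeff G i j i j x = (if i = j then 0 else -1)" for i j
  proof (cases "i = j")
    case False
    then have ne: "axis i (1::real) \<noteq> axis j 1" by (simp add: axis_eq_axis)
    have "independent {axis i (1::real), axis j 1}"
      by (rule independent_mono[OF independent_Basis]) (auto simp: axis_in_Basis_iff)
    from sec[OF ne this] show ?thesis
      using sectional_curvature_diagonal[where G = G and x = x and d = d, OF G d False] False d[of j]
      by (simp add: field_simps)
  qed simp
  then have "scalar_curvature G x = (\<Sum>j\<in>(UNIV::'n set). \<Sum>i\<in>(UNIV::'n set). if i = j then 0 else -1)"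
    unfolding scalar_curvature_diagonal_eq_sum[where G = G and x = x and d = d, OF G d] by simp
  also have "\<dots> = (\<Sum>j\<in>(UNIV::'n set). \<Sum>i\<in>(UNIV::'n set). (if i = j then 1 else 0) - (1::real))"
    by (intro sum.cong) auto
  also have "\<dots> = - (real CARD('n) * (real CARD('n) - 1))"
    by (simp add: sum_subtractf algebra_simps)
  finally show ?thesis .
qed

subsection \<open>Scalar curvature in logarithmic form\<close>

text \<open>Writing the entries as \<open>exp (2 \<psi>\<^sub>i)\<close> makes the Christoffel symbols polynomial in the derivatives of
the \<open>\<psi>\<^sub>i\<close>, apart from the factors \<open>exp (2 \<psi>\<^sub>i - 2 \<psi>\<^sub>k)\<close>.\<close>

locale diagonal_metric =
  fixes W :: "(real^'n) set" and \<psi> :: "'n::finite \<Rightarrow> real^'n \<Rightarrow> real" and G :: "real^'n \<Rightarrow> real^'n^'n"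
  assumes open_W: "open W" and smooth_\<psi>: "smooth_on W (\<psi> i)"
    and G_eq: "y \<in> W \<Longrightarrow> G y = diagonal (\<lambda>i. exp (2 * \<psi> i y))"
begin

abbreviation d\<psi> :: "'n \<Rightarrow> 'n \<Rightarrow> real^'n \<Rightarrow> real" where
  "d\<psi> k j \<equiv> partial k (\<psi> j)"

lemma \<psi>_derivative: "y \<in> W \<Longrightarrow> (\<psi> j has_derivative frechet_derivative (\<psi> j) (at y)) (at y)"
  by (rule smooth_on_has_derivative[OF smooth_\<psi>])

lemma d\<psi>_derivative: "y \<in> W \<Longrightarrow> (d\<psi> k j has_derivative frechet_derivative (d\<psi> k j) (at y)) (at y)"
  by (rule smooth_on_has_derivative[OF smooth_on_partial[OF smooth_\<psi>]])

lemma partial_G: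
  assumes y: "y \<in> W"
  shows "partial k (\<lambda>y. G y $ i $ j) y = (if i = j then 2 * d\<psi> k i y * exp (2 * \<psi> i y) else 0)"
proof -
  have "partial k (\<lambda>y. G y $ i $ j) y = partial k (\<lambda>y. if i = j then exp (2 * \<psi> i y) else 0) y"
    by (rule partial_cong[OF open_W y]) (simp add: G_eq diagonal_nth)
  also have "\<dots> = (if i = j then 2 * d\<psi> k i y * exp (2 * \<psi> i y) else 0)"
  proof (cases "i = j")
    case True
    have "((\<lambda>y. exp (2 * \<psi> i y)) has_derivative
        (\<lambda>h. exp (2 * \<psi> i y) * (2 * frechet_derivative (\<psi> i) (at y) h))) (at y)"
      by (auto intro!: derivative_eq_intros \<psi>_derivative[OF y])
    from partial_eqI[OF this] show ?thesis using True by (simp add: partial_def)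
  next
    case False
    then show ?thesis by (simp add: partial_def)
  qed
  finally show ?thesis .
qed

lemma christoffel_eq:
  assumes y: "y \<in> W"
  shows "christoffel G k i j y = (if j = k then d\<psi> i k y else 0) + (if i = k then d\<psi> j k y else 0)
    - (if i = j then exp (2 * \<psi> i y - 2 * \<psi> k y) * d\<psi> k i y else 0)"
proof -
  have inv: "matrix_inv (G y) = diagonal (\<lambda>i. inverse (exp (2 * \<psi> i y)))"
    unfolding G_eq[OF y] by (rule matrix_inv_diagonal) simp
  have "christoffel G k i j y = (1/2) * (inverse (exp (2 * \<psi> k y)) *
     ((if j = k then 2 * d\<psi> i j y * exp (2 * \<psi> j y) else 0)
      + (if i = k then 2 * d\<psi> j i y * exp (2 * \<psi> i y) else 0)
      - (if i = j then 2 * d\<psi> k i y * exp (2 * \<psi> i y) else 0)))"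
    unfolding christoffel_def inv diagonal_nth sum_if_mult partial_G[OF y] ..
  also have "\<dots> = (if j = k then d\<psi> i k y else 0) + (if i = k then d\<psi> j k y else 0)
    - (if i = j then exp (2 * \<psi> i y - 2 * \<psi> k y) * d\<psi> k i y else 0)"
    by (cases "j = k"; cases "i = k"; cases "i = j") (simp_all add: exp_diff field_simps)
  finally show ?thesis .
qed

lemma riemann_coeff_eq:
  assumes x: "x \<in> W" and ij: "i \<noteq> j"
  shows "exp (- 2 * \<psi> j x) * riemann_coeff G i j i j x =
    - (\<Sum>m\<in>UNIV. exp (- 2 * \<psi> m x) * (d\<psi> m i x * d\<psi> m j x))
    - exp (- 2 * \<psi> i x) * (partial i (d\<psi> i j) x + (d\<psi> i j x)\<^sup>2 - 2 * d\<psi> i i x * d\<psi> i j x)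
    - exp (- 2 * \<psi> j x) * (partial j (d\<psi> j i) x + (d\<psi> j i x)\<^sup>2 - 2 * d\<psi> j j x * d\<psi> j i x)"
proof -
  define e where "e = exp (2 * \<psi> j x - 2 * \<psi> i x)"
  have "partial i (christoffel G i j j) x = partial i (\<lambda>y. - (exp (2 * \<psi> j y - 2 * \<psi> i y) * d\<psi> i j y)) x"
    by (rule partial_cong[OF open_W x]) (use ij in \<open>simp add: christoffel_eq\<close>)
  also have "\<dots> = - (e * (2 * d\<psi> i j x - 2 * d\<psi> i i x) * d\<psi> i j x + e * partial i (d\<psi> i j) x)"
  proof -
    have "((\<lambda>y. - (exp (2 * \<psi> j y - 2 * \<psi> i y) * d\<psi> i j y)) has_derivative
       (\<lambda>h. - (e * (2 * frechet_derivative (\<psi> j) (at x) h - 2 * frechet_derivative (\<psi> i) (at x) h) * d\<psi> i j x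
              + e * frechet_derivative (d\<psi> i j) (at x) h))) (at x)"
      unfolding e_def
      by (auto intro!: derivative_eq_intros \<psi>_derivative[OF x] d\<psi>_derivative[OF x])
    from partial_eqI[OF this] show ?thesis by (simp add: partial_def)
  qed
  finally have 1: "partial i (christoffel G i j j) x
    = - (e * (2 * d\<psi> i j x - 2 * d\<psi> i i x) * d\<psi> i j x + e * partial i (d\<psi> i j) x)" .
  have 2: "partial j (christoffel G i i j) x = partial j (d\<psi> j i) x"
    by (rule partial_cong[OF open_W x]) (use ij in \<open>simp add: christoffel_eq\<close>)
  have "christoffel G i i m x * christoffel G m j j x =
     (if m = j then 2 * d\<psi> j i x * d\<psi> j j x else 0)
     - exp (2 * \<psi> j x) * (exp (- 2 * \<psi> m x) * (d\<psi> m i x * d\<psi> m j x))" for m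
    by (auto simp: christoffel_eq[OF x] exp_diff exp_minus divide_inverse algebra_simps)
  then have 3: "(\<Sum>m\<in>UNIV. christoffel G i i m x * christoffel G m j j x) = 2 * d\<psi> j i x * d\<psi> j j x
     - exp (2 * \<psi> j x) * (\<Sum>m\<in>UNIV. exp (- 2 * \<psi> m x) * (d\<psi> m i x * d\<psi> m j x))"
    by (simp add: sum_subtractf sum_distrib_left)
  have "christoffel G i j m x * christoffel G m i j x =
     (if m = i then (d\<psi> j i x)\<^sup>2 else 0) - (if m = j then e * (d\<psi> i j x)\<^sup>2 else 0)" for m
    using ij by (auto simp: christoffel_eq[OF x] e_def power2_eq_square)
  then have 4: "(\<Sum>m\<in>UNIV. christoffel G i j m x * christoffel G m i j x)
      = (d\<psi> j i x)\<^sup>2 - e * (d\<psi> i j x)\<^sup>2"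
    by (simp add: sum_subtractf)
  have e: "exp (- 2 * \<psi> j x) * e = exp (- 2 * \<psi> i x)" "exp (- 2 * \<psi> j x) * exp (2 * \<psi> j x) = 1"
    by (simp_all add: e_def flip: exp_add)
  have "riemann_coeff G i j i j x =
     - (e * (2 * d\<psi> i j x - 2 * d\<psi> i i x) * d\<psi> i j x + e * partial i (d\<psi> i j) x)
     - partial j (d\<psi> j i) x
     + (2 * d\<psi> j i x * d\<psi> j j x
     - exp (2 * \<psi> j x) * (\<Sum>m\<in>UNIV. exp (- 2 * \<psi> m x) * (d\<psi> m i x * d\<psi> m j x)))
     - ((d\<psi> j i x)\<^sup>2 - e * (d\<psi> i j x)\<^sup>2)"
    unfolding riemann_coeff_def 1 2 sum_subtractf 3 4 by simp
  note coeff = this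
  have "exp (- 2 * \<psi> j x) * riemann_coeff G i j i j x =
     - ((exp (- 2 * \<psi> j x) * e) * ((2 * d\<psi> i j x - 2 * d\<psi> i i x) * d\<psi> i j x + partial i (d\<psi> i j) x - (d\<psi> i j x)\<^sup>2))
     - exp (- 2 * \<psi> j x) * (partial j (d\<psi> j i) x - 2 * d\<psi> j i x * d\<psi> j j x + (d\<psi> j i x)\<^sup>2)
     - (exp (- 2 * \<psi> j x) * exp (2 * \<psi> j x)) * (\<Sum>m\<in>UNIV. exp (- 2 * \<psi> m x) * (d\<psi> m i x * d\<psi> m j x))"
    unfolding coeff by (simp add: algebra_simps power2_eq_square)
  then show ?thesis unfolding e by (simp add: algebra_simps power2_eq_square)
qed

text \<open>The coefficient of \<open>exp (- 2 \<psi>\<^sub>k)\<close> in the scalar curvature. The sectional curvatures contain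
mixed terms in three indices. Summed over all pairs, they collect into squares of sums, and only
derivatives in one direction \<open>k\<close> at a time remain. For the metric below all but three of the
summands vanish.\<close>

definition curvature_term :: "'n \<Rightarrow> real^'n \<Rightarrow> real" where
  "curvature_term k x =
     2 * partial k (d\<psi> k k) x - 2 * (d\<psi> k k x)\<^sup>2 + 4 * d\<psi> k k x * (\<Sum>j\<in>UNIV. d\<psi> k j x)
     - (\<Sum>j\<in>UNIV. d\<psi> k j x)\<^sup>2 - (\<Sum>j\<in>UNIV. (d\<psi> k j x)\<^sup>2) - 2 * (\<Sum>j\<in>UNIV. partial k (d\<psi> k j) x)"

lemma scalar_curvature_eq:
  assumes x: "x \<in> W"
  shows "scalar_curvature G x = (\<Sum>k\<in>UNIV. exp (- 2 * \<psi> k x) * curvature_term k x)"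
proof -
  define E where "E k = exp (- 2 * \<psi> k x)" for k
  define D where "D k j = d\<psi> k j x" for k j
  define DD where "DD k j = partial k (d\<psi> k j) x" for k j
  define T where "T i j = E i * (DD i j + (D i j)\<^sup>2 - 2 * D i i * D i j)" for i j
  define P where "P i j = (\<Sum>m\<in>UNIV. E m * (D m i * D m j))" for i j
  \<comment> \<open>The formula for distinct indices is extended to \<open>i = j\<close>, and the surplus is added back, so that the
sums below run over all pairs.\<close>
  have K: "inverse (exp (2 * \<psi> j x)) * riemann_coeff G i j i j x =
     - P i j - T i j - T j i + (if i = j then P i i + 2 * T i i else 0)" for i j
  proof (cases "i = j")
    case False
    then show ?thesis
      using riemann_coeff_eq[OF x False] by (simp add: E_def D_def DD_def T_def P_def exp_minus)
  qed simp
  have sP: "(\<Sum>j\<in>UNIV. \<Sum>i\<in>UNIV. P i j) = (\<Sum>k\<in>UNIV. E k * (\<Sum>j\<in>UNIV. D k j)\<^sup>2)"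
  proof -
    have "(\<Sum>j\<in>UNIV. \<Sum>i\<in>UNIV. P i j) = (\<Sum>j\<in>UNIV. \<Sum>k\<in>UNIV. \<Sum>i\<in>UNIV. E k * (D k i * D k j))"
      unfolding P_def by (rule sum.cong[OF refl sum.swap])
    also have "\<dots> = (\<Sum>k\<in>UNIV. \<Sum>j\<in>UNIV. \<Sum>i\<in>UNIV. E k * (D k i * D k j))" by (rule sum.swap)
    also have "\<dots> = (\<Sum>k\<in>UNIV. E k * (\<Sum>j\<in>UNIV. D k j)\<^sup>2)"
    proof (rule sum.cong[OF refl])
      fix k
      have "E k * (\<Sum>j\<in>UNIV. D k j)\<^sup>2 = (\<Sum>j\<in>UNIV. \<Sum>i\<in>UNIV. E k * (D k j * D k i))"
        unfolding power2_eq_square unfolding sum_product unfolding sum_distrib_left ..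
      then show "(\<Sum>j\<in>UNIV. \<Sum>i\<in>UNIV. E k * (D k i * D k j)) = E k * (\<Sum>j\<in>UNIV. D k j)\<^sup>2"
        by (subst sum.swap) simp
    qed
    finally show ?thesis .
  qed
  have sP': "(\<Sum>i\<in>UNIV. P i i) = (\<Sum>k\<in>UNIV. E k * (\<Sum>j\<in>UNIV. (D k j)\<^sup>2))"
    unfolding P_def power2_eq_square sum_distrib_left by (rule sum.swap)
  have sT: "(\<Sum>j\<in>UNIV. T k j) =
     E k * ((\<Sum>j\<in>UNIV. DD k j) + (\<Sum>j\<in>UNIV. (D k j)\<^sup>2) - 2 * D k k * (\<Sum>j\<in>UNIV. D k j))" for k
    unfolding T_def by (simp add: sum_distrib_left sum.distrib sum_subtractf algebra_simps)
  have "scalar_curvature G x = (\<Sum>j\<in>UNIV. \<Sum>i\<in>UNIV.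
      - P i j - T i j - T j i + (if i = j then P i i + 2 * T i i else 0))"
    unfolding scalar_curvature_diagonal_eq_sum[where G = G and x = x and d = "\<lambda>i. exp (2 * \<psi> i x)", OF G_eq[OF x] exp_not_eq_zero] K ..
  also have "\<dots> = - (\<Sum>j\<in>UNIV. \<Sum>i\<in>UNIV. P i j) - (\<Sum>j\<in>UNIV. \<Sum>i\<in>UNIV. T i j)
      - (\<Sum>j\<in>UNIV. \<Sum>i\<in>UNIV. T j i) + (\<Sum>i\<in>UNIV. P i i) + 2 * (\<Sum>i\<in>UNIV. T i i)"
    by (simp add: sum.distrib sum_subtractf sum_negf sum_distrib_left)
  also have "(\<Sum>j\<in>UNIV. \<Sum>i\<in>UNIV. T i j) = (\<Sum>j\<in>UNIV. \<Sum>i\<in>UNIV. T j i)" by (rule sum.swap)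
  also have "- (\<Sum>j\<in>UNIV. \<Sum>i\<in>UNIV. P i j) - (\<Sum>j\<in>UNIV. \<Sum>i\<in>UNIV. T j i)
      - (\<Sum>j\<in>UNIV. \<Sum>i\<in>UNIV. T j i) + (\<Sum>i\<in>UNIV. P i i) + 2 * (\<Sum>i\<in>UNIV. T i i) =
     (\<Sum>k\<in>UNIV. - (E k * (\<Sum>j\<in>UNIV. D k j)\<^sup>2) - 2 * (\<Sum>j\<in>UNIV. T k j)
        + E k * (\<Sum>j\<in>UNIV. (D k j)\<^sup>2) + 2 * T k k)"
    unfolding sP sP' by (simp add: sum.distrib sum_subtractf sum_negf sum_distrib_left)
  also have "\<dots> = (\<Sum>k\<in>UNIV. E k * (2 * DD k k - 2 * (D k k)\<^sup>2 + 4 * D k k * (\<Sum>j\<in>UNIV. D k j)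
     - (\<Sum>j\<in>UNIV. D k j)\<^sup>2 - (\<Sum>j\<in>UNIV. (D k j)\<^sup>2) - 2 * (\<Sum>j\<in>UNIV. DD k j)))"
    unfolding sT unfolding T_def by (intro sum.cong refl) (simp add: algebra_simps power2_eq_square)
  finally show ?thesis by (simp add: E_def D_def DD_def curvature_term_def)
qed

end

section \<open>The radial profile\<close>

text \<open>The usual function that is flat at \<open>1\<close>, multiplied by a power of \<open>1 / (1 - s)\<close>: the derivative of
\<open>flat k\<close> is a combination of \<open>flat (k + 1)\<close> and \<open>flat (k + 2)\<close>, which gives smoothness by induction.
The exponent \<open>- 4 / (1 - s)\<close> instead of \<open>- 1 / (1 - s)\<close> keeps the derivatives small enough for the
inequalities below.\<close>

definition flat :: "nat \<Rightarrow> real \<Rightarrow> real" where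
  "flat k s = (if s < 1 then (1 / (1 - s)) ^ k * exp (- 4 / (1 - s)) else 0)"

lemma flat_nonneg: "0 \<le> flat k s"
  by (simp add: flat_def)

text \<open>With \<open>r = 1 / (1 - s)\<close> this is \<open>r ^ (k + 1) \<le> C exp (4 r)\<close>.\<close>

lemma flat_le_dist: "\<exists>C. \<forall>s. flat k s \<le> C * \<bar>s - 1\<bar>"
proof (intro exI allI)
  fix s :: real
  let ?n = "Suc k"
  show "flat k s \<le> real ?n ^ ?n * \<bar>s - 1\<bar>"
  proof (cases "s < 1")
    case True
    define r where "r = 1 / (1 - s)"
    have r: "0 < r" "1 - s = 1 / r" using True by (auto simp: r_def)
    have "(r / real ?n) ^ ?n \<le> (1 + r / real ?n) ^ ?n"
      using r(1) by (intro power_mono) auto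
    also have "\<dots> \<le> exp r"
      using r(1) by (intro exp_ge_one_plus_x_over_n_power_n) auto
    also have "\<dots> \<le> exp (4 * r)" using r(1) by simp
    finally have "r ^ ?n \<le> real ?n ^ ?n * exp (4 * r)"
      unfolding power_divide by (simp only: pos_divide_le_eq mult.commute zero_less_power of_nat_0_less_iff zero_less_Suc)
    then have "r ^ k * exp (- (4 * r)) \<le> real ?n ^ ?n / r"
      using r(1) by (simp add: exp_minus field_simps)
    moreover have "flat k s = r ^ k * exp (- (4 * r))"
      using True by (simp add: flat_def r_def)
    moreover have "\<bar>s - 1\<bar> = 1 / r" using r True by simp
    ultimately show ?thesis by simp
  qed (simp add: flat_def)
qed

lemma flat_tendsto: "(flat k \<longlongrightarrow> 0) (at 1)"
proof -
  obtain C where C: "\<And>s. flat k s \<le> C * \<bar>s - 1\<bar>" using flat_le_dist by blast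
  have "((\<lambda>s. C * \<bar>s - 1\<bar>) \<longlongrightarrow> C * \<bar>1 - 1\<bar>) (at (1::real))" by (intro tendsto_intros)
  then have "((\<lambda>s. C * \<bar>s - 1\<bar>) \<longlongrightarrow> 0) (at (1::real))" by simp
  then show ?thesis
    by (rule tendsto_sandwich[OF _ _ tendsto_const, rotated 2]) (auto simp: flat_nonneg C)
qed

lemma flat_derivative:
  "(flat k has_real_derivative (real k * flat (Suc k) s - 4 * flat (Suc (Suc k)) s)) (at s)"
proof (rule linorder_cases[of s 1])
  assume s: "s < 1"
  define r where "r x = 1 / (1 - x)" for x :: real
  have r: "(r has_real_derivative (r s)\<^sup>2) (at s)"
    unfolding r_def using s by (auto intro!: derivative_eq_intros simp: power2_eq_square)
  have "((\<lambda>x. r x ^ k * exp (- 4 * r x)) has_real_derivative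
      (real k * (r s ^ (k - 1) * (r s)\<^sup>2)) * exp (- 4 * r s)
      + r s ^ k * (exp (- 4 * r s) * (- 4 * (r s)\<^sup>2))) (at s)"
    by (auto intro!: derivative_eq_intros r)
  moreover have "flat j s = r s ^ j * exp (- 4 * r s)" for j
    using s by (simp add: flat_def r_def)
  then have "(real k * (r s ^ (k - 1) * (r s)\<^sup>2)) * exp (- 4 * r s)
      + r s ^ k * (exp (- 4 * r s) * (- 4 * (r s)\<^sup>2)) = real k * flat (Suc k) s - 4 * flat (Suc (Suc k)) s"
    by (cases k) (simp_all add: power2_eq_square algebra_simps)
  ultimately have "((\<lambda>x. r x ^ k * exp (- 4 * r x)) has_real_derivative
      (real k * flat (Suc k) s - 4 * flat (Suc (Suc k)) s)) (at s)"
    by (simp only:)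
  then show ?thesis
    by (rule has_field_derivative_transform_within_open[where S = "{..<1}"])
      (use s in \<open>auto simp: r_def flat_def\<close>)
next
  assume s: "s = 1"
  have "((\<lambda>y. (flat k y - flat k 1) / (y - 1)) \<longlongrightarrow> - 0) (at 1)"
  proof (rule Lim_transform_eventually)
    show "((\<lambda>y. - flat (Suc k) y) \<longlongrightarrow> - 0) (at 1)" by (intro tendsto_minus flat_tendsto)
    have "- flat (Suc k) y = (flat k y - flat k 1) / (y - 1)" if "y \<noteq> 1" for y
      using that by (auto simp: flat_def divide_simps algebra_simps)
    then show "\<forall>\<^sub>F y in at 1. - flat (Suc k) y = (flat k y - flat k 1) / (y - 1)"
      by (auto simp: eventually_at_filter)
  qed
  then show ?thesis by (simp add: s has_field_derivative_iff flat_def)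
next
  assume s: "1 < s"
  have "((\<lambda>_. 0::real) has_real_derivative (real k * flat (Suc k) s - 4 * flat (Suc (Suc k)) s)) (at s)"
    using s by (simp add: flat_def)
  then show ?thesis
    by (rule has_field_derivative_transform_within_open[where S = "{1<..}"])
      (use s in \<open>auto simp: flat_def\<close>)
qed

lemma smooth_on_flat: "smooth_on UNIV (flat k)"
  unfolding smooth_on_def
proof
  show "C_k_on m UNIV (flat k)" for m
  proof (induction m arbitrary: k)
    case 0
    show ?case
      by (simp add: continuous_at_imp_continuous_on DERIV_isCont[OF flat_derivative])
  next
    case (Suc m)
    have "C_k_on m UNIV (\<lambda>s. real k * flat (Suc k) s + (- 4) * flat (Suc (Suc k)) s)"
      by (intro C_k_on_add C_k_on_bilinear[OF _ bounded_bilinear_mult] Suc C_k_on_const open_UNIV)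
    then show ?case
      using flat_derivative by (intro C_k_on_SucI_real[OF open_UNIV]) auto
  qed
qed

text \<open>The function \<open>v\<close> with \<open>A = 4 + log v / 2\<close>; the argument is \<open>|p|\<^sup>2\<close>.\<close>

definition profile :: "real \<Rightarrow> real" where
  "profile s = s + flat 0 s"

definition profile' :: "real \<Rightarrow> real" where
  "profile' s = 1 - 4 * flat 2 s"

definition profile'' :: "real \<Rightarrow> real" where
  "profile'' s = 16 * flat 4 s - 8 * flat 3 s"

lemma profile_derivative: "(profile has_real_derivative profile' s) (at s)"
  unfolding profile_def profile'_def
  by (auto intro!: derivative_eq_intros flat_derivative simp: numeral_2_eq_2)

lemma profile'_derivative: "(profile' has_real_derivative profile'' s) (at s)"
  unfolding profile'_def profile''_def
  by (auto intro!: derivative_eq_intros flat_derivative simp: eval_nat_numeral)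

lemma smooth_on_profile: "smooth_on UNIV profile"
  unfolding profile_def
  by (intro smooth_on_add open_UNIV smooth_on_linear bounded_linear_ident smooth_on_flat)

lemma profile_outside: "1 \<le> s \<Longrightarrow> profile s = s" "1 \<le> s \<Longrightarrow> profile' s = 1" "1 \<le> s \<Longrightarrow> profile'' s = 0"
  by (simp_all add: profile_def profile'_def profile''_def flat_def)

text \<open>With \<open>r = 1 / (1 - s)\<close> the first two bounds are \<open>exp (4 r) \<ge> 8 r\<^sup>2\<close> and \<open>exp (4 r) \<ge> 4 r\<close>. The left-hand side of
the equation is \<open>\<eta>\<^sup>2 (log \<eta>)''\<close> for \<open>\<eta> = flat 0\<close>, and \<open>log \<eta> = - 4 r\<close> has second derivative \<open>- 8 r\<^sup>3\<close>.\<close>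

lemma flat_bounds:
  assumes "0 \<le> s"
  shows "flat 2 s \<le> 1 / 8" "flat 1 s \<le> 1 / 4" "0 \<le> profile'' s"
    "flat 0 s * profile'' s - (4 * flat 2 s)\<^sup>2 = - 8 * flat 2 s * flat 1 s"
proof -
  consider "1 \<le> s" | "s < 1" by linarith
  then have "flat 2 s \<le> 1 / 8 \<and> flat 1 s \<le> 1 / 4 \<and> 0 \<le> profile'' s \<and>
    flat 0 s * profile'' s - (4 * flat 2 s)\<^sup>2 = - 8 * flat 2 s * flat 1 s"
  proof cases
    case 2
    define r where "r = 1 / (1 - s)"
    define e where "e = exp (- 4 * r)"
    have r: "1 \<le> r" using assms 2 by (simp add: r_def field_simps)
    have flat: "flat k s = r ^ k * e" for k using 2 by (simp add: flat_def r_def e_def)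
    have e: "0 < e" "e * exp (4 * r) = 1" by (simp_all add: e_def flip: exp_add)
    have "1 + 4 * r + (4 * r)\<^sup>2 / 2 \<le> exp (4 * r)" using r by (intro exp_lower_Taylor_quadratic) auto
    moreover have "(4 * r)\<^sup>2 / 2 = 8 * r\<^sup>2" by (simp add: power_mult_distrib)
    ultimately have "8 * r\<^sup>2 \<le> exp (4 * r)" "4 * r \<le> exp (4 * r)"
      using r zero_le_power2[of r] by linarith+
    then have "e * (8 * r\<^sup>2) \<le> 1" "e * (4 * r) \<le> 1"
      using e by (metis mult_left_mono less_imp_le)+
    moreover have "0 \<le> 8 * r ^ 3 * (2 * r - 1) * e" using r e by auto
    ultimately show ?thesis
      by (simp add: flat profile''_def eval_nat_numeral algebra_simps)
  qed (simp add: flat_def profile''_def)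
  then show "flat 2 s \<le> 1 / 8" "flat 1 s \<le> 1 / 4" "0 \<le> profile'' s"
    "flat 0 s * profile'' s - (4 * flat 2 s)\<^sup>2 = - 8 * flat 2 s * flat 1 s" by blast+
qed

lemma profile'_bounds: "0 \<le> s \<Longrightarrow> 1 / 2 \<le> profile' s" "profile' s \<le> 1"
  using flat_bounds(1)[of s] flat_nonneg[of 2 s] by (simp_all add: profile'_def)

lemma profile_mono:
  assumes "0 \<le> s" "s \<le> t"
  shows "profile s \<le> profile t"
proof (rule DERIV_nonneg_imp_nondecreasing[OF assms(2)])
  show "\<exists>y. (profile has_real_derivative y) (at x) \<and> 0 \<le> y" if "s \<le> x" for x
    using profile_derivative[of x] profile'_bounds(1)[of x] assms(1) that by auto
qed

lemma profile_ge: "0 \<le> s \<Longrightarrow> exp (- 4) \<le> profile s"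
  using profile_mono[of 0 s] by (simp add: profile_def flat_def)

lemma profile_pos: "0 \<le> s \<Longrightarrow> 0 < profile s"
  using profile_ge[of s] exp_gt_zero[of "-4 :: real"] by linarith

lemma profile_ge_self: "s \<le> profile s"
  by (simp add: profile_def flat_nonneg)

lemma profile_le_1: "0 \<le> s \<Longrightarrow> s \<le> 1 \<Longrightarrow> profile s \<le> 1"
  using profile_mono[of s 1] profile_outside(1)[of 1] by simp

text \<open>\<open>gradient_defect\<close> is \<open>E = 1 - v |\<nabla>A|\<^sup>2\<close> and \<open>laplacian\<close> is \<open>q = v \<Delta>A\<close>, for \<open>A = 4 + log v / 2\<close> as a
radial function on the plane with the conformal metric \<open>v\<^sup>-\<^sup>1 |dp|\<^sup>2\<close>.\<close>

definition gradient_defect :: "real \<Rightarrow> real" where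
  "gradient_defect s = 1 - s * (profile' s)\<^sup>2 / profile s"

definition laplacian :: "real \<Rightarrow> real" where
  "laplacian s = 2 * (profile' s + s * profile'' s - s * (profile' s)\<^sup>2 / profile s)"

text \<open>With \<open>\<eta> = flat 0 s\<close> and \<open>d = - \<eta>'\<close>, clearing denominators gives
\<open>v E = \<eta> + s d (2 - d) \<le> \<eta> + 2 s d\<close>, while \<open>v q\<close> is twice
\<open>\<eta> (1 - d) + s d + s\<^sup>2 \<eta>'' + s (\<eta> \<eta>'' - d\<^sup>2)\<close>. Only the last summand is negative; by \<open>flat_bounds\<close> it is
at most \<open>s d / 2\<close> in absolute value, and \<open>d \<le> 1 / 2\<close>, so that \<open>v q \<ge> \<eta> + s d\<close>.\<close>

lemma defect_bounds:
  assumes s: "0 \<le> s"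
  shows "0 \<le> gradient_defect s" "gradient_defect s \<le> 2 * laplacian s" "flat 0 s \<le> profile s * laplacian s"
proof -
  define d where "d = 4 * flat 2 s"
  have d: "0 \<le> d" "d \<le> 1 / 2" using flat_bounds(1)[OF s] flat_nonneg[of 2 s] by (simp_all add: d_def)
  have p': "profile' s = 1 - d" by (simp add: profile'_def d_def)
  have pos: "0 < profile s" by (rule profile_pos[OF s])
  have g: "flat 0 s * profile'' s - d\<^sup>2 = - 2 * d * flat 1 s"
    using flat_bounds(4)[OF s] by (simp add: d_def)
  have E: "profile s * gradient_defect s = flat 0 s + s * d * (2 - d)"
    using pos by (simp add: gradient_defect_def p' field_simps)
      (simp add: profile_def algebra_simps power2_eq_square)
  have "profile s * laplacian s = 2 * (profile s * (1 - d) + s * (profile s * profile'' s) - s * (1 - d)\<^sup>2)"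
    using pos by (simp add: laplacian_def p' field_simps)
  then have "profile s * laplacian s = 2 * (flat 0 s * (1 - d) + s * d + s\<^sup>2 * profile'' s
      + s * (flat 0 s * profile'' s - d\<^sup>2))"
    by (simp add: profile_def algebra_simps power2_eq_square)
  also have "\<dots> = 2 * (flat 0 s * (1 - d) + s * d * (1 - 2 * flat 1 s) + s\<^sup>2 * profile'' s)"
    unfolding g by (simp add: algebra_simps)
  finally have L: "profile s * laplacian s
    = 2 * (flat 0 s * (1 - d) + s * d * (1 - 2 * flat 1 s) + s\<^sup>2 * profile'' s)" .
  have "flat 0 s * (1 / 2) \<le> flat 0 s * (1 - d)" using d flat_nonneg by (intro mult_left_mono) auto
  moreover have "s * d * (1 / 2) \<le> s * d * (1 - 2 * flat 1 s)"
    using d s flat_bounds(2)[OF s] by (intro mult_left_mono) auto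
  moreover have "0 \<le> s\<^sup>2 * profile'' s" using flat_bounds(3)[OF s] by simp
  ultimately have L': "flat 0 s + s * d \<le> profile s * laplacian s" unfolding L by argo
  have sd: "0 \<le> s * d" using s d by simp
  show "flat 0 s \<le> profile s * laplacian s" using L' sd by linarith
  have "0 \<le> profile s * gradient_defect s"
    unfolding E using d s flat_nonneg[of 0 s] by (intro add_nonneg_nonneg mult_nonneg_nonneg) auto
  then show "0 \<le> gradient_defect s" using pos by (simp add: zero_le_mult_iff)
  have "s * d * (2 - d) \<le> s * d * 2" using d sd by (intro mult_left_mono) auto
  then have "profile s * gradient_defect s \<le> profile s * (2 * laplacian s)"
    unfolding E using L' flat_nonneg[of 0 s] by argo
  then show "gradient_defect s \<le> 2 * laplacian s" using pos by simp
qed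

lemma defect_outside: "1 \<le> s \<Longrightarrow> gradient_defect s = 0" "1 \<le> s \<Longrightarrow> laplacian s = 0"
  by (simp_all add: gradient_defect_def laplacian_def profile_outside)

lemma laplacian_nonneg: "0 \<le> s \<Longrightarrow> 0 \<le> laplacian s"
  using defect_bounds(1,2)[of s] by simp

lemma laplacian_zero_pos: "0 < laplacian 0"
proof -
  have "0 < flat 0 0" by (simp add: flat_def)
  also have "\<dots> \<le> profile 0 * laplacian 0" by (rule defect_bounds(3)) simp
  finally show ?thesis using profile_pos[of 0] by (simp add: zero_less_mult_iff)
qed

section \<open>The capped-off metric\<close>

lemma diagonal_expand: "diagonal d = (\<Sum>i\<in>UNIV. d i *\<^sub>R diagonal (\<lambda>j. if j = i then 1 else 0))"
  by (simp add: vec_eq_iff diagonal_nth if_distrib[of "\<lambda>x. _ * x"] cong: if_cong)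

lemma smooth_on_diagonal:
  fixes d :: "'n::finite \<Rightarrow> real^'n \<Rightarrow> real"
  assumes "open S" "\<And>i. smooth_on S (d i)"
  shows "smooth_on S (\<lambda>x. diagonal (\<lambda>i. d i x))"
  by (subst diagonal_expand) (intro smooth_on_sum smooth_on_scaleR smooth_on_const assms)

lemma has_derivative_component: "((\<lambda>w::real^'n. w $ i) has_derivative (\<lambda>h. h $ i)) F"
  by (rule bounded_linear.has_derivative[OF bounded_linear_vec_nth has_derivative_ident])

text \<open>The coordinates \<open>a\<close> and \<open>b\<close> form the plane that contains the new disc, \<open>c\<close> is the angle \<open>\<theta>\<close> in the
half-plane, and the other coordinates are the remaining circles.\<close>

locale cap =
  fixes a b c :: "'n::finite"
  assumes distinct: "a \<noteq> b" "a \<noteq> c" "b \<noteq> c"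
begin

definition rsq :: "real^'n \<Rightarrow> real" where
  "rsq w = (w $ a)\<^sup>2 + (w $ b)\<^sup>2"

text \<open>The function \<open>A\<close>. For \<open>|p| \<ge> 1\<close> it is the distance to \<open>(0, z\<^sub>0)\<close> in the half-plane, and everywhere it
is the radius of the circle with coordinate \<open>\<theta>\<close> in the metric before division by \<open>f\<^sup>2\<close>.\<close>

definition rad :: "real^'n \<Rightarrow> real" where
  "rad w = 4 + ln (profile (rsq w)) / 2"

text \<open>Inside the unit disc \<open>A \<le> 4\<close>, so this value gives \<open>f \<ge> 2 n - 1\<close> there, which exceeds the coefficient
\<open>2 (n - 1)\<close> of the term to be absorbed. It also places the discarded disc of radius \<open>4\<close> inside the
half-plane.\<close>

definition z0 :: real where
  "z0 = 2 * real CARD('n) + 3"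

text \<open>The function \<open>f\<close>, which extends the coordinate \<open>z\<close>.\<close>

definition height :: "real^'n \<Rightarrow> real" where
  "height w = z0 + rad w * cos (w $ c)"

definition W :: "(real^'n) set" where
  "W = {w. 0 < height w}"

definition log_scale :: "'n \<Rightarrow> real^'n \<Rightarrow> real" where
  "log_scale i w = (if i = a \<or> i = b then 4 - rad w else if i = c then ln (rad w) else 0) - ln (height w)"

definition G :: "real^'n \<Rightarrow> real^'n^'n" where
  "G w = diagonal (\<lambda>i. exp (2 * log_scale i w))"

lemma rsq_nonneg [simp]: "0 \<le> rsq w"
  by (simp add: rsq_def)

lemma profile_rsq_pos [simp]: "0 < profile (rsq w)" "profile (rsq w) \<noteq> 0"
  using profile_pos[of "rsq w"] by simp_all

lemma rad_ge: "2 \<le> rad w"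
proof -
  have "ln (exp (- 4)) \<le> ln (profile (rsq w))" using profile_ge[of "rsq w"] by (subst ln_le_cancel_iff) auto
  then show ?thesis by (simp add: rad_def)
qed

lemma rad_pos [simp]: "0 < rad w" "rad w \<noteq> 0"
  using rad_ge[of w] by auto

lemma rad_mono: "rsq w \<le> rsq w' \<Longrightarrow> rad w \<le> rad w'"
  using profile_mono[of "rsq w" "rsq w'"] by (simp add: rad_def)

lemma rad_le_4: "rsq w \<le> 1 \<Longrightarrow> rad w \<le> 4"
  using profile_le_1[of "rsq w"] by (simp add: rad_def)

lemma rad_outside: "1 \<le> rsq w \<Longrightarrow> rad w = 4 + ln (rsq w) / 2"
  by (simp add: rad_def profile_outside)

lemma exp_rad: "exp (2 * (rad w - 4)) = profile (rsq w)"
  by (simp add: rad_def)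

lemma smooth_on_rsq: "smooth_on UNIV rsq"
  unfolding rsq_def by (intro smooth_on_add open_UNIV smooth_on_power smooth_on_component)

lemma smooth_on_rad: "smooth_on UNIV rad"
proof -
  have "smooth_on UNIV (\<lambda>w. profile (rsq w))"
    by (rule smooth_on_compose_real[OF smooth_on_profile open_UNIV open_UNIV smooth_on_rsq UNIV_I])
  then show ?thesis
    unfolding rad_def by (intro smooth_on_add smooth_on_divide smooth_on_ln' open_UNIV smooth_on_const) auto
qed

lemma smooth_on_height: "smooth_on UNIV height"
  unfolding height_def
  by (intro smooth_on_add smooth_on_mult smooth_on_cos' open_UNIV smooth_on_const smooth_on_rad smooth_on_component)

lemma open_W: "open W"
proof -
  have "continuous_on UNIV height" by (rule smooth_on_continuous[OF smooth_on_height])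
  then show ?thesis unfolding W_def by (intro open_Collect_less continuous_on_const)
qed

lemma height_pos: "w \<in> W \<Longrightarrow> 0 < height w"
  by (simp add: W_def)

lemma smooth_on_log_scale: "smooth_on W (log_scale i)"
proof -
  have h: "smooth_on W (\<lambda>w. ln (height w))"
    using height_pos by (intro smooth_on_ln' open_W smooth_on_subset[OF smooth_on_height]) auto
  have r: "smooth_on W rad" by (rule smooth_on_subset[OF smooth_on_rad]) auto
  have lr: "smooth_on W (\<lambda>w. ln (rad w))" by (rule smooth_on_ln'[OF open_W r]) simp
  show ?thesis
    unfolding log_scale_def
    by (cases "i = a \<or> i = b"; cases "i = c")
      (use distinct in \<open>auto intro!: smooth_on_diff smooth_on_minus open_W h r lr\<close>)
qed

sublocale diagonal_metric W log_scale G
  by unfold_locales (simp_all add: open_W smooth_on_log_scale G_def)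

lemma log_scale_exp:
  assumes "w \<in> W"
  shows "exp (2 * log_scale i w) =
    (if i = a \<or> i = b then 1 / profile (rsq w) else if i = c then (rad w)\<^sup>2 else 1) / (height w)\<^sup>2"
proof -
  have e: "exp (2 * ln t) = t\<^sup>2" if "0 < t" for t :: real
    using that by (metis exp_ln exp_double)
  have "exp (2 * (4 - rad w)) = 1 / profile (rsq w)"
    unfolding exp_rad[symmetric] by (simp add: exp_minus[symmetric] inverse_eq_divide[symmetric])
  then show ?thesis
    using height_pos[OF assms]
    by (auto simp: log_scale_def right_diff_distrib exp_diff e)
qed

lemma G_nth:
  assumes "w \<in> W"
  shows "G w = diagonal (\<lambda>i. (if i = a \<or> i = b then 1 / profile (rsq w) else if i = c then (rad w)\<^sup>2 else 1)
      / (height w)\<^sup>2)"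
  unfolding G_def log_scale_exp[OF assms] ..

lemma smooth_on_G: "smooth_on W G"
  unfolding G_def
  by (intro smooth_on_diagonal open_W smooth_on_exp' smooth_on_mult smooth_on_const smooth_on_log_scale)

subsection \<open>Derivatives\<close>

definition slope :: "real \<Rightarrow> real" where
  "slope s = profile' s / profile s"

definition slope' :: "real \<Rightarrow> real" where
  "slope' s = (profile'' s * profile s - (profile' s)\<^sup>2) / (profile s)\<^sup>2"

lemma slope_derivative: "0 \<le> s \<Longrightarrow> (slope has_real_derivative slope' s) (at s)"
  unfolding slope_def slope'_def using profile_pos[of s]
  by (auto intro!: derivative_eq_intros profile_derivative profile'_derivative simp: power2_eq_square)

lemma rsq_has_derivative:
  "(rsq has_derivative (\<lambda>h. 2 * (w $ a * h $ a + w $ b * h $ b))) (at w)"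
  unfolding rsq_def
  by (auto intro!: derivative_eq_intros has_derivative_component simp: algebra_simps)

lemma rad_has_derivative:
  "(rad has_derivative (\<lambda>h. slope (rsq w) * (w $ a * h $ a + w $ b * h $ b))) (at w)"
proof -
  have "((\<lambda>s. 4 + ln (profile s) / 2) has_real_derivative slope (rsq w) / 2) (at (rsq w))"
    unfolding slope_def using profile_rsq_pos[of w]
    by (auto intro!: derivative_eq_intros profile_derivative)
  then have "((\<lambda>s. 4 + ln (profile s) / 2) has_derivative (*) (slope (rsq w) / 2)) (at (rsq w))"
    by (simp only: has_field_derivative_def)
  from has_derivative_compose[OF rsq_has_derivative this] show ?thesis
    unfolding rad_def by (simp add: algebra_simps)
qed

lemma height_has_derivative:
  "(height has_derivative (\<lambda>h. cos (w $ c) * (slope (rsq w) * (w $ a * h $ a + w $ b * h $ b))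
      - rad w * sin (w $ c) * h $ c)) (at w)"
  unfolding height_def
  by (auto intro!: derivative_eq_intros rad_has_derivative has_derivative_component simp: algebra_simps)

lemma partial_rad: "partial k rad w = (if k = a \<or> k = b then slope (rsq w) * w $ k else 0)"
  unfolding partial_eqI[OF rad_has_derivative] using distinct by (auto simp: axis_def)

lemma partial_partial_rad:
  assumes "k = a \<or> k = b"
  shows "partial k (partial k rad) w = slope (rsq w) + 2 * (w $ k)\<^sup>2 * slope' (rsq w)"
proof -
  have eq: "partial k rad = (\<lambda>w. slope (rsq w) * w $ k)" using assms by (auto simp: partial_rad)
  have "(slope has_derivative (\<lambda>t. slope' (rsq w) * t)) (at (rsq w))"
    using slope_derivative[of "rsq w"] by (simp add: has_field_derivative_def)
  from has_derivative_compose[OF rsq_has_derivative this]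
  have "((\<lambda>w. slope (rsq w)) has_derivative (\<lambda>h. slope' (rsq w) * (2 * (w $ a * h $ a + w $ b * h $ b)))) (at w)" .
  then have "((\<lambda>w. slope (rsq w) * w $ k) has_derivative
      (\<lambda>h. slope (rsq w) * h $ k + slope' (rsq w) * (2 * (w $ a * h $ a + w $ b * h $ b)) * w $ k)) (at w)"
    by (intro has_derivative_mult has_derivative_component)
  from partial_eqI[OF this] show ?thesis
    unfolding eq using assms distinct by (auto simp: axis_def power2_eq_square)
qed

text \<open>Apart from \<open>A\<close> itself, the profile enters the curvature only through this quantity and that of the
next lemma.\<close>

lemma gradient_rad:
  "profile (rsq w) * ((partial a rad w)\<^sup>2 + (partial b rad w)\<^sup>2) = 1 - gradient_defect (rsq w)"
proof -
  have "(partial a rad w)\<^sup>2 + (partial b rad w)\<^sup>2 = (slope (rsq w))\<^sup>2 * rsq w"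
    by (simp add: partial_rad rsq_def power_mult_distrib algebra_simps)
  show ?thesis
    unfolding \<open>_ = (slope (rsq w))\<^sup>2 * rsq w\<close>
    using profile_rsq_pos[of w] by (simp add: gradient_defect_def slope_def power2_eq_square field_simps)
qed

lemma laplacian_rad:
  "profile (rsq w) * (partial a (partial a rad) w + partial b (partial b rad) w) = laplacian (rsq w)"
proof -
  have "partial a (partial a rad) w + partial b (partial b rad) w = 2 * (slope (rsq w) + rsq w * slope' (rsq w))"
    by (simp add: partial_partial_rad) (simp add: rsq_def algebra_simps)
  show ?thesis
    unfolding \<open>_ = 2 * (slope (rsq w) + rsq w * slope' (rsq w))\<close>
    using profile_rsq_pos[of w]
    by (simp add: laplacian_def slope_def slope'_def field_simps power2_eq_square)
qed

lemma rad_has_derivative': "(rad has_derivative frechet_derivative rad (at w)) (at w)"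
  by (rule smooth_on_has_derivative[OF smooth_on_rad UNIV_I])

lemma log_scale_has_derivative:
  assumes y: "y \<in> W"
  defines "d \<equiv> frechet_derivative rad (at y)"
  shows "(log_scale j has_derivative
      (\<lambda>t. (if j = a \<or> j = b then - d t else if j = c then d t / rad y else 0)
        - (d t * cos (y $ c) - rad y * sin (y $ c) * t $ c) / height y)) (at y)"
proof -
  note rd = rad_has_derivative'[of y, folded d_def]
  have h: "((\<lambda>y. ln (height y)) has_derivative
      (\<lambda>t. (d t * cos (y $ c) - rad y * sin (y $ c) * t $ c) / height y)) (at y)"
    unfolding height_def using height_pos[OF y, unfolded height_def]
    by (auto intro!: derivative_eq_intros rd has_derivative_component simp: field_simps)
  have lr: "((\<lambda>y. ln (rad y)) has_derivative (\<lambda>t. d t / rad y)) (at y)"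
    by (auto intro!: derivative_eq_intros rd simp: field_simps)
  have r: "((\<lambda>y. 4 - rad y) has_derivative (\<lambda>t. - d t)) (at y)"
    by (auto intro!: derivative_eq_intros rd)
  have "((\<lambda>y. if j = a \<or> j = b then 4 - rad y else if j = c then ln (rad y) else 0) has_derivative
      (\<lambda>t. if j = a \<or> j = b then - d t else if j = c then d t / rad y else 0)) (at y)"
    using r lr by (cases "j = a \<or> j = b"; cases "j = c") auto
  from has_derivative_diff[OF this h] show ?thesis unfolding log_scale_def .
qed

lemma partial_log_scale_ab:
  assumes y: "y \<in> W" and k: "k = a \<or> k = b"
  shows "partial k (log_scale j) y =
    (if j = a \<or> j = b then - partial k rad y else if j = c then partial k rad y / rad y else 0)
    - partial k rad y * cos (y $ c) / height y"
proof -
  have kc: "axis k 1 $ c = (0::real)" using k distinct by (auto simp: axis_def)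
  from partial_eqI[OF log_scale_has_derivative[OF y], of k] show ?thesis by (simp add: kc partial_def)
qed

lemma partial_log_scale_other:
  assumes y: "y \<in> W" and k: "k \<noteq> a" "k \<noteq> b"
  shows "partial k (log_scale j) y = (if k = c then rad y * sin (y $ c) / height y else 0)"
proof -
  have dk: "frechet_derivative rad (at y) (axis k 1) = 0"
    using partial_rad[of k y] k by (simp add: partial_def)
  have "axis k (1::real) $ c = (if k = c then 1 else 0)" by (simp add: axis_def)
  with partial_eqI[OF log_scale_has_derivative[OF y], of k] show ?thesis by (simp add: dk)
qed

lemma partial2_log_scale_ab:
  assumes y: "y \<in> W" and k: "k = a \<or> k = b"
  defines "D \<equiv> partial k rad y" and "B \<equiv> partial k (partial k rad) y"
  shows "partial k (partial k (log_scale j)) y =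
    (if j = a \<or> j = b then - B else if j = c then B / rad y - (D / rad y)\<^sup>2 else 0)
    - (B * cos (y $ c) / height y - (D * cos (y $ c) / height y)\<^sup>2)"
proof -
  have kc: "axis k 1 $ c = (0::real)" using k distinct by (auto simp: axis_def)
  let ?d = "frechet_derivative rad (at y)"
  let ?D = "partial k rad"
  let ?d2 = "frechet_derivative ?D (at y)"
  have D: "(?D has_derivative ?d2) (at y)"
    by (rule smooth_on_has_derivative[OF smooth_on_partial[OF smooth_on_rad] UNIV_I])
  have h: "((\<lambda>y. ?D y * cos (y $ c) / height y) has_derivative
      (\<lambda>t. ((?d2 t * cos (y $ c) - ?D y * sin (y $ c) * t $ c) * height y
        - ?D y * cos (y $ c) * (?d t * cos (y $ c) - rad y * sin (y $ c) * t $ c)) / (height y)\<^sup>2)) (at y)"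
    unfolding height_def using height_pos[OF y, unfolded height_def]
    by (auto intro!: derivative_eq_intros rad_has_derivative' D has_derivative_component
        simp: field_simps power2_eq_square)
  have lr: "((\<lambda>y. ?D y / rad y) has_derivative (\<lambda>t. (?d2 t * rad y - ?D y * ?d t) / (rad y)\<^sup>2)) (at y)"
    by (auto intro!: derivative_eq_intros rad_has_derivative' D simp: field_simps power2_eq_square)
  have r: "((\<lambda>y. - ?D y) has_derivative (\<lambda>t. - ?d2 t)) (at y)"
    by (intro has_derivative_minus D)
  have "((\<lambda>y. if j = a \<or> j = b then - ?D y else if j = c then ?D y / rad y else 0) has_derivative
      (\<lambda>t. if j = a \<or> j = b then - ?d2 t else if j = c then (?d2 t * rad y - ?D y * ?d t) / (rad y)\<^sup>2 else 0)) (at y)"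
    using r lr by (cases "j = a \<or> j = b"; cases "j = c") auto
  note main = has_derivative_diff[OF this h]
  have "partial k (partial k (log_scale j)) y = partial k (\<lambda>y.
    (if j = a \<or> j = b then - ?D y else if j = c then ?D y / rad y else 0) - ?D y * cos (y $ c) / height y) y"
    by (rule partial_cong[OF open_W y]) (simp add: partial_log_scale_ab k)
  also have "\<dots> = (if j = a \<or> j = b then - B else if j = c then (B * rad y - D * D) / (rad y)\<^sup>2 else 0)
    - (B * cos (y $ c) * height y - D * cos (y $ c) * (D * cos (y $ c))) / (height y)\<^sup>2"
    unfolding partial_eqI[OF main] unfolding kc D_def B_def partial_def by simp
  also have "\<dots> = (if j = a \<or> j = b then - B else if j = c then B / rad y - (D / rad y)\<^sup>2 else 0)
    - (B * cos (y $ c) / height y - (D * cos (y $ c) / height y)\<^sup>2)"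
    using height_pos[OF y] by (simp add: field_simps power2_eq_square)
  finally show ?thesis .
qed

lemma partial2_log_scale_other:
  assumes y: "y \<in> W" and k: "k \<noteq> a" "k \<noteq> b"
  shows "partial k (partial k (log_scale j)) y =
    (if k = c then rad y * cos (y $ c) / height y + (rad y * sin (y $ c) / height y)\<^sup>2 else 0)"
proof (cases "k = c")
  case True
  let ?d = "frechet_derivative rad (at y)"
  have dk: "?d (axis c 1) = 0" using partial_rad[of c y] k True by (simp add: partial_def)
  have main: "((\<lambda>y. rad y * sin (y $ c) / height y) has_derivative
      (\<lambda>t. ((?d t * sin (y $ c) + rad y * cos (y $ c) * t $ c) * height y
        - rad y * sin (y $ c) * (?d t * cos (y $ c) - rad y * sin (y $ c) * t $ c)) / (height y)\<^sup>2)) (at y)"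
    unfolding height_def using height_pos[OF y, unfolded height_def]
    by (auto intro!: derivative_eq_intros rad_has_derivative' has_derivative_component
        simp: field_simps power2_eq_square)
  have "partial k (partial k (log_scale j)) y = partial c (\<lambda>y. rad y * sin (y $ c) / height y) y"
    unfolding True by (rule partial_cong[OF open_W y])
      (use k True in \<open>simp add: partial_log_scale_other\<close>)
  also have "\<dots> = (rad y * cos (y $ c) * height y + rad y * sin (y $ c) * (rad y * sin (y $ c))) / (height y)\<^sup>2"
    unfolding partial_eqI[OF main] unfolding dk by (simp add: axis_def)
  finally show ?thesis using height_pos[OF y] True by (simp add: field_simps power2_eq_square)
next
  case False
  have "partial k (partial k (log_scale j)) y = partial k (\<lambda>_. 0) y"
    by (rule partial_cong[OF open_W y]) (use k False in \<open>simp add: partial_log_scale_other\<close>)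
  then show ?thesis using False by (simp add: partial_def)
qed


subsection \<open>Scalar curvature\<close>

lemma sum_three_values:
  fixes X Y Z :: real
  shows "(\<Sum>j\<in>UNIV. if j = a \<or> j = b then X else if j = c then Y else Z)
    = 2 * X + Y + (real CARD('n) - 3) * Z"
proof -
  have "(if j = a \<or> j = b then X else if j = c then Y else Z)
      = Z + (if j = a then X - Z else 0) + (if j = b then X - Z else 0) + (if j = c then Y - Z else 0)" for j
    using distinct by auto
  then have "(\<Sum>j\<in>UNIV. if j = a \<or> j = b then X else if j = c then Y else Z)
      = (\<Sum>j\<in>(UNIV::'n set). Z + (if j = a then X - Z else 0) + (if j = b then X - Z else 0) + (if j = c then Y - Z else 0))"
    by simp
  also have "\<dots> = 2 * X + Y + (real CARD('n) - 3) * Z"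
    by (simp add: sum.distrib algebra_simps)
  finally show ?thesis .
qed

lemma sum_only_abc:
  fixes F :: "'n \<Rightarrow> real"
  assumes "\<And>k. k \<noteq> a \<Longrightarrow> k \<noteq> b \<Longrightarrow> k \<noteq> c \<Longrightarrow> F k = 0"
  shows "(\<Sum>k\<in>UNIV. F k) = F a + F b + F c"
proof -
  have "(\<Sum>k\<in>UNIV. F k) = (\<Sum>k\<in>{a, b, c}. F k)"
    by (rule sum.mono_neutral_right) (use assms in auto)
  then show ?thesis using distinct by simp
qed

text \<open>All \<open>\<psi>\<^sub>j\<close> have the same derivatives in direction \<open>k\<close> except for those of the disc and of the angle
\<open>\<theta>\<close>, so the sums over \<open>j\<close> have the form of \<open>sum_three_values\<close>. Squares of \<open>D\<close> without a factor \<open>h\<close>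
cancel because the metric of the disc is conformal to the flat one. As its logarithmic factor is
\<open>4 - A\<close>, the curvature of the disc and the second derivative of the circle radius \<open>A\<close> combine to
\<open>2 B (1 - 1 / A)\<close>.\<close>

lemma curvature_term_ab:
  assumes x: "x \<in> W" and k: "k = a \<or> k = b"
  defines "D \<equiv> partial k rad x" and "B \<equiv> partial k (partial k rad) x"
    and "h \<equiv> cos (x $ c) / height x" and "n \<equiv> real CARD('n)"
  shows "curvature_term k x
    = 2 * B * (1 - 1 / rad x) + 2 * (n - 1) * h * (B + D\<^sup>2 / rad x) - n * (n - 1) * D\<^sup>2 * h\<^sup>2"
proof -
  define \<alpha> where "\<alpha> = 1 / rad x"
  have d: "d\<psi> k j x = (if j = a \<or> j = b then - D - D * h else if j = c then D * \<alpha> - D * h else - D * h)" for j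
    unfolding partial_log_scale_ab[OF x k] D_def h_def \<alpha>_def by simp
  have d2: "(d\<psi> k j x)\<^sup>2 = (if j = a \<or> j = b then (- D - D * h)\<^sup>2 else if j = c then (D * \<alpha> - D * h)\<^sup>2 else (D * h)\<^sup>2)" for j
    unfolding d by simp
  have dd: "partial k (d\<psi> k j) x = (if j = a \<or> j = b then - B - (B * h - (D * h)\<^sup>2)
      else if j = c then B * \<alpha> - (D * \<alpha>)\<^sup>2 - (B * h - (D * h)\<^sup>2) else - (B * h - (D * h)\<^sup>2))" for j
    unfolding partial2_log_scale_ab[OF x k] D_def B_def h_def \<alpha>_def by simp
  have kk: "d\<psi> k k x = - D - D * h" "partial k (d\<psi> k k) x = - B - (B * h - (D * h)\<^sup>2)"
    using k by (auto simp: d dd)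
  have frac: "1 / rad x = \<alpha>" "D\<^sup>2 / rad x = D\<^sup>2 * \<alpha>" by (simp_all add: \<alpha>_def)
  show ?thesis
    unfolding curvature_term_def kk d2 unfolding d dd unfolding sum_three_values frac n_def[symmetric] by algebra
qed

lemma curvature_term_c:
  assumes x: "x \<in> W"
  defines "n \<equiv> real CARD('n)"
  shows "curvature_term c x
    = - 2 * (n - 1) * (rad x * cos (x $ c) / height x) - n * (n - 1) * (rad x * sin (x $ c) / height x)\<^sup>2"
proof -
  define e where "e = rad x * sin (x $ c) / height x"
  define g where "g = rad x * cos (x $ c) / height x"
  have d: "d\<psi> c j x = e" for j
    using distinct by (simp add: partial_log_scale_other[OF x] e_def)
  have dd: "partial c (d\<psi> c j) x = g + e\<^sup>2" for j
    using distinct by (simp add: partial2_log_scale_other[OF x] e_def g_def)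
  show ?thesis
    unfolding curvature_term_def d dd by (simp add: n_def flip: e_def g_def) algebra
qed

lemma curvature_term_other:
  assumes x: "x \<in> W" and "k \<noteq> a" "k \<noteq> b" "k \<noteq> c"
  shows "curvature_term k x = 0"
  using assms by (simp add: curvature_term_def partial_log_scale_other partial2_log_scale_other)

lemma scalar_curvature_cap:
  assumes x: "x \<in> W"
  defines "n \<equiv> real CARD('n)" and "C \<equiv> cos (x $ c)" and "q \<equiv> laplacian (rsq x)" and "E \<equiv> gradient_defect (rsq x)"
  shows "scalar_curvature G x + n * (n - 1) = 2 * (height x)\<^sup>2 * q * (1 - 1 / rad x)
    + 2 * (n - 1) * height x * C * (q - E / rad x) + n * (n - 1) * E * C\<^sup>2"
proof -
  define v where "v = profile (rsq x)"
  define H where "H = height x"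
  define A where "A = rad x"
  have H: "H \<noteq> 0" and A: "A \<noteq> 0" using height_pos[OF x] by (simp_all add: H_def A_def)
  have ex: "exp (- 2 * log_scale k x) = (if k = a \<or> k = b then v * H\<^sup>2 else if k = c then H\<^sup>2 / A\<^sup>2 else H\<^sup>2)" for k
    using log_scale_exp[OF x, of k] by (simp add: exp_minus v_def H_def A_def)
  define P where "P k = 2 * partial k (partial k rad) x * (1 - 1 / A)
      + 2 * (n - 1) * (C / H) * (partial k (partial k rad) x + (partial k rad x)\<^sup>2 / A)
      - n * (n - 1) * (partial k rad x)\<^sup>2 * (C / H)\<^sup>2" for k
  define R where "R = - 2 * (n - 1) * (A * C / H) - n * (n - 1) * (A * sin (x $ c) / H)\<^sup>2"
  have "scalar_curvature G x = v * H\<^sup>2 * P a + v * H\<^sup>2 * P b + H\<^sup>2 / A\<^sup>2 * R"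
  proof -
    define F where "F k = exp (- 2 * log_scale k x) * curvature_term k x" for k
    have "scalar_curvature G x = F a + F b + F c"
      unfolding scalar_curvature_eq[OF x] F_def[symmetric]
      by (rule sum_only_abc) (simp add: F_def curvature_term_other[OF x])
    moreover have "F k = v * H\<^sup>2 * P k" if "k = a \<or> k = b" for k
      unfolding F_def curvature_term_ab[OF x that] ex P_def using that by (simp add: n_def C_def H_def A_def)
    moreover have "F c = H\<^sup>2 / A\<^sup>2 * R"
      unfolding F_def curvature_term_c[OF x] ex R_def using distinct by (simp add: n_def C_def H_def A_def)
    ultimately show ?thesis by simp
  qed
  moreover have "v * H\<^sup>2 * P a + v * H\<^sup>2 * P b = 2 * H\<^sup>2 * q * (1 - 1 / A)
      + 2 * (n - 1) * H * C * (q + (1 - E) / A) - n * (n - 1) * (1 - E) * C\<^sup>2"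
  proof -
    define B where "B = partial a (partial a rad) x + partial b (partial b rad) x"
    define D2 where "D2 = (partial a rad x)\<^sup>2 + (partial b rad x)\<^sup>2"
    have vB: "v * B = q" and vD2: "v * D2 = 1 - E"
      by (simp_all add: v_def B_def D2_def q_def E_def laplacian_rad gradient_rad)
    have "P a + P b = 2 * B * (1 - 1 / A) + 2 * (n - 1) * (C / H) * (B + D2 / A)
        - n * (n - 1) * D2 * (C / H)\<^sup>2"
      by (simp add: P_def B_def D2_def algebra_simps add_divide_distrib)
    then have sum: "v * H\<^sup>2 * P a + v * H\<^sup>2 * P b = 2 * H\<^sup>2 * (v * B) * (1 - 1 / A)
        + 2 * (n - 1) * (H\<^sup>2 * (C / H)) * (v * B + (v * D2) / A) - n * (n - 1) * (v * D2) * (H\<^sup>2 * (C / H)\<^sup>2)"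
      by (simp flip: distrib_left) (simp add: algebra_simps)
    have H2: "H\<^sup>2 * (C / H) = H * C" "H\<^sup>2 * (C / H)\<^sup>2 = C\<^sup>2"
      using H by (simp_all add: power2_eq_square)
    show ?thesis using sum unfolding vB vD2 H2 by (simp add: mult.assoc)
  qed
  moreover have "H\<^sup>2 / A\<^sup>2 * R = - 2 * (n - 1) * H * C / A - n * (n - 1) * (1 - C\<^sup>2)"
  proof -
    have "(sin (x $ c))\<^sup>2 = 1 - C\<^sup>2" by (simp add: C_def sin_squared_eq)
    moreover have "H\<^sup>2 / A\<^sup>2 * R = - 2 * (n - 1) * H * C / A - n * (n - 1) * (sin (x $ c))\<^sup>2"
      using H A unfolding R_def by (simp add: power2_eq_square field_simps)
    ultimately show ?thesis by simp
  qed
  ultimately have "scalar_curvature G x = 2 * H\<^sup>2 * q * (1 - 1 / A)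
      + 2 * (n - 1) * H * C * (q + (1 - E) / A) - n * (n - 1) * (1 - E) * C\<^sup>2
      + (- 2 * (n - 1) * H * C / A - n * (n - 1) * (1 - C\<^sup>2))" by (simp only:)
  then show ?thesis
    unfolding H_def[symmetric] A_def[symmetric] divide_inverse by algebra
qed

text \<open>Where \<open>s \<ge> 1\<close>, the right-hand side of \<open>scalar_curvature_cap\<close> vanishes. Elsewhere \<open>|q - E / A| \<le> q\<close> and
\<open>1 - 1 / A \<ge> 1 / 2\<close>, which leaves at least \<open>f q (f - 2 (n - 1)) \<ge> f q\<close>.\<close>

lemma scalar_curvature_bounds:
  assumes x: "x \<in> W"
  shows "- (real CARD('n) * (real CARD('n) - 1)) \<le> scalar_curvature G x"
    and "rsq x = 0 \<Longrightarrow> - (real CARD('n) * (real CARD('n) - 1)) < scalar_curvature G x"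
proof -
  define n where "n = real CARD('n)"
  define C where "C = cos (x $ c)"
  define q where "q = laplacian (rsq x)"
  define E where "E = gradient_defect (rsq x)"
  define X where "X = 2 * (height x)\<^sup>2 * q * (1 - 1 / rad x)
    + 2 * (n - 1) * height x * C * (q - E / rad x) + n * (n - 1) * E * C\<^sup>2"
  have X: "scalar_curvature G x + n * (n - 1) = X"
    unfolding X_def n_def C_def q_def E_def by (rule scalar_curvature_cap[OF x])
  have n: "1 \<le> n" by (simp add: n_def Suc_le_eq)
  have E: "0 \<le> E" "E \<le> 2 * q" and q: "0 \<le> q"
    using defect_bounds[of "rsq x"] laplacian_nonneg[of "rsq x"] by (simp_all add: E_def q_def)
  have C: "\<bar>C\<bar> \<le> 1" by (simp add: C_def)
  have main: "height x * q \<le> X" if s: "rsq x < 1"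
  proof -
    have A: "2 \<le> rad x" "rad x \<le> 4" using rad_ge rad_le_4 s by auto
    have "\<bar>rad x * C\<bar> \<le> 4 * 1" unfolding abs_mult using A C by (intro mult_mono) auto
    then have h: "2 * n - 1 \<le> height x" by (simp add: height_def z0_def n_def C_def abs_le_iff)
    have "E / rad x \<le> E / 2" using A E by (intro divide_left_mono) auto
    moreover have "0 \<le> E / rad x" using A E by simp
    ultimately have "\<bar>q - E / rad x\<bar> \<le> q" using E by auto
    then have "\<bar>C * (q - E / rad x)\<bar> \<le> 1 * q" unfolding abs_mult using C q by (intro mult_mono) auto
    then have "- q \<le> C * (q - E / rad x)" by linarith
    then have "2 * (n - 1) * height x * (- q) \<le> 2 * (n - 1) * height x * (C * (q - E / rad x))"
      using n h by (intro mult_left_mono) auto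
    moreover have "2 * (height x)\<^sup>2 * q * (1 / 2) \<le> 2 * (height x)\<^sup>2 * q * (1 - 1 / rad x)"
      using A q by (intro mult_left_mono) (auto simp: field_simps)
    moreover have "0 \<le> n * (n - 1) * E * C\<^sup>2" using n E by auto
    ultimately have "(height x)\<^sup>2 * q - 2 * (n - 1) * height x * q \<le> X" unfolding X_def by (simp add: mult.assoc)
    moreover have "height x * q * 1 \<le> height x * q * (height x - 2 * (n - 1))"
      using h n q by (intro mult_left_mono) auto
    ultimately show ?thesis by (simp add: power2_eq_square algebra_simps)
  qed
  have "0 \<le> X"
  proof (cases "rsq x < 1")
    case True
    have "0 \<le> height x * q" using q height_pos[OF x] by simp
    then show ?thesis using main[OF True] by linarith
  next
    case False
    then show ?thesis by (simp add: X_def q_def E_def defect_outside)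
  qed
  then show "- (real CARD('n) * (real CARD('n) - 1)) \<le> scalar_curvature G x"
    using X by (simp add: n_def)
  show "- (real CARD('n) * (real CARD('n) - 1)) < scalar_curvature G x" if "rsq x = 0"
  proof -
    have "0 < height x * q" using height_pos[OF x] laplacian_zero_pos that by (simp add: q_def)
    then show ?thesis using main that X by (simp add: n_def)
  qed
qed

end

section \<open>Global properties of the capped-off manifold\<close>

context cap
begin

lemma period_simps:
  assumes "t \<in> periods a b"
  shows "(w + t) $ a = w $ a" "(w + t) $ b = w $ b"
    "cos ((w + t) $ i) = cos (w $ i)" "sin ((w + t) $ i) = sin (w $ i)"
proof -
  show "(w + t) $ a = w $ a" "(w + t) $ b = w $ b" using assms by (auto simp: periods_def)
  obtain k :: int where "t $ i = 2 * pi * of_int k" using assms by (auto simp: periods_def)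
  then show "cos ((w + t) $ i) = cos (w $ i)" "sin ((w + t) $ i) = sin (w $ i)"
    by (simp_all add: cos_add sin_add)
qed

lemma periodic:
  assumes "t \<in> periods a b"
  shows "rsq (w + t) = rsq w" "rad (w + t) = rad w" "height (w + t) = height w"
    "G (w + t) = G w"
  unfolding G_def log_scale_def height_def rad_def rsq_def period_simps[OF assms] by (rule refl)+

lemma in_W_if_rsq_le:
  assumes "rsq w \<le> 1"
  shows "w \<in> W"
proof -
  have "rad w \<le> 4" using assms by (rule rad_le_4)
  moreover have "rad w * - 1 \<le> rad w * cos (w $ c)" by (intro mult_left_mono) (auto simp: less_imp_le)
  ultimately have "- 4 \<le> rad w * cos (w $ c)" by linarith
  moreover have "1 \<le> real CARD('n)" by (simp add: Suc_le_eq)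
  ultimately show ?thesis unfolding W_def height_def z0_def mem_Collect_eq by linarith
qed

text \<open>Shrinking \<open>p\<close> to \<open>0\<close> keeps \<open>f\<close> positive, because \<open>A\<close> decreases and only angles with \<open>cos \<theta> < 0\<close> are
critical. The part of the domain over \<open>p = 0\<close> is an affine subspace.\<close>

lemma connected_W: "connected W"
proof -
  define core where "core = {w :: real^'n. w $ a = 0 \<and> w $ b = 0}"
  define base where "base w = (\<chi> i. if i = a \<or> i = b then 0 else w $ i)" for w :: "real^'n"
  have core: "core \<subseteq> W"
    by (auto intro!: in_W_if_rsq_le simp: core_def rsq_def)
  have "connected core"
    unfolding core_def by (intro convex_connected convexI) (simp add: vec_eq_iff)
  have base: "base w \<in> core" for w using distinct by (simp add: base_def core_def)
  have seg: "closed_segment w (base w) \<subseteq> W" if w: "w \<in> W" for w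
  proof
    fix y assume "y \<in> closed_segment w (base w)"
    then obtain t where t: "0 \<le> t" "t \<le> 1" "y = (1 - t) *\<^sub>R w + t *\<^sub>R base w"
      by (auto simp: closed_segment_def)
    have y: "y $ a = (1 - t) * w $ a" "y $ b = (1 - t) * w $ b" "y $ c = w $ c"
      using distinct by (simp_all add: t(3) base_def algebra_simps)
    have "rsq y = (1 - t)\<^sup>2 * rsq w" by (simp add: rsq_def y power_mult_distrib distrib_left)
    also have "\<dots> \<le> 1 * rsq w" using t by (intro mult_right_mono) (auto simp: power_le_one)
    finally have r: "rad y \<le> rad w" by (intro rad_mono) simp
    show "y \<in> W"
    proof (cases "0 \<le> cos (w $ c)")
      case True
      then have "0 \<le> rad y * cos (w $ c)" by (intro mult_nonneg_nonneg) (auto simp: less_imp_le)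
      then show ?thesis by (simp add: W_def height_def y z0_def)
    next
      case False
      then have "rad w * cos (w $ c) \<le> rad y * cos (w $ c)" using r by (intro mult_right_mono_neg) auto
      then show ?thesis using w by (simp add: W_def height_def y)
    qed
  qed
  have "W = (\<Union>w\<in>W. closed_segment w (base w) \<union> core)"
    using core seg by auto
  also have "connected \<dots>"
  proof (rule connected_Union)
    show "connected T" if "T \<in> (\<lambda>w. closed_segment w (base w) \<union> core) ` W" for T
      using that \<open>connected core\<close> base by (auto intro!: connected_Un)
    have "0 \<in> \<Inter> ((\<lambda>w. closed_segment w (base w) \<union> core) ` W)" by (auto simp: core_def)
    then show "\<Inter> ((\<lambda>w. closed_segment w (base w) \<union> core) ` W) \<noteq> {}" by blast
  qed
  finally show ?thesis .
qed

lemma quadratic_G: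
  assumes "w \<in> W"
  shows "(height w)\<^sup>2 * (v \<bullet> (G w *v v)) =
    (\<Sum>i\<in>UNIV. (if i = a \<or> i = b then 1 / profile (rsq w) else if i = c then (rad w)\<^sup>2 else 1) * (v $ i)\<^sup>2)"
  using height_pos[OF assms]
  by (simp add: G_nth[OF assms] diagonal_quadratic sum_distrib_left power2_eq_square)

sublocale riemannian_domain a b W G
proof unfold_locales
  show "x + t \<in> W" if "x \<in> W" "t \<in> periods a b" for x t using that by (simp add: W_def periodic)
  show "0 < v \<bullet> (G x *v v)" if v: "v \<noteq> 0" for x v
  proof -
    have "0 \<le> exp (2 * log_scale i x) * (v $ i)\<^sup>2" for i by simp
    moreover obtain i where "v $ i \<noteq> 0" using v by (auto simp: vec_eq_iff)
    then have "0 < exp (2 * log_scale i x) * (v $ i)\<^sup>2" by simp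
    ultimately have "0 < (\<Sum>i\<in>UNIV. exp (2 * log_scale i x) * (v $ i)\<^sup>2)" by (intro sum_pos2) auto
    then show ?thesis by (simp add: G_def diagonal_quadratic power2_eq_square)
  qed
  show "transpose (G x) = G x" for x by (simp add: G_def transpose_diagonal)
qed (simp_all add: open_W smooth_on_G periodic connected_W)

text \<open>The left-hand side is \<open>|dA(v)|\<^sup>2 + (A d\<theta>(v))\<^sup>2\<close>; the estimate for \<open>dA\<close> is \<open>E \<ge> 0\<close>.\<close>

lemma quadratic_G_ge:
  assumes w: "w \<in> W"
  defines "P v \<equiv> slope (rsq w) * (w $ a * v $ a + w $ b * v $ b)"
  shows "(P v)\<^sup>2 + (rad w * v $ c)\<^sup>2 \<le> (height w)\<^sup>2 * (v \<bullet> (G w *v v))"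
proof -
  have "(w $ a * v $ a + w $ b * v $ b)\<^sup>2 \<le> rsq w * ((v $ a)\<^sup>2 + (v $ b)\<^sup>2)"
  proof -
    have "rsq w * ((v $ a)\<^sup>2 + (v $ b)\<^sup>2) - (w $ a * v $ a + w $ b * v $ b)\<^sup>2
        = (w $ a * v $ b - w $ b * v $ a)\<^sup>2" by (simp add: rsq_def) algebra
    then show ?thesis by (metis diff_ge_0_iff_ge zero_le_power2)
  qed
  then have "(P v)\<^sup>2 \<le> (slope (rsq w))\<^sup>2 * (rsq w * ((v $ a)\<^sup>2 + (v $ b)\<^sup>2))"
    unfolding P_def power_mult_distrib by (intro mult_left_mono) auto
  also have "\<dots> = ((slope (rsq w))\<^sup>2 * rsq w) * ((v $ a)\<^sup>2 + (v $ b)\<^sup>2)" by simp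
  also have "\<dots> \<le> 1 / profile (rsq w) * ((v $ a)\<^sup>2 + (v $ b)\<^sup>2)"
  proof (rule mult_right_mono)
    have "(slope (rsq w))\<^sup>2 * rsq w = (1 - gradient_defect (rsq w)) / profile (rsq w)"
      by (simp add: slope_def gradient_defect_def field_simps power2_eq_square)
    also have "\<dots> \<le> 1 / profile (rsq w)"
      using defect_bounds(1)[of "rsq w"] by (intro divide_right_mono) (auto simp: less_imp_le)
    finally show "(slope (rsq w))\<^sup>2 * rsq w \<le> 1 / profile (rsq w)" .
  qed simp
  finally have "(P v)\<^sup>2 + (rad w * v $ c)\<^sup>2 \<le>
      1 / profile (rsq w) * ((v $ a)\<^sup>2 + (v $ b)\<^sup>2) + (rad w)\<^sup>2 * (v $ c)\<^sup>2"
    by (simp add: power_mult_distrib)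
  also have "\<dots> = (\<Sum>i\<in>{a, b, c}. (if i = a \<or> i = b then 1 / profile (rsq w) else if i = c then (rad w)\<^sup>2 else 1) * (v $ i)\<^sup>2)"
    using distinct by (simp add: distrib_left)
  also have "\<dots> \<le> (height w)\<^sup>2 * (v \<bullet> (G w *v v))"
    unfolding quadratic_G[OF w] by (rule sum_mono2) (auto simp: less_imp_le)
  finally show ?thesis .
qed

lemma rotation_le: "\<bar>cos \<theta> * p - sin \<theta> * q\<bar> \<le> sqrt (p\<^sup>2 + q\<^sup>2)"
proof -
  have "(cos \<theta> * p - sin \<theta> * q)\<^sup>2 + (sin \<theta> * p + cos \<theta> * q)\<^sup>2
      = ((sin \<theta>)\<^sup>2 + (cos \<theta>)\<^sup>2) * (p\<^sup>2 + q\<^sup>2)" by algebra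
  then have "p\<^sup>2 + q\<^sup>2 - (cos \<theta> * p - sin \<theta> * q)\<^sup>2 = (sin \<theta> * p + cos \<theta> * q)\<^sup>2"
    by simp
  then have "(cos \<theta> * p - sin \<theta> * q)\<^sup>2 \<le> p\<^sup>2 + q\<^sup>2" by (metis diff_ge_0_iff_ge zero_le_power2)
  then show ?thesis by (metis real_sqrt_abs real_sqrt_le_iff)
qed

text \<open>The derivative of \<open>f\<close> is \<open>cos \<theta> dA - sin \<theta> A d\<theta>\<close>, a unit combination of the two forms of
\<open>quadratic_G_ge\<close>, so its norm for the metric before division by \<open>f\<^sup>2\<close> is at most \<open>1\<close>. Dividing by \<open>f\<close>
compensates the conformal factor exactly. For the second function, \<open>f \<le> f + A\<close> is used as well.\<close>

lemma gradient_bounds: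
  "gradient_bound (\<lambda>w. ln (height w)) 1" "gradient_bound (\<lambda>w. ln (height w + rad w)) 2"
proof -
  have *: "\<exists>h'. ((\<lambda>w. ln (height w)) has_derivative h') (at x) \<and> (\<forall>v. \<bar>h' v\<bar> \<le> 1 * sqrt (v \<bullet> (G x *v v)))"
    "\<exists>h'. ((\<lambda>w. ln (height w + rad w)) has_derivative h') (at x) \<and> (\<forall>v. \<bar>h' v\<bar> \<le> 2 * sqrt (v \<bullet> (G x *v v)))"
    if x: "x \<in> W" for x
  proof -
    define P where "P v = slope (rsq x) * (x $ a * v $ a + x $ b * v $ b)" for v
    define Q where "Q v = rad x * v $ c" for v
    define N where "N v = sqrt (v \<bullet> (G x *v v))" for v
    have hp: "0 < height x" by (rule height_pos[OF x])
    have PQ: "sqrt ((P v)\<^sup>2 + (Q v)\<^sup>2) \<le> height x * N v" for v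
    proof -
      have "sqrt ((P v)\<^sup>2 + (Q v)\<^sup>2) \<le> sqrt ((height x)\<^sup>2 * (v \<bullet> (G x *v v)))"
        unfolding P_def Q_def by (intro real_sqrt_le_mono quadratic_G_ge x)
      then show ?thesis using hp by (simp add: N_def real_sqrt_mult)
    qed
    have h: "(height has_derivative (\<lambda>v. cos (x $ c) * P v - sin (x $ c) * Q v)) (at x)"
      using height_has_derivative[of x] by (simp add: P_def Q_def mult_ac)
    have r: "(rad has_derivative P) (at x)"
      using rad_has_derivative[of x] by (simp add: P_def[abs_def])
    have le1: "\<bar>cos (x $ c) * P v - sin (x $ c) * Q v\<bar> \<le> height x * N v" for v
      using rotation_le PQ order_trans by blast
    have "\<bar>P v\<bar> \<le> sqrt ((P v)\<^sup>2 + (Q v)\<^sup>2)" for v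
      by (rule real_le_rsqrt) simp
    then have le2: "\<bar>P v\<bar> \<le> height x * N v" for v using PQ order_trans by blast
    have "((\<lambda>w. ln (height w)) has_derivative (\<lambda>v. (cos (x $ c) * P v - sin (x $ c) * Q v) / height x)) (at x)"
      using hp by (auto intro!: derivative_eq_intros h simp: field_simps)
    moreover have "\<bar>(cos (x $ c) * P v - sin (x $ c) * Q v) / height x\<bar> \<le> 1 * N v" for v
      using le1[of v] hp by (simp add: divide_le_eq mult.commute)
    ultimately show "\<exists>h'. ((\<lambda>w. ln (height w)) has_derivative h') (at x) \<and>
        (\<forall>v. \<bar>h' v\<bar> \<le> 1 * sqrt (v \<bullet> (G x *v v)))"
      unfolding N_def by blast
    have sum_pos: "0 < height x + rad x" by (intro add_pos_pos hp rad_pos)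
    have "((\<lambda>w. ln (height w + rad w)) has_derivative
        (\<lambda>v. (cos (x $ c) * P v - sin (x $ c) * Q v + P v) / (height x + rad x))) (at x)"
      using sum_pos by (auto intro!: derivative_eq_intros h r simp: field_simps)
    moreover have "\<bar>(cos (x $ c) * P v - sin (x $ c) * Q v + P v) / (height x + rad x)\<bar> \<le> 2 * N v" for v
    proof -
      have "\<bar>cos (x $ c) * P v - sin (x $ c) * Q v + P v\<bar> \<le> 2 * (height x * N v)"
        using le1[of v] le2[of v] abs_triangle_ineq[of "cos (x $ c) * P v - sin (x $ c) * Q v" "P v"]
        by linarith
      also have "\<dots> = 2 * N v * height x" by simp
      also have "\<dots> \<le> 2 * N v * (height x + rad x)"
        by (intro mult_left_mono) (auto simp: N_def less_imp_le intro: metric_nonneg[OF x])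
      finally show ?thesis using sum_pos by (simp add: divide_le_eq)
    qed
    ultimately show "\<exists>h'. ((\<lambda>w. ln (height w + rad w)) has_derivative h') (at x) \<and>
        (\<forall>v. \<bar>h' v\<bar> \<le> 2 * sqrt (v \<bullet> (G x *v v)))"
      unfolding N_def by blast
  qed
  then show "gradient_bound (\<lambda>w. ln (height w)) 1" "gradient_bound (\<lambda>w. ln (height w + rad w)) 2"
    unfolding gradient_bound_def by blast+
qed

lemma continuous_on_rad: "continuous_on S rad" and continuous_on_height: "continuous_on S height"
  and continuous_on_rsq: "continuous_on S rsq"
  using smooth_on_continuous[OF smooth_on_rad] smooth_on_continuous[OF smooth_on_height]
    smooth_on_continuous[OF smooth_on_rsq] continuous_on_subset by blast+

lemma compact_box:
  assumes "closed {w. T w}" and "\<And>w. T w \<Longrightarrow> \<bar>w $ a\<bar> \<le> B \<and> \<bar>w $ b\<bar> \<le> B"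
  shows "compact {w :: real^'n. T w \<and> w \<in> period_box a b}"
proof (rule compact_eq_bounded_closed[THEN iffD2], intro conjI)
  have "closed {w :: real^'n. i \<noteq> a \<longrightarrow> i \<noteq> b \<longrightarrow> w $ i \<in> {0..2 * pi}}" for i
    by (cases "i = a \<or> i = b")
      (auto intro!: closed_Collect_conj closed_Collect_le continuous_intros)
  then have "closed {w :: real^'n. w \<in> period_box a b}"
    unfolding period_box_def mem_Collect_eq by (intro closed_Collect_all)
  with assms(1) show "closed {w :: real^'n. T w \<and> w \<in> period_box a b}"
    by (intro closed_Collect_conj)
  have "\<bar>w $ i\<bar> \<le> max B (2 * pi)" if "T w" "w \<in> period_box a b" for w i
    using assms(2)[OF that(1)] that(2) by (cases "i = a \<or> i = b") (auto simp: period_box_def)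
  then show "bounded {w :: real^'n. T w \<and> w \<in> period_box a b}"
    by (intro bounded_subset[OF bounded_cbox[of "\<chi> i. - max B (2 * pi)" "\<chi> i. max B (2 * pi)"]])
      (auto simp: mem_box_cart abs_le_iff minus_le_iff)
qed

lemma component_le_if_rsq_le:
  assumes "rsq w \<le> B\<^sup>2" "0 \<le> B"
  shows "\<bar>w $ a\<bar> \<le> B \<and> \<bar>w $ b\<bar> \<le> B"
proof -
  have "(w $ a)\<^sup>2 \<le> B\<^sup>2" "(w $ b)\<^sup>2 \<le> B\<^sup>2"
    using assms(1) zero_le_power2[of "w $ a"] zero_le_power2[of "w $ b"] unfolding rsq_def by linarith+
  then show ?thesis using assms(2) by (simp add: abs_le_square_iff[symmetric])
qed

text \<open>Bounds on \<open>log f\<close> keep \<open>f\<close> away from \<open>0\<close>, and a bound on \<open>log (f + A)\<close> bounds \<open>A\<close> and hence \<open>|p|\<close>, as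
\<open>|p|\<^sup>2 \<le> v = exp (2 (A - 4))\<close>.\<close>

lemma complete_cap: "complete_riem M"
proof (rule complete_if_proper[where F = "{\<lambda>w. ln (height w), \<lambda>w. ln (height w + rad w)}"])
  fix h assume "h \<in> {\<lambda>w. ln (height w), \<lambda>w. ln (height w + rad w)}"
  then show "\<exists>\<kappa>>0. gradient_bound h \<kappa>"
    using gradient_bounds by (auto intro: exI[of _ 1] exI[of _ 2])
next
  fix h x t assume "h \<in> {\<lambda>w. ln (height w), \<lambda>w. ln (height w + rad w)}" "t \<in> periods a b"
  then show "h (x + t) = h x" by (auto simp: periodic)
next
  fix C :: "(real^'n \<Rightarrow> real) \<Rightarrow> real"
  define c1 where "c1 = C (\<lambda>w. ln (height w))"
  define c2 where "c2 = C (\<lambda>w. ln (height w + rad w))"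
  define T where "T w \<longleftrightarrow> exp (- c1) \<le> height w \<and> height w \<le> exp c1 \<and>
    exp (- c2) \<le> height w + rad w \<and> height w + rad w \<le> exp c2" for w
  have ln_iff: "\<bar>ln t\<bar> \<le> r \<longleftrightarrow> exp (- r) \<le> t \<and> t \<le> exp r" if "0 < t" for t r :: real
  proof -
    have "\<bar>ln t\<bar> \<le> r \<longleftrightarrow> - r \<le> ln t \<and> ln t \<le> r" by linarith
    then show ?thesis
      using that ln_le_cancel_iff[of t "exp r"] ln_le_cancel_iff[of "exp (- r)" t] by simp
  qed
  have T: "T w \<longleftrightarrow> w \<in> W \<and> \<bar>ln (height w)\<bar> \<le> c1 \<and> \<bar>ln (height w + rad w)\<bar> \<le> c2" for w
  proof (cases "0 < height w")
    case True
    then have "0 < height w + rad w" by (intro add_pos_pos rad_pos)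
    then show ?thesis using True by (auto simp: T_def W_def ln_iff)
  next
    case False
    then have "\<not> exp (- c1) \<le> height w" using exp_gt_zero[of "- c1"] by linarith
    then show ?thesis using False by (simp add: T_def W_def)
  qed
  have "closed {w. T w}"
    unfolding T_def
    by (intro closed_Collect_conj closed_Collect_le continuous_intros continuous_on_height continuous_on_rad)
  moreover have "\<bar>w $ a\<bar> \<le> exp (exp c2) \<and> \<bar>w $ b\<bar> \<le> exp (exp c2)" if "T w" for w
  proof (rule component_le_if_rsq_le)
    have "rad w \<le> exp c2" using that T[of w] height_pos[of w] unfolding T_def by linarith
    then have "exp (2 * (rad w - 4)) \<le> exp (2 * exp c2)" by simp
    then have "profile (rsq w) \<le> exp (2 * exp c2)" unfolding exp_rad .
    then show "rsq w \<le> (exp (exp c2))\<^sup>2"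
      using profile_ge_self[of "rsq w"] unfolding exp_double by linarith
  qed simp
  ultimately have "compact {w. T w \<and> w \<in> period_box a b}"
    by (rule compact_box)
  also have "{w. T w \<and> w \<in> period_box a b} =
    {x \<in> W. x \<in> period_box a b \<and>
       (\<forall>h\<in>{\<lambda>w. ln (height w), \<lambda>w. ln (height w + rad w)}. \<bar>h x\<bar> \<le> C h)}"
    unfolding T by (auto simp: c1_def c2_def)
  finally show "compact {x \<in> W. x \<in> period_box a b \<and>
       (\<forall>h\<in>{\<lambda>w. ln (height w), \<lambda>w. ln (height w + rad w)}. \<bar>h x\<bar> \<le> C h)}" .
qed

lemma not_hyperbolic_cap: "\<not> hyperbolic M"
proof
  assume hyp: "hyperbolic M"
  have r0: "rsq 0 = 0" by (simp add: rsq_def)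
  have 0: "0 \<in> W" by (simp add: W_def height_def z0_def add_pos_pos)
  obtain V where V: "open V" "V \<subseteq> W" "inj_on (orbit a b) V" "0 \<in> V" by (rule small_chart[OF 0])
  then have "(V, orbit a b) \<in> atlas M" by simp
  then have "sectional_curvature G 0 v w = -1" if "v \<noteq> w" "independent {v, w}" for v w
    using hyp V(4) that unfolding hyperbolic_def by fastforce
  then have "scalar_curvature G 0 = - (real CARD('n) * (real CARD('n) - 1))"
    by (intro hyperbolic_imp_scalar_curvature[OF G_def]) simp_all
  then show False using scalar_curvature_bounds(2)[OF 0 r0] by simp
qed

definition K :: "(real^'n) set" where
  "K = {w. rsq w \<le> 1 \<and> w \<in> period_box a b}"

lemma compact_K: "compact K"
  unfolding K_def
proof (rule compact_box)
  show "closed {w. rsq w \<le> 1}"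
    by (intro closed_Collect_le continuous_on_const continuous_on_rsq)
  show "\<bar>w $ a\<bar> \<le> 1 \<and> \<bar>w $ b\<bar> \<le> 1" if "rsq w \<le> 1" for w
    using component_le_if_rsq_le[of w 1] that by simp
qed

lemma K_subset: "K \<subseteq> W"
  by (auto simp: K_def intro: in_W_if_rsq_le)

lemma orbit_in_K:
  assumes "w \<in> W"
  shows "orbit a b w \<in> orbit a b ` K \<longleftrightarrow> rsq w \<le> 1"
  unfolding K_def by (rule orbit_in_image_of_box[OF assms]) (simp only: periodic)

end

section \<open>Polar coordinates\<close>

text \<open>The branch near \<open>\<phi>\<close> of the polar angle of \<open>(x, y)\<close>, obtained by rotating by \<open>- \<phi>\<close> into the right
half-plane.\<close>

definition branch :: "real \<Rightarrow> real \<Rightarrow> real \<Rightarrow> real" where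
  "branch \<phi> x y = \<phi> + arctan ((y * cos \<phi> - x * sin \<phi>) / (x * cos \<phi> + y * sin \<phi>))"

lemma branch_polar:
  assumes pos: "0 < x * cos \<phi> + y * sin \<phi>"
  shows "x = sqrt (x\<^sup>2 + y\<^sup>2) * cos (branch \<phi> x y)" "y = sqrt (x\<^sup>2 + y\<^sup>2) * sin (branch \<phi> x y)"
proof -
  define u where "u = x * cos \<phi> + y * sin \<phi>"
  define v where "v = y * cos \<phi> - x * sin \<phi>"
  have u: "0 < u" using pos by (simp add: u_def)
  have sc: "(sin \<phi>)\<^sup>2 + (cos \<phi>)\<^sup>2 = 1" by simp
  have uv: "x = u * cos \<phi> - v * sin \<phi>" "y = u * sin \<phi> + v * cos \<phi>"
    unfolding u_def v_def using sc by algebra+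
  have "u\<^sup>2 + v\<^sup>2 = ((sin \<phi>)\<^sup>2 + (cos \<phi>)\<^sup>2) * (x\<^sup>2 + y\<^sup>2)" unfolding u_def v_def by algebra
  then have norm: "x\<^sup>2 + y\<^sup>2 = u\<^sup>2 + v\<^sup>2" by simp
  have "u\<^sup>2 + v\<^sup>2 = u\<^sup>2 * (1 + (v / u)\<^sup>2)" using u by (simp add: field_simps)
  then have r: "sqrt (x\<^sup>2 + y\<^sup>2) = u * sqrt (1 + (v / u)\<^sup>2)"
    unfolding norm using u by (simp add: real_sqrt_mult)
  have "0 < 1 + (v / u)\<^sup>2" using zero_le_power2[of "v / u"] by linarith
  then have s: "sqrt (1 + (v / u)\<^sup>2) \<noteq> 0" by simp
  have c: "sqrt (x\<^sup>2 + y\<^sup>2) * cos (arctan (v / u)) = u"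
    unfolding r cos_arctan using s by simp
  have s: "sqrt (x\<^sup>2 + y\<^sup>2) * sin (arctan (v / u)) = v"
    unfolding r sin_arctan using s u by simp
  have b: "branch \<phi> x y = \<phi> + arctan (v / u)" by (simp add: branch_def u_def v_def)
  have "sqrt (x\<^sup>2 + y\<^sup>2) * cos (branch \<phi> x y)
      = cos \<phi> * (sqrt (x\<^sup>2 + y\<^sup>2) * cos (arctan (v / u))) - sin \<phi> * (sqrt (x\<^sup>2 + y\<^sup>2) * sin (arctan (v / u)))"
    unfolding b cos_add by algebra
  then show "x = sqrt (x\<^sup>2 + y\<^sup>2) * cos (branch \<phi> x y)" unfolding c s using uv(1) by (simp add: mult.commute)
  have "sqrt (x\<^sup>2 + y\<^sup>2) * sin (branch \<phi> x y)
      = sin \<phi> * (sqrt (x\<^sup>2 + y\<^sup>2) * cos (arctan (v / u))) + cos \<phi> * (sqrt (x\<^sup>2 + y\<^sup>2) * sin (arctan (v / u)))"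
    unfolding b sin_add by algebra
  then show "y = sqrt (x\<^sup>2 + y\<^sup>2) * sin (branch \<phi> x y)" unfolding c s using uv(2) by (simp add: mult.commute)
qed

lemma polar_exists:
  assumes "0 < x\<^sup>2 + y\<^sup>2"
  obtains \<phi> where "x = sqrt (x\<^sup>2 + y\<^sup>2) * cos \<phi>" "y = sqrt (x\<^sup>2 + y\<^sup>2) * sin \<phi>"
    "0 < x * cos \<phi> + y * sin \<phi>"
proof -
  define r where "r = sqrt (x\<^sup>2 + y\<^sup>2)"
  have r: "0 < r" "r\<^sup>2 = x\<^sup>2 + y\<^sup>2" using assms by (simp_all add: r_def less_imp_le)
  have ne: "x\<^sup>2 + y\<^sup>2 \<noteq> 0" using assms by linarith
  have "(x / r)\<^sup>2 + (y / r)\<^sup>2 = 1"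
    by (simp only: power_divide r(2) add_divide_distrib[symmetric] divide_self[OF ne])
  then obtain \<phi> where \<phi>: "x / r = cos \<phi>" "y / r = sin \<phi>" using sincos_total_2pi_le by metis
  have xy: "x = r * cos \<phi>" "y = r * sin \<phi>" using \<phi> r(1) by (simp_all add: field_simps)
  have "x * cos \<phi> + y * sin \<phi> = r * ((sin \<phi>)\<^sup>2 + (cos \<phi>)\<^sup>2)" unfolding xy by algebra
  then have "0 < x * cos \<phi> + y * sin \<phi>" using r(1) by simp
  with xy show ?thesis using that unfolding r_def by blast
qed

lemma same_polar_angle:
  assumes "0 < (r :: real)" "r * cos \<alpha> = r * cos \<beta>" "r * sin \<alpha> = r * sin \<beta>"
  shows "\<exists>k::int. \<beta> - \<alpha> = 2 * pi * of_int k"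
proof -
  have "sin \<beta> = sin \<alpha> \<and> cos \<beta> = cos \<alpha>" using assms by simp
  then obtain k :: int where "\<beta> = \<alpha> + 2 * pi * of_int k" unfolding sin_cos_eq_iff by blast
  then show ?thesis by auto
qed

lemma smooth_on_branch:
  fixes f g :: "'a::real_normed_vector \<Rightarrow> real"
  assumes "open N" "smooth_on N f" "smooth_on N g" "\<And>y. y \<in> N \<Longrightarrow> 0 < f y * cos \<phi> + g y * sin \<phi>"
  shows "smooth_on N (\<lambda>y. branch \<phi> (f y) (g y))"
  unfolding branch_def
proof (intro smooth_on_add smooth_on_arctan' smooth_on_divide smooth_on_diff smooth_on_mult
    smooth_on_const assms)
  show "f y * cos \<phi> + g y * sin \<phi> \<noteq> 0" if "y \<in> N" for y using assms(4)[OF that] by simp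
qed

lemma branch_has_derivative:
  fixes x y :: "'a::real_normed_vector \<Rightarrow> real"
  assumes x: "(x has_derivative x') (at w)" and y: "(y has_derivative y') (at w)"
    and pos: "0 < x w * cos \<phi> + y w * sin \<phi>"
  shows "((\<lambda>w. branch \<phi> (x w) (y w)) has_derivative
    (\<lambda>h. (x w * y' h - y w * x' h) / ((x w)\<^sup>2 + (y w)\<^sup>2))) (at w)"
proof -
  define u where "u w = x w * cos \<phi> + y w * sin \<phi>" for w
  define v where "v w = y w * cos \<phi> - x w * sin \<phi>" for w
  define u' where "u' h = x' h * cos \<phi> + y' h * sin \<phi>" for h
  define v' where "v' h = y' h * cos \<phi> - x' h * sin \<phi>" for h
  have sc: "(sin \<phi>)\<^sup>2 + (cos \<phi>)\<^sup>2 = 1" by simp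
  have uw: "0 < u w" using pos by (simp add: u_def)
  have u: "(u has_derivative u') (at w)" unfolding u_def u'_def by (auto intro!: derivative_eq_intros x y)
  have v: "(v has_derivative v') (at w)" unfolding v_def v'_def by (auto intro!: derivative_eq_intros x y)
  have "((\<lambda>w. v w / u w) has_derivative (\<lambda>h. (v' h * u w - v w * u' h) / (u w)\<^sup>2)) (at w)"
    using uw by (auto intro!: derivative_eq_intros u v simp: power2_eq_square field_simps)
  moreover have "(arctan has_derivative (*) (inverse (1 + (v w / u w)\<^sup>2))) (at (v w / u w))"
    using DERIV_arctan by (simp add: has_field_derivative_def)
  ultimately have "((\<lambda>w. arctan (v w / u w)) has_derivative
      (\<lambda>h. inverse (1 + (v w / u w)\<^sup>2) * ((v' h * u w - v w * u' h) / (u w)\<^sup>2))) (at w)"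
    by (rule has_derivative_compose)
  from has_derivative_add[OF has_derivative_const this, of \<phi>]
  have "((\<lambda>w. branch \<phi> (x w) (y w)) has_derivative
      (\<lambda>h. inverse (1 + (v w / u w)\<^sup>2) * ((v' h * u w - v w * u' h) / (u w)\<^sup>2))) (at w)"
    unfolding branch_def u_def[symmetric] v_def[symmetric] by simp
  moreover have "inverse (1 + (v w / u w)\<^sup>2) * ((v' h * u w - v w * u' h) / (u w)\<^sup>2)
      = (x w * y' h - y w * x' h) / ((x w)\<^sup>2 + (y w)\<^sup>2)" for h
  proof -
    have "(u w)\<^sup>2 + (v w)\<^sup>2 = ((sin \<phi>)\<^sup>2 + (cos \<phi>)\<^sup>2) * ((x w)\<^sup>2 + (y w)\<^sup>2)"
      unfolding u_def v_def by algebra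
    then have norm: "(u w)\<^sup>2 + (v w)\<^sup>2 = (x w)\<^sup>2 + (y w)\<^sup>2" by simp
    have "v' h * u w - v w * u' h = ((sin \<phi>)\<^sup>2 + (cos \<phi>)\<^sup>2) * (x w * y' h - y w * x' h)"
      unfolding u_def v_def u'_def v'_def by algebra
    then have num: "v' h * u w - v w * u' h = x w * y' h - y w * x' h" by simp
    have "(u w)\<^sup>2 * (1 + (v w / u w)\<^sup>2) = (u w)\<^sup>2 + (v w)\<^sup>2"
      using uw by (simp add: distrib_left power_divide)
    then have "inverse (1 + (v w / u w)\<^sup>2) * ((v' h * u w - v w * u' h) / (u w)\<^sup>2)
        = (v' h * u w - v w * u' h) / ((u w)\<^sup>2 + (v w)\<^sup>2)"
      by (simp add: divide_inverse mult_ac flip: inverse_mult_distrib)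
    then show ?thesis unfolding norm num .
  qed
  ultimately show ?thesis by simp
qed

lemma pullback_conformal_nth:
  assumes "(F has_derivative D) (at x)"
  shows "pullback_matrix F (\<lambda>p. s p *\<^sub>R mat 1) x $ i $ j = s (F x) * (D (axis i 1) \<bullet> D (axis j 1))"
proof -
  have J: "jacobian F (at x) $ k $ i = D (axis i 1) $ k" for k i
    unfolding jacobian_def frechet_derivative_at[OF assms, symmetric] by (simp add: matrix_def)
  have "pullback_matrix F (\<lambda>p. s p *\<^sub>R mat 1) x
      = s (F x) *\<^sub>R (transpose (jacobian F (at x)) ** jacobian F (at x))"
    unfolding pullback_matrix_def
    by (simp add: scalar_matrix_assoc matrix_scalar_ac flip: matrix_mul_assoc)
  then show ?thesis
    by (simp add: matrix_matrix_mult_def transpose_def J inner_vec_def)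
qed

section \<open>The isometry outside compact sets\<close>

context cap
begin

abbreviation H :: "(real^'n) set" where
  "H \<equiv> upper_half_space b"

sublocale H: periodic_domain a b H
proof
  show "open H" unfolding upper_half_space_def by (intro open_Collect_less continuous_intros)
  show "x + t \<in> H" if "x \<in> H" "t \<in> periods a b" for x t
    using that by (simp add: upper_half_space_def periods_def)
qed

definition rho :: "real^'n \<Rightarrow> real" where
  "rho h = sqrt ((h $ b - z0)\<^sup>2 + (h $ a)\<^sup>2)"

text \<open>The isometry as a relation between points of \<open>\<real>\<^sup>n\<close> over the two quotients: \<open>w\<close> contains polar coordinates for
\<open>h\<close> in the half-plane, and \<open>h\<close> contains polar coordinates for \<open>w\<close> in the plane of the disc. Both angles
are determined only modulo \<open>2 \<pi>\<close>, that is, modulo periods on either side. Hence the relation descends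
to a bijection of orbits, although in neither direction is it the graph of a map on \<open>\<real>\<^sup>n\<close>.\<close>

definition corresponds :: "real^'n \<Rightarrow> real^'n \<Rightarrow> bool" where
  "corresponds w h \<longleftrightarrow> w \<in> W \<and> 1 < rsq w \<and>
     h $ b = height w \<and> h $ a = rad w * sin (w $ c) \<and>
     w $ a = sqrt (rsq w) * cos (h $ c) \<and> w $ b = sqrt (rsq w) * sin (h $ c) \<and>
     (\<forall>i. i \<noteq> a \<longrightarrow> i \<noteq> b \<longrightarrow> i \<noteq> c \<longrightarrow> h $ i = w $ i)"

lemma corresponds_rho:
  assumes "corresponds w h"
  shows "rho h = rad w" "sqrt (rsq w) = exp (rho h - 4)" "h \<in> H" "4 < rho h"
proof -
  have h: "h $ b - z0 = rad w * cos (w $ c)" "h $ a = rad w * sin (w $ c)"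
    using assms by (simp_all add: corresponds_def height_def)
  have "(h $ b - z0)\<^sup>2 + (h $ a)\<^sup>2 = (rad w)\<^sup>2 * ((sin (w $ c))\<^sup>2 + (cos (w $ c))\<^sup>2)"
    unfolding h by algebra
  then show rho: "rho h = rad w" by (simp add: rho_def less_imp_le)
  have r: "1 < rsq w" using assms by (simp add: corresponds_def)
  have "rsq w = (exp (rad w - 4))\<^sup>2"
    using exp_rad[of w] r by (simp add: profile_outside flip: exp_double)
  then show "sqrt (rsq w) = exp (rho h - 4)" unfolding rho by simp
  show "h \<in> H" using assms height_pos[of w] by (simp add: corresponds_def upper_half_space_def)
  have "4 < rad w" using r by (simp add: rad_outside)
  then show "4 < rho h" by (simp add: rho)
qed

lemma correspondsI:
  assumes "h \<in> H" "4 < rho h" and w: "w $ a = exp (rho h - 4) * cos (h $ c)" "w $ b = exp (rho h - 4) * sin (h $ c)"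
    and h: "h $ b - z0 = rho h * cos (w $ c)" "h $ a = rho h * sin (w $ c)"
    and eq: "\<And>i. i \<noteq> a \<Longrightarrow> i \<noteq> b \<Longrightarrow> i \<noteq> c \<Longrightarrow> h $ i = w $ i"
  shows "corresponds w h"
proof -
  have "rsq w = (exp (rho h - 4))\<^sup>2 * ((sin (h $ c))\<^sup>2 + (cos (h $ c))\<^sup>2)"
    unfolding rsq_def w by algebra
  then have rsq: "rsq w = (exp (rho h - 4))\<^sup>2" by simp
  then have r: "1 < rsq w" using assms(2) by (simp flip: exp_double)
  have rad: "rad w = rho h" using r by (simp add: rad_outside) (simp add: rsq ln_realpow field_simps)
  have "height w = h $ b" using h(1) by (simp add: height_def rad)
  then show ?thesis
    using assms(1) r h(2) w eq by (auto simp: corresponds_def W_def upper_half_space_def rad rsq)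
qed

lemma periods_if:
  assumes "t $ a = 0" "t $ b = 0" "\<exists>k::int. t $ c = 2 * pi * of_int k"
    "\<And>i. i \<noteq> a \<Longrightarrow> i \<noteq> b \<Longrightarrow> i \<noteq> c \<Longrightarrow> \<exists>k::int. t $ i = 2 * pi * of_int k"
  shows "t \<in> periods a b"
proof -
  have "\<exists>k::int. t $ i = 2 * pi * of_int k" for i
  proof (cases "i = a \<or> i = b")
    case True
    then show ?thesis using assms(1,2) by (auto intro: exI[of _ 0])
  next
    case False
    then show ?thesis using assms(3,4) by (cases "i = c") auto
  qed
  then show ?thesis using assms(1,2) by (simp add: periods_def)
qed

lemma corresponds_orbit:
  assumes 1: "corresponds w h" and 2: "corresponds w' h'"
  shows "orbit a b w = orbit a b w' \<longleftrightarrow> orbit a b h = orbit a b h'"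
proof -
  have other: "(h' - h) $ i = (w' - w) $ i" if "i \<noteq> a" "i \<noteq> b" "i \<noteq> c" for i
    using that 1 2 by (auto simp: corresponds_def)
  show ?thesis unfolding orbit_eq_iff
  proof
    assume t: "w' - w \<in> periods a b"
    note p = periodic[OF t, of w] period_simps[OF t, of w]
    have "0 < sqrt (rsq w)" using 1 by (auto simp: corresponds_def)
    then show "h' - h \<in> periods a b"
    proof (intro periods_if)
      show "(h' - h) $ a = 0" "(h' - h) $ b = 0" using 1 2 p by (simp_all add: corresponds_def)
      show "\<exists>k::int. (h' - h) $ c = 2 * pi * of_int k"
        using same_polar_angle[OF \<open>0 < sqrt (rsq w)\<close>, of "h $ c" "h' $ c"] 1 2 p
        by (simp add: corresponds_def)
      show "\<exists>k::int. (h' - h) $ i = 2 * pi * of_int k" if "i \<noteq> a" "i \<noteq> b" "i \<noteq> c" for i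
        unfolding other[OF that] using t unfolding periods_def by blast
    qed
  next
    assume t: "h' - h \<in> periods a b"
    note p = period_simps[OF t, of h]
    have rho: "rho h' = rho h" using p by (simp add: rho_def)
    have s: "sqrt (rsq w') = sqrt (rsq w)" and r: "rad w' = rad w"
      using corresponds_rho[OF 1] corresponds_rho[OF 2] rho by simp_all
    show "w' - w \<in> periods a b"
    proof (intro periods_if)
      show "(w' - w) $ a = 0" "(w' - w) $ b = 0" using 1 2 p s by (simp_all add: corresponds_def)
      show "\<exists>k::int. (w' - w) $ c = 2 * pi * of_int k"
        using same_polar_angle[of "rad w" "w $ c" "w' $ c"] 1 2 p r
        by (simp add: corresponds_def height_def)
      show "\<exists>k::int. (w' - w) $ i = 2 * pi * of_int k" if "i \<noteq> a" "i \<noteq> b" "i \<noteq> c" for i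
        unfolding other[OF that, symmetric] using t unfolding periods_def by blast
    qed
  qed
qed

definition to_H :: "(real^'n) set \<Rightarrow> (real^'n) set" where
  "to_H P = (SOME Q. \<exists>w h. corresponds w h \<and> P = orbit a b w \<and> Q = orbit a b h)"

definition from_H :: "(real^'n) set \<Rightarrow> (real^'n) set" where
  "from_H Q = (SOME P. \<exists>w h. corresponds w h \<and> P = orbit a b w \<and> Q = orbit a b h)"

lemma to_H_orbit:
  assumes "corresponds w h"
  shows "to_H (orbit a b w) = orbit a b h"
proof -
  have "\<exists>w' h'. corresponds w' h' \<and> orbit a b w = orbit a b w' \<and> to_H (orbit a b w) = orbit a b h'"
    unfolding to_H_def by (rule someI_ex) (use assms in blast)
  then show ?thesis using corresponds_orbit assms by metis
qed

lemma from_H_orbit: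
  assumes "corresponds w h"
  shows "from_H (orbit a b h) = orbit a b w"
proof -
  have "\<exists>w' h'. corresponds w' h' \<and> from_H (orbit a b h) = orbit a b w' \<and> orbit a b h = orbit a b h'"
    unfolding from_H_def by (rule someI_ex) (use assms in blast)
  then show ?thesis using corresponds_orbit assms by metis
qed

text \<open>With \<open>\<sigma> = |p|\<^sup>2\<close> and \<open>A = 4 + log |p|\<close>, the differential of the lift is a rotation of
\<open>(dA, A d\<theta>)\<close> in the half-plane together with \<open>d\<phi>\<close>, and \<open>dA\<^sup>2 + d\<phi>\<^sup>2 = |dp|\<^sup>2 / \<sigma>\<close>.\<close>

lemma to_H_lift:
  assumes w: "w \<in> W" "1 < rsq w"
  obtains N \<Psi> where "open N" "w \<in> N" "smooth_on N \<Psi>" "\<And>y. y \<in> N \<Longrightarrow> corresponds y (\<Psi> y)"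
    "G w = pullback_matrix \<Psi> (\<lambda>p. (1 / (p $ b)\<^sup>2) *\<^sub>R mat 1) w"
proof -
  have rsq: "rsq y = (y $ a)\<^sup>2 + (y $ b)\<^sup>2" for y by (simp add: rsq_def)
  obtain \<phi> where \<phi>: "0 < w $ a * cos \<phi> + w $ b * sin \<phi>"
    using polar_exists[of "w $ a" "w $ b"] w(2) unfolding rsq by (metis less_trans zero_less_one)
  define N where "N = {y \<in> W. 1 < rsq y \<and> 0 < y $ a * cos \<phi> + y $ b * sin \<phi>}"
  define \<Psi> :: "real^'n \<Rightarrow> real^'n" where "\<Psi> y = (\<chi> i. if i = a then rad y * sin (y $ c) else if i = b then height y
    else if i = c then branch \<phi> (y $ a) (y $ b) else y $ i)" for y
  have \<Psi>: "\<Psi> y $ a = rad y * sin (y $ c)" "\<Psi> y $ b = height y" "\<Psi> y $ c = branch \<phi> (y $ a) (y $ b)"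
    "i \<noteq> a \<Longrightarrow> i \<noteq> b \<Longrightarrow> i \<noteq> c \<Longrightarrow> \<Psi> y $ i = y $ i" for y i
    using distinct by (auto simp: \<Psi>_def)
  have N: "open N"
  proof -
    have "open {y :: real^'n. 1 < rsq y \<and> 0 < y $ a * cos \<phi> + y $ b * sin \<phi>}"
      by (intro open_Collect_conj open_Collect_less continuous_intros continuous_on_rsq)
    then have "open (W \<inter> {y. 1 < rsq y \<and> 0 < y $ a * cos \<phi> + y $ b * sin \<phi>})"
      using open_W by (rule open_Int[rotated])
    then show ?thesis by (simp add: N_def Int_def)
  qed
  show ?thesis
  proof (rule that[of N \<Psi>])
    show "open N" by (rule N)
    show "w \<in> N" using w \<phi> by (simp add: N_def)
    show "corresponds y (\<Psi> y)" if "y \<in> N" for y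
      using that branch_polar[of "y $ a" \<phi> "y $ b"]
      by (simp add: N_def corresponds_def \<Psi> rsq)
    have r: "smooth_on N rad" and h: "smooth_on N height"
      using smooth_on_subset[OF smooth_on_rad] smooth_on_subset[OF smooth_on_height] by auto
    have "smooth_on N (\<lambda>y. if i = a then rad y * sin (y $ c) else if i = b then height y
        else if i = c then branch \<phi> (y $ a) (y $ b) else y $ i)" for i
    proof -
      have "smooth_on N (\<lambda>y. rad y * sin (y $ c))"
        by (intro smooth_on_mult smooth_on_sin' N r smooth_on_component)
      moreover have "smooth_on N (\<lambda>y. branch \<phi> (y $ a) (y $ b))"
        by (intro smooth_on_branch N smooth_on_component) (simp add: N_def)
      moreover have "smooth_on N (\<lambda>y. y $ i)" by (rule smooth_on_component)
      ultimately show ?thesis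
        using h by (cases "i = a"; cases "i = b"; cases "i = c") simp_all
    qed
    then show "smooth_on N \<Psi>" unfolding \<Psi>_def by (intro smooth_on_vec N)
    define \<sigma> where "\<sigma> = rsq w"
    have \<sigma>: "0 < \<sigma>" "profile \<sigma> = \<sigma>" "slope \<sigma> = 1 / \<sigma>"
      using w(2) by (simp_all add: \<sigma>_def slope_def profile_outside)
    define dr where "dr t = (w $ a * t $ a + w $ b * t $ b) / \<sigma>" for t :: "real^'n"
    define D :: "real^'n \<Rightarrow> real^'n" where "D t = (\<chi> i. if i = a then dr t * sin (w $ c) + rad w * cos (w $ c) * t $ c
      else if i = b then dr t * cos (w $ c) - rad w * sin (w $ c) * t $ c
      else if i = c then (w $ a * t $ b - w $ b * t $ a) / \<sigma> else t $ i)" for t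
    have dr: "(rad has_derivative dr) (at w)"
      using rad_has_derivative[of w] by (simp add: \<sigma>_def[symmetric] \<sigma>(3) dr_def[abs_def] divide_inverse mult.commute)
    have D: "(\<Psi> has_derivative D) (at w)"
      unfolding has_derivative_componentwise_within[of \<Psi>]
    proof
      fix u :: "real^'n" assume "u \<in> Basis"
      then obtain i where u: "u = axis i 1" by (auto simp: Basis_vec_def)
      have ra: "((\<lambda>y. rad y * sin (y $ c)) has_derivative
          (\<lambda>t. dr t * sin (w $ c) + rad w * cos (w $ c) * t $ c)) (at w)"
        by (auto intro!: derivative_eq_intros dr has_derivative_component simp: algebra_simps)
      have rb: "(height has_derivative (\<lambda>t. dr t * cos (w $ c) - rad w * sin (w $ c) * t $ c)) (at w)"
        unfolding height_def by (auto intro!: derivative_eq_intros dr has_derivative_component simp: algebra_simps)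
      have rc: "((\<lambda>y. branch \<phi> (y $ a) (y $ b)) has_derivative (\<lambda>t. (w $ a * t $ b - w $ b * t $ a) / \<sigma>)) (at w)"
        using branch_has_derivative[OF has_derivative_component has_derivative_component \<phi>] by (simp add: \<sigma>_def rsq)
      have "((\<lambda>y. \<Psi> y $ i) has_derivative (\<lambda>t. D t $ i)) (at w)"
        using ra rb rc has_derivative_component[of i "at w"] distinct
        by (cases "i = a"; cases "i = b"; cases "i = c") (simp_all add: \<Psi>_def D_def)
      then show "((\<lambda>y. \<Psi> y \<bullet> u) has_derivative (\<lambda>t. D t \<bullet> u)) (at w)"
        by (simp add: u inner_axis)
    qed
    define g where "g i = (if i = a \<or> i = b then 1 / \<sigma> else if i = c then (rad w)\<^sup>2 else 1)" for i
    have inner: "D t \<bullet> D s = (\<Sum>i\<in>UNIV. g i * (t $ i * s $ i))" for t s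
    proof -
      have split: "(\<Sum>i\<in>UNIV. F i) = F a + F b + F c + (\<Sum>i\<in>-{a, b, c}. F i)" for F :: "'n \<Rightarrow> real"
        using sum.subset_diff[of "{a, b, c}" UNIV F] distinct by (simp add: Compl_eq_Diff_UNIV algebra_simps)
      have rest: "(\<Sum>i\<in>-{a, b, c}. D t $ i * D s $ i) = (\<Sum>i\<in>-{a, b, c}. g i * (t $ i * s $ i))"
        by (rule sum.cong) (auto simp: D_def g_def)
      define C where "C = cos (w $ c)"
      define S where "S = sin (w $ c)"
      define R where "R = rad w"
      have SC: "S\<^sup>2 + C\<^sup>2 = 1" by (simp add: S_def C_def)
      have "(dr t * S + R * C * t $ c) * (dr s * S + R * C * s $ c)
          + (dr t * C - R * S * t $ c) * (dr s * C - R * S * s $ c)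
          = (S\<^sup>2 + C\<^sup>2) * (dr t * dr s + R\<^sup>2 * (t $ c * s $ c))" by algebra
      then have ab: "(dr t * S + R * C * t $ c) * (dr s * S + R * C * s $ c)
          + (dr t * C - R * S * t $ c) * (dr s * C - R * S * s $ c)
          = dr t * dr s + R\<^sup>2 * (t $ c * s $ c)" unfolding SC by simp
      have "dr t * dr s + (w $ a * t $ b - w $ b * t $ a) / \<sigma> * ((w $ a * s $ b - w $ b * s $ a) / \<sigma>)
          = ((w $ a)\<^sup>2 + (w $ b)\<^sup>2) * (t $ a * s $ a + t $ b * s $ b) / (\<sigma> * \<sigma>)"
        by (simp add: dr_def add_divide_distrib[symmetric]) algebra
      also have "\<dots> = 1 / \<sigma> * (t $ a * s $ a) + 1 / \<sigma> * (t $ b * s $ b)"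
        unfolding rsq[symmetric] \<sigma>_def[symmetric] using \<sigma>(1) by (simp add: add_divide_distrib)
      finally have c: "dr t * dr s + (w $ a * t $ b - w $ b * t $ a) / \<sigma> * ((w $ a * s $ b - w $ b * s $ a) / \<sigma>)
          = 1 / \<sigma> * (t $ a * s $ a) + 1 / \<sigma> * (t $ b * s $ b)" .
      have "D t $ a * D s $ a + D t $ b * D s $ b + D t $ c * D s $ c
          = g a * (t $ a * s $ a) + g b * (t $ b * s $ b) + g c * (t $ c * s $ c)"
        using ab c distinct by (simp add: D_def g_def flip: C_def S_def R_def)
      then show ?thesis unfolding inner_vec_def inner_real_def split rest by simp
    qed
    have G: "G w = diagonal (\<lambda>i. g i / (height w)\<^sup>2)"
      unfolding G_nth[OF w(1)] g_def \<sigma>_def[symmetric] \<sigma>(2) ..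
    have "pullback_matrix \<Psi> (\<lambda>p. (1 / (p $ b)\<^sup>2) *\<^sub>R mat 1) w $ i $ j = G w $ i $ j" for i j
    proof -
      have "(\<Sum>k\<in>UNIV. g k * (axis i 1 $ k * axis j 1 $ k)) = (\<Sum>k\<in>UNIV. if k = i then (if i = j then g i else 0) else 0)"
        by (rule sum.cong) (auto simp: axis_def)
      then show ?thesis
        unfolding pullback_conformal_nth[OF D] inner by (simp add: G diagonal_nth \<Psi>)
    qed
    then show "G w = pullback_matrix \<Psi> (\<lambda>p. (1 / (p $ b)\<^sup>2) *\<^sub>R mat 1) w"
      by (simp add: vec_eq_iff)
  qed
qed

lemma from_H_lift:
  assumes h: "h \<in> H" "4 < rho h"
  obtains N \<Psi> where "open N" "h \<in> N" "smooth_on N \<Psi>" "\<And>y. y \<in> N \<Longrightarrow> corresponds (\<Psi> y) y"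
proof -
  have pos: "0 < (h $ b - z0)\<^sup>2 + (h $ a)\<^sup>2"
  proof -
    have "0 < rho h" using h(2) by simp
    then show ?thesis by (simp add: rho_def)
  qed
  obtain \<phi> where \<phi>: "0 < (h $ b - z0) * cos \<phi> + h $ a * sin \<phi>"
    using polar_exists[OF pos] by metis
  define N where "N = {y \<in> H. 4 < rho y \<and> 0 < (y $ b - z0) * cos \<phi> + y $ a * sin \<phi>}"
  define \<Psi> :: "real^'n \<Rightarrow> real^'n" where "\<Psi> y = (\<chi> i. if i = a then exp (rho y - 4) * cos (y $ c)
    else if i = b then exp (rho y - 4) * sin (y $ c)
    else if i = c then branch \<phi> (y $ b - z0) (y $ a) else y $ i)" for y
  have \<Psi>: "\<Psi> y $ a = exp (rho y - 4) * cos (y $ c)" "\<Psi> y $ b = exp (rho y - 4) * sin (y $ c)"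
    "\<Psi> y $ c = branch \<phi> (y $ b - z0) (y $ a)"
    "i \<noteq> a \<Longrightarrow> i \<noteq> b \<Longrightarrow> i \<noteq> c \<Longrightarrow> \<Psi> y $ i = y $ i" for y i
    using distinct by (auto simp: \<Psi>_def)
  have rho_cont: "continuous_on UNIV rho" unfolding rho_def by (intro continuous_intros)
  have N: "open N"
  proof -
    have "open {y :: real^'n. 4 < rho y \<and> 0 < (y $ b - z0) * cos \<phi> + y $ a * sin \<phi>}"
      by (intro open_Collect_conj open_Collect_less continuous_intros rho_cont)
    then have "open (H \<inter> {y. 4 < rho y \<and> 0 < (y $ b - z0) * cos \<phi> + y $ a * sin \<phi>})"
      using H.open_domain by (rule open_Int[rotated])
    then show ?thesis by (simp add: N_def Int_def)
  qed
  show ?thesis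
  proof (rule that[of N \<Psi>])
    show "open N" by (rule N)
    show "h \<in> N" using h \<phi> by (simp add: N_def)
    show "corresponds (\<Psi> y) y" if "y \<in> N" for y
      using that branch_polar[of "y $ b - z0" \<phi> "y $ a"]
      by (intro correspondsI) (simp_all add: N_def \<Psi> rho_def)
    have r: "smooth_on N rho"
      unfolding rho_def
    proof (intro smooth_on_sqrt' smooth_on_add smooth_on_power smooth_on_diff smooth_on_const smooth_on_component N)
      fix y assume "y \<in> N"
      then have "0 < rho y" by (simp add: N_def)
      then show "0 < (y $ b - z0)\<^sup>2 + (y $ a)\<^sup>2" by (simp add: rho_def)
    qed
    have "smooth_on N (\<lambda>y. if i = a then exp (rho y - 4) * cos (y $ c)
      else if i = b then exp (rho y - 4) * sin (y $ c)
      else if i = c then branch \<phi> (y $ b - z0) (y $ a) else y $ i)" for i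
    proof -
      have "smooth_on N (\<lambda>y. exp (rho y - 4) * cos (y $ c))" "smooth_on N (\<lambda>y. exp (rho y - 4) * sin (y $ c))"
        by (intro smooth_on_mult smooth_on_exp' smooth_on_sin' smooth_on_cos' smooth_on_diff smooth_on_const N r smooth_on_component)+
      moreover have "smooth_on N (\<lambda>y. branch \<phi> (y $ b - z0) (y $ a))"
        by (intro smooth_on_branch smooth_on_diff smooth_on_const N smooth_on_component) (simp add: N_def)
      moreover have "smooth_on N (\<lambda>y. y $ i)" by (rule smooth_on_component)
      ultimately show ?thesis
        by (cases "i = a"; cases "i = b"; cases "i = c") simp_all
    qed
    then show "smooth_on N \<Psi>" unfolding \<Psi>_def by (intro smooth_on_vec N)
  qed
qed

definition K' :: "(real^'n) set" where
  "K' = {h. rho h \<le> 4 \<and> h \<in> period_box a b}"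

lemma rho_bounds: "\<bar>h $ b - z0\<bar> \<le> rho h" "\<bar>h $ a\<bar> \<le> rho h"
  by (simp_all add: rho_def real_le_rsqrt)

lemma compact_K': "compact K'"
  unfolding K'_def
proof (rule compact_box)
  have "continuous_on UNIV rho" unfolding rho_def by (intro continuous_intros)
  then show "closed {h. rho h \<le> 4}" by (intro closed_Collect_le continuous_on_const)
  show "\<bar>h $ a\<bar> \<le> z0 + 4 \<and> \<bar>h $ b\<bar> \<le> z0 + 4" if "rho h \<le> 4" for h
    using rho_bounds[of h] that by (auto simp: z0_def abs_le_iff)
qed

lemma K'_subset: "K' \<subseteq> H"
proof
  fix h assume "h \<in> K'"
  then have "\<bar>h $ b - z0\<bar> \<le> 4" using rho_bounds(1)[of h] by (simp add: K'_def)
  moreover have "1 \<le> real CARD('n)" by (simp add: Suc_le_eq)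
  ultimately show "h \<in> H" unfolding upper_half_space_def z0_def mem_Collect_eq by linarith
qed

lemma rho_periodic: "t \<in> periods a b \<Longrightarrow> rho (h + t) = rho h"
  unfolding rho_def by (simp only: period_simps)

lemma orbit_in_K':
  assumes "h \<in> H"
  shows "orbit a b h \<in> orbit a b ` K' \<longleftrightarrow> rho h \<le> 4"
  unfolding K'_def by (rule H.orbit_in_image_of_box[OF assms]) (simp only: rho_periodic)

text \<open>The complements of the compact sets are \<open>|p| > 1\<close> and \<open>\<rho> > 4\<close>.\<close>

lemma isometric_ends:
  "isometric_subsets M (topspace (mtop M) - orbit a b ` K)
    (hyperbolic_quotient a b) (topspace (mtop (hyperbolic_quotient a b)) - orbit a b ` K')"
  unfolding hyperbolic_quotient_eq quotient_riem_simps
proof (rule isometric_subsets_quotI[where f = to_H and f' = from_H])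
  let ?U = "topspace quot - orbit a b ` K"
  let ?U' = "topspace H.quot - orbit a b ` K'"
  show "periodic_domain a b W" "periodic_domain a b H" by unfold_locales
  show "openin quot ?U"
    using compactin_imp_closedin[OF Hausdorff_quot compactin_quot[OF compact_K K_subset]]
    by (simp add: openin_diff)
  show "openin H.quot ?U'"
    using compactin_imp_closedin[OF H.Hausdorff_quot H.compactin_quot[OF compact_K' K'_subset]]
    by (simp add: openin_diff)
  show "(1 / ((x + t) $ b)\<^sup>2) *\<^sub>R mat 1 = ((1 / (x $ b)\<^sup>2) *\<^sub>R mat 1 :: real^'n^'n)"
    if "t \<in> periods a b" for x t using that by (simp add: periods_def)
  have U: "orbit a b w \<in> ?U \<longleftrightarrow> 1 < rsq w" if "w \<in> W" for w
    using that orbit_in_K[OF that] by (auto simp: topspace_quot)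
  have U': "orbit a b h \<in> ?U' \<longleftrightarrow> 4 < rho h" if "h \<in> H" for h
    using that orbit_in_K'[OF that] by (auto simp: H.topspace_quot)
  show "to_H P \<in> ?U' \<and> from_H (to_H P) = P" if P: "P \<in> ?U" for P
  proof -
    obtain w where w: "w \<in> W" "P = orbit a b w" using P by (auto simp: topspace_quot)
    then have "1 < rsq w" using U P by blast
    then obtain h where h: "corresponds w h" using to_H_lift[OF w(1)] by metis
    then show ?thesis
      using U'[OF corresponds_rho(3)[OF h]] corresponds_rho(4)[OF h]
      by (simp add: w(2) to_H_orbit from_H_orbit)
  qed
  show "from_H Q \<in> ?U \<and> to_H (from_H Q) = Q" if Q: "Q \<in> ?U'" for Q
  proof -
    obtain h where h: "h \<in> H" "Q = orbit a b h" using Q by (auto simp: H.topspace_quot)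
    then have "4 < rho h" using U' Q by blast
    then obtain w where w: "corresponds w h" using from_H_lift[OF h(1)] by metis
    then have "w \<in> W" "1 < rsq w" by (simp_all add: corresponds_def)
    then show ?thesis using w U by (simp add: h(2) to_H_orbit from_H_orbit)
  qed
  show "\<exists>N \<Psi>. smooth_lift a b to_H N \<Psi> \<and> w \<in> N \<and> \<Psi> ` N \<subseteq> H \<and>
      G w = pullback_matrix \<Psi> (\<lambda>p. (1 / (p $ b)\<^sup>2) *\<^sub>R mat 1) w"
    if "w \<in> W" "orbit a b w \<in> ?U" for w
  proof -
    have "1 < rsq w" using U that by blast
    from to_H_lift[OF that(1) this] obtain N \<Psi> where "open N" "w \<in> N" "smooth_on N \<Psi>"
      "\<And>y. y \<in> N \<Longrightarrow> corresponds y (\<Psi> y)"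
      "G w = pullback_matrix \<Psi> (\<lambda>p. (1 / (p $ b)\<^sup>2) *\<^sub>R mat 1) w" by blast
    then show ?thesis
      using corresponds_rho(3) to_H_orbit by (intro exI[of _ N] exI[of _ \<Psi>]) (auto simp: smooth_lift_def)
  qed
  show "\<exists>N \<Psi>. smooth_lift a b from_H N \<Psi> \<and> h \<in> N \<and> \<Psi> ` N \<subseteq> W"
    if "h \<in> H" "orbit a b h \<in> ?U'" for h
  proof -
    have "4 < rho h" using U' that by blast
    from from_H_lift[OF that(1) this] obtain N \<Psi> where "open N" "h \<in> N" "smooth_on N \<Psi>"
      "\<And>y. y \<in> N \<Longrightarrow> corresponds (\<Psi> y) y" by blast
    then show ?thesis
      using from_H_orbit by (intro exI[of _ N] exI[of _ \<Psi>]) (auto simp: smooth_lift_def corresponds_def)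
  qed
qed

end

theorem theorem1p2:
  fixes a b :: "'n::finite"
  assumes "CARD('n) \<ge> 3" and "a \<noteq> b"
  shows "\<exists>(M :: ((real^'n) set, 'n) riem) K K'.
      riemannian_manifold M \<and> orientable (mtop M) (atlas M) \<and>
      connected_space (mtop M) \<and> complete_riem M \<and> \<not> hyperbolic M \<and>
      compactin (mtop M) K \<and> compactin (mtop (hyperbolic_quotient a b)) K' \<and>
      (\<forall>c\<in>atlas M. \<forall>x\<in>fst c.
         scalar_curvature (metric M c) x \<ge> - (real CARD('n) * (real CARD('n) - 1))) \<and>
      isometric_subsets M (topspace (mtop M) - K)
        (hyperbolic_quotient a b) (topspace (mtop (hyperbolic_quotient a b)) - K')"
proof -
  have "\<not> UNIV \<subseteq> {a, b}"
    using assms card_mono[of "{a, b}" "UNIV :: 'n set"] by auto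
  then obtain c where c: "c \<noteq> a" "c \<noteq> b" by blast
  interpret cap a b c by unfold_locales (use c assms(2) in auto)
  have "riemannian_manifold M"
    by (rule riemannian_manifold_quot[OF smooth_metric symmetric_metric positive_metric periodic_metric])
  moreover have "orientable (mtop M) (atlas M)" using orientable_quot by simp
  moreover have "connected_space (mtop M)" using connected_quot[OF connected_W] by simp
  moreover have "compactin (mtop M) (orbit a b ` K)" using compactin_quot[OF compact_K K_subset] by simp
  moreover have "compactin (mtop (hyperbolic_quotient a b)) (orbit a b ` K')"
    using H.compactin_quot[OF compact_K' K'_subset] by (simp add: hyperbolic_quotient_eq)
  moreover have "\<forall>c\<in>atlas M. \<forall>x\<in>fst c.
      scalar_curvature (metric M c) x \<ge> - (real CARD('n) * (real CARD('n) - 1))"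
    using scalar_curvature_bounds(1) by (auto dest!: subsetD)
  ultimately show ?thesis
    using complete_cap not_hyperbolic_cap isometric_ends by blast
qed

end
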